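(* Let $\Omega\subset\mathbb R^N$ be a bounded Lipschitz domain, $s\in(0,1)$, $\alpha>0$, $y^\delta\in L^2(\Omega)$, and let $K:H_0^s(\Omega)\to L^2(\Omega)$ be bounded and linear. Introduce the transformed variable $z=A_s^{1/2}u$, $u=A_s^{-1/2}z$, define $B:=KA_s^{-1/2}$, and define $\widetilde J_\alpha:L^2(\Omega)\to\mathbb R$ by $$\widetilde J_\alpha(z)=\frac12\|Bz-y^\delta\|_{L^2(\Omega)}^2+\frac{\alpha}{2}\|z\|_{L^2(\Omega)}^2 .$$ Let $$J_\alpha(u)=\frac12\|Ku-y^\delta\|_{L^2(\Omega)}^2+\frac{\alpha}{2}\|u\|_{H_0^s(\Omega)}^2,\qquad u\in H_0^s(\Omega).$$ Then the problem $\min_{u\in H_0^s(\Omega)}J_\alpha(u)$ is equivalent, under this change of variables, to the problem $\min_{z\in L^2(\Omega)}\widetilde J_\alpha(z)$. Moreover, if $z_\alpha^\delta$ denotes the unique minimizer of $\widetilde J_\alpha$, then the minimizer of $J_\alpha$ is $$u_\alpha^\delta=A_s^{-1/2}z_\alpha^\delta .$$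
   Context: All spaces are real. $H_0^s(\Omega)$ is the space of functions $u\in H^s(\mathbb R^N)$ with $u=0$ a.e. in $\mathbb R^N\setminus\Omega$ (also regarded as functions on $\Omega$). On $H_0^s(\Omega)$ consider the closed, symmetric, coercive bilinear form $$a_s(u,v)=\int_\Omega uv\,dx+\frac{C_{N,s}}{2}\iint_{\mathbb R^{2N}}\frac{(u(x)-u(y))(v(x)-v(y))}{|x-y|^{N+2s}}\,dx\,dy,$$ where $C_{N,s}>0$ is the standard normalization constant of the integral fractional Laplacian, $C_{N,s}=\frac{4^s s\,\Gamma(N/2+s)}{\pi^{N/2}\Gamma(1-s)}$. $H_0^s(\Omega)$ is a Hilbert space with norm $\|u\|_{H_0^s(\Omega)}^2=a_s(u,u)$. $A_s=I+(-\Delta)^s$ is the unique positive self-adjoint operator on $L^2(\Omega)$ associated with $a_s$; powers are defined by the spectral theorem. $A_s^{1/2}$ is an isometric isomorphism of $D(A_s^{1/2})=H_0^s(\Omega)$ onto $L^2(\Omega)$ with inverse $A_s^{-1/2}:L^2(\Omega)\to H_0^s(\Omega)$. *)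

theory Defs
  imports "HOL-Analysis.Analysis"
begin

section \<open>The real Hilbert space of square integrable functions\<close>

text \<open>Elements are almost-everywhere classes of Borel functions; every Lebesgue measurable
  class has a Borel representative.\<close>

definition square_integrable :: "('a::euclidean_space \<Rightarrow> real) \<Rightarrow> bool" where
  "square_integrable f \<longleftrightarrow> f \<in> borel_measurable lborel \<and> integrable lborel (\<lambda>x. (f x)\<^sup>2)"

definition L2_rel :: "('a::euclidean_space \<Rightarrow> real) \<Rightarrow> ('a \<Rightarrow> real) \<Rightarrow> bool" where
  "L2_rel f g \<longleftrightarrow> square_integrable f \<and> square_integrable g \<and> (AE x in lborel. f x = g x)"

lemma square_integrable_mult:
  assumes "square_integrable f" "square_integrable g"
  shows "integrable lborel (\<lambda>x. f x * g x)"
proof (rule Bochner_Integration.integrable_bound)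
  show "integrable lborel (\<lambda>x. (f x)\<^sup>2 + (g x)\<^sup>2)"
    using assms by (auto simp: square_integrable_def)
  show "(\<lambda>x. f x * g x) \<in> borel_measurable lborel"
    using assms by (auto simp: square_integrable_def)
  have "\<bar>a * b\<bar> \<le> a\<^sup>2 + b\<^sup>2" for a b :: real
  proof -
    have "2 * (\<bar>a\<bar> * \<bar>b\<bar>) \<le> a\<^sup>2 + b\<^sup>2"
      using sum_squares_bound[of "\<bar>a\<bar>" "\<bar>b\<bar>"] by simp
    moreover have "0 \<le> \<bar>a\<bar> * \<bar>b\<bar>" by simp
    ultimately show ?thesis unfolding abs_mult by linarith
  qed
  then show "AE x in lborel. norm (f x * g x) \<le> norm ((f x)\<^sup>2 + (g x)\<^sup>2)"
    by simp
qed

lemma square_integrable_zero: "square_integrable (\<lambda>_. 0)"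
  by (simp add: square_integrable_def)

lemma square_integrable_add:
  assumes "square_integrable f" "square_integrable g"
  shows "square_integrable (\<lambda>x. f x + g x)"
proof -
  have "integrable lborel (\<lambda>x. (f x)\<^sup>2 + (g x)\<^sup>2 + 2 * (f x * g x))"
    using assms square_integrable_mult[OF assms] by (simp add: square_integrable_def)
  then show ?thesis
    using assms by (auto simp: square_integrable_def power2_sum mult.assoc)
qed

lemma square_integrable_scale:
  "square_integrable f \<Longrightarrow> square_integrable (\<lambda>x. c * f x)"
  by (auto simp: square_integrable_def power_mult_distrib)

lemma square_integrable_uminus:
  "square_integrable f \<Longrightarrow> square_integrable (\<lambda>x. - f x)"
  using square_integrable_scale[of f "-1"] by simp

lemma square_integrable_diff:
  "square_integrable f \<Longrightarrow> square_integrable g \<Longrightarrow> square_integrable (\<lambda>x. f x - g x)"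
  using square_integrable_add[of f "\<lambda>x. - g x"] square_integrable_uminus[of g] by simp

quotient_type (overloaded) 'a L2 = "'a::euclidean_space \<Rightarrow> real" / partial: L2_rel
  morphisms rep_L2 abs_L2
proof (rule part_equivpI)
  show "\<exists>f :: 'a \<Rightarrow> real. L2_rel f f"
    using square_integrable_zero by (auto simp: L2_rel_def)
  show "symp L2_rel"
    by (auto simp: symp_def L2_rel_def eq_commute)
  show "transp L2_rel"
    unfolding transp_def L2_rel_def by (auto elim: AE_mp)
qed

instantiation L2 :: (euclidean_space) real_inner
begin

lift_definition zero_L2 :: "'a L2" is "\<lambda>_. 0"
  by (simp add: L2_rel_def square_integrable_zero)

lift_definition plus_L2 :: "'a L2 \<Rightarrow> 'a L2 \<Rightarrow> 'a L2" is "\<lambda>f g x. f x + g x"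
  by (auto simp: L2_rel_def intro: square_integrable_add)

lift_definition minus_L2 :: "'a L2 \<Rightarrow> 'a L2 \<Rightarrow> 'a L2" is "\<lambda>f g x. f x - g x"
  by (auto simp: L2_rel_def intro: square_integrable_diff)

lift_definition uminus_L2 :: "'a L2 \<Rightarrow> 'a L2" is "\<lambda>f x. - f x"
  by (auto simp: L2_rel_def intro: square_integrable_uminus)

lift_definition scaleR_L2 :: "real \<Rightarrow> 'a L2 \<Rightarrow> 'a L2" is "\<lambda>c f x. c * f x"
  by (auto simp: L2_rel_def intro: square_integrable_scale)

lift_definition inner_L2 :: "'a L2 \<Rightarrow> 'a L2 \<Rightarrow> real" is "\<lambda>f g. LINT x|lborel. f x * g x"
proof -
  fix f f' g g' :: "'a \<Rightarrow> real"
  assume *: "L2_rel f f'" "L2_rel g g'"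
  show "(LINT x|lborel. f x * g x) = (LINT x|lborel. f' x * g' x)"
  proof (rule integral_cong_AE)
    show "AE x in lborel. f x * g x = f' x * g' x"
      using * by (auto simp: L2_rel_def)
  qed (use * in \<open>auto simp: L2_rel_def dest: square_integrable_mult\<close>)
qed

definition norm_L2 :: "'a L2 \<Rightarrow> real" where "norm_L2 u = sqrt (inner u u)"
definition sgn_L2 :: "'a L2 \<Rightarrow> 'a L2" where "sgn_L2 u = inverse (norm u) *\<^sub>R u"
definition dist_L2 :: "'a L2 \<Rightarrow> 'a L2 \<Rightarrow> real" where "dist_L2 u v = norm (u - v)"
definition uniformity_L2 :: "('a L2 \<times> 'a L2) filter" where
  "uniformity_L2 = (INF e\<in>{0<..}. principal {(x, y). dist x y < e})"
definition open_L2 :: "'a L2 set \<Rightarrow> bool" where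
  "open_L2 U \<longleftrightarrow> (\<forall>x\<in>U. eventually (\<lambda>(x', y). x' = x \<longrightarrow> y \<in> U) uniformity)"

instance
proof
  fix u v w :: "'a L2" and a b :: real
  show "u + v + w = u + (v + w)"
    by transfer (auto simp: L2_rel_def add.assoc intro!: square_integrable_add)
  show "u + v = v + u"
    by transfer (auto simp: L2_rel_def add.commute intro!: square_integrable_add)
  show "0 + u = u"
    by transfer (auto simp: L2_rel_def)
  show "- u + u = 0"
    by transfer (auto simp: L2_rel_def square_integrable_zero)
  show "u - v = u + - v"
    by transfer (auto simp: L2_rel_def intro!: square_integrable_diff)
  show "a *\<^sub>R (u + v) = a *\<^sub>R u + a *\<^sub>R v"
    by transfer (auto simp: L2_rel_def distrib_left
        intro!: square_integrable_add square_integrable_scale)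
  show "(a + b) *\<^sub>R u = a *\<^sub>R u + b *\<^sub>R u"
    by transfer (auto simp: L2_rel_def distrib_right
        intro!: square_integrable_add square_integrable_scale)
  show "a *\<^sub>R b *\<^sub>R u = (a * b) *\<^sub>R u"
    by transfer (auto simp: L2_rel_def mult.assoc intro!: square_integrable_scale)
  show "1 *\<^sub>R u = u"
    by transfer (auto simp: L2_rel_def)
  show "dist u v = norm (u - v)" by (rule dist_L2_def)
  show "sgn u = inverse (norm u) *\<^sub>R u" by (rule sgn_L2_def)
  show "(uniformity :: ('a L2 \<times> 'a L2) filter) = (INF e\<in>{0<..}. principal {(x, y). dist x y < e})"
    by (rule uniformity_L2_def)
  show "open U = (\<forall>x\<in>U. eventually (\<lambda>(x', y). x' = x \<longrightarrow> y \<in> U) uniformity)" for U :: "'a L2 set"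
    by (rule open_L2_def)
  show "inner u v = inner v u"
    by transfer (simp add: mult.commute)
  show "inner (u + v) w = inner u w + inner v w"
    by transfer (simp add: L2_rel_def distrib_right square_integrable_mult)
  show "inner (a *\<^sub>R u) v = a * inner u v"
    by transfer (simp add: mult.assoc)
  show "0 \<le> inner u u"
    by transfer simp
  show "(inner u u = 0) = (u = 0)"
  proof transfer
    fix f :: "'a \<Rightarrow> real" assume "L2_rel f f"
    then have f: "square_integrable f" by (simp add: L2_rel_def)
    have "((LINT x|lborel. f x * f x) = 0) = (AE x in lborel. f x * f x = 0)"
      by (rule integral_nonneg_eq_0_iff_AE) (use square_integrable_mult[OF f f] in auto)
    then show "((LINT x|lborel. f x * f x) = 0) = L2_rel f (\<lambda>_. 0)"
      using f by (simp add: L2_rel_def square_integrable_zero)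
  qed
  show "norm u = sqrt (inner u u)" by (rule norm_L2_def)
qed

end


section \<open>Lipschitz domains\<close>

text \<open>Local orthogonal coordinates are given by a unit vector \<open>e\<close>: the last coordinate of \<open>x\<close>
  is \<open>x \<bullet> e\<close>, the remaining ones are the projection \<open>x - (x \<bullet> e) *\<^sub>R e\<close> onto the orthogonal
  complement of \<open>e\<close>. Near each boundary point the domain is the strict subgraph of a Lipschitz
  function of the latter.\<close>

definition bounded_lipschitz_domain :: "'a::euclidean_space set \<Rightarrow> bool" where
  "bounded_lipschitz_domain \<Omega> \<longleftrightarrow>
     open \<Omega> \<and> connected \<Omega> \<and> \<Omega> \<noteq> {} \<and> bounded \<Omega> \<and>
     (\<forall>p \<in> frontier \<Omega>. \<exists>V e \<phi> L. open V \<and> p \<in> V \<and> norm e = 1 \<and>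
        L-lipschitz_on {y. y \<bullet> e = 0} (\<phi> :: 'a \<Rightarrow> real) \<and>
        \<Omega> \<inter> V = {x \<in> V. x \<bullet> e < \<phi> (x - (x \<bullet> e) *\<^sub>R e)})"


section \<open>Function spaces and the bilinear form\<close>

text \<open>Functions on \<open>\<Omega>\<close> are identified with their extensions by zero.\<close>

definition L2_on :: "'a::euclidean_space set \<Rightarrow> 'a L2 set" where
  "L2_on \<Omega> = {u. AE x in lborel. x \<notin> \<Omega> \<longrightarrow> rep_L2 u x = 0}"

text \<open>On the diagonal the quotient below is \<open>0 / 0 = 0\<close>; the diagonal is a null set.\<close>

definition gagliardo_density :: "real \<Rightarrow> 'a::euclidean_space L2 \<Rightarrow> 'a L2 \<Rightarrow> 'a \<times> 'a \<Rightarrow> real" where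
  "gagliardo_density s u v = (\<lambda>(x, y).
     (rep_L2 u x - rep_L2 u y) * (rep_L2 v x - rep_L2 v y) / norm (x - y) powr (real DIM('a) + 2 * s))"

definition fractional_sobolev :: "real \<Rightarrow> 'a::euclidean_space L2 set" where
  "fractional_sobolev s = {u. integrable (lborel \<Otimes>\<^sub>M lborel) (gagliardo_density s u u)}"

definition H0 :: "real \<Rightarrow> 'a::euclidean_space set \<Rightarrow> 'a L2 set" where
  "H0 s \<Omega> = {u \<in> fractional_sobolev s. AE x in lborel. x \<notin> \<Omega> \<longrightarrow> rep_L2 u x = 0}"

definition fractional_laplacian_const :: "nat \<Rightarrow> real \<Rightarrow> real" where
  "fractional_laplacian_const N s =
     4 powr s * s * Gamma (real N / 2 + s) / (pi powr (real N / 2) * Gamma (1 - s))"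

definition sobolev_form ::
    "real \<Rightarrow> 'a::euclidean_space set \<Rightarrow> 'a L2 \<Rightarrow> 'a L2 \<Rightarrow> real" where
  "sobolev_form s \<Omega> u v =
     (LINT x:\<Omega>|lborel. rep_L2 u x * rep_L2 v x) +
     fractional_laplacian_const DIM('a) s / 2 *
       (LINT p|(lborel \<Otimes>\<^sub>M lborel). gagliardo_density s u v p)"

definition H0_norm :: "real \<Rightarrow> 'a::euclidean_space set \<Rightarrow> 'a L2 \<Rightarrow> real" where
  "H0_norm s \<Omega> u = sqrt (sobolev_form s \<Omega> u u)"


section \<open>Unbounded operators and their powers\<close>

text \<open>Here \<open>X\<close> is a closed subspace of the ambient space, regarded as a Hilbert space of its own;
  an unbounded operator in \<open>X\<close> is represented by its graph, and its domain is the
  \<^const>\<open>Domain\<close> of the graph.\<close>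

definition op_apply :: "('h \<times> 'h) set \<Rightarrow> 'h \<Rightarrow> 'h" where
  "op_apply G u = (THE w. (u, w) \<in> G)"

definition linear_between ::
    "'h::real_vector set \<Rightarrow> 'k::real_vector set \<Rightarrow> ('h \<Rightarrow> 'k) \<Rightarrow> bool" where
  "linear_between V W T \<longleftrightarrow>
     (\<forall>u\<in>V. T u \<in> W) \<and>
     (\<forall>u\<in>V. \<forall>v\<in>V. T (u + v) = T u + T v) \<and>
     (\<forall>c. \<forall>u\<in>V. T (c *\<^sub>R u) = c *\<^sub>R T u)"

definition form_operator ::
    "'h::real_inner set \<Rightarrow> 'h set \<Rightarrow> ('h \<Rightarrow> 'h \<Rightarrow> real) \<Rightarrow> ('h \<times> 'h) set" where
  "form_operator X V a = {(u, f). u \<in> V \<and> f \<in> X \<and> (\<forall>v\<in>V. a u v = f \<bullet> v)}"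

definition resolution_of_identity ::
    "'h::real_inner set \<Rightarrow> (real \<Rightarrow> 'h \<Rightarrow> 'h) \<Rightarrow> bool" where
  "resolution_of_identity X E \<longleftrightarrow>
     (\<forall>t. linear_between X X (E t) \<and>
          (\<forall>u\<in>X. E t (E t u) = E t u) \<and>
          (\<forall>u\<in>X. \<forall>v\<in>X. E t u \<bullet> v = u \<bullet> E t v)) \<and>
     (\<forall>r t. \<forall>u\<in>X. r \<le> t \<longrightarrow> E r (E t u) = E r u) \<and>
     (\<forall>u\<in>X. (\<forall>t. continuous (at_right t) (\<lambda>r. E r u)) \<and>
            ((\<lambda>t. E t u) \<longlongrightarrow> 0) at_bot \<and>
            ((\<lambda>t. E t u) \<longlongrightarrow> u) at_top)"

text \<open>The Stieltjes measure \<open>d\<langle>E(t) u, u\<rangle>\<close>.\<close>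

definition spectral_measure ::
    "(real \<Rightarrow> 'h::real_inner \<Rightarrow> 'h) \<Rightarrow> 'h \<Rightarrow> real measure" where
  "spectral_measure E u = interval_measure (\<lambda>t. E t u \<bullet> u)"

definition spectral_domain ::
    "'h::real_inner set \<Rightarrow> (real \<Rightarrow> 'h \<Rightarrow> 'h) \<Rightarrow> (real \<Rightarrow> real) \<Rightarrow> 'h set" where
  "spectral_domain X E f = {u \<in> X. integrable (spectral_measure E u) (\<lambda>t. (f t)\<^sup>2)}"

text \<open>The operator \<open>\<integral> f(t) dE(t)\<close>. Its value \<open>w\<close> at \<open>u\<close> is determined by
  \<open>\<langle>w, v\<rangle> = \<integral> f(t) d\<langle>E(t) u, v\<rangle>\<close>, where the signed measure on the right is written by
  polarization. Testing is restricted to \<open>v\<close> in the (dense) domain because otherwise the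
  two polarized integrals need not exist separately.\<close>

definition spectral_integral ::
    "'h::real_inner set \<Rightarrow> (real \<Rightarrow> 'h \<Rightarrow> 'h) \<Rightarrow> (real \<Rightarrow> real) \<Rightarrow> ('h \<times> 'h) set" where
  "spectral_integral X E f = {(u, w). u \<in> spectral_domain X E f \<and> w \<in> X \<and>
     (\<forall>v \<in> spectral_domain X E f.
        w \<bullet> v = ((LINT t|spectral_measure E (u + v). f t) -
                 (LINT t|spectral_measure E (u - v). f t)) / 4)}"

text \<open>Powers of a positive self-adjoint operator \<open>G\<close> by functional calculus: if
  \<open>G = \<integral> t dE(t)\<close>, then \<open>G\<^sup>r = \<integral> t\<^sup>r dE(t)\<close>. The spectral theorem provides a
  resolution of the identity, whose restriction to \<open>X\<close> is unique.\<close>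

definition op_power ::
    "'h::real_inner set \<Rightarrow> ('h \<times> 'h) set \<Rightarrow> real \<Rightarrow> ('h \<times> 'h) set" where
  "op_power X G r =
     spectral_integral X
       (SOME E. resolution_of_identity X E \<and> G = spectral_integral X E (\<lambda>t. t))
       (\<lambda>t. t powr r)"

definition A_op :: "real \<Rightarrow> 'a::euclidean_space set \<Rightarrow> ('a L2 \<times> 'a L2) set" where
  "A_op s \<Omega> = form_operator (L2_on \<Omega>) (H0 s \<Omega>) (sobolev_form s \<Omega>)"

definition A_pow :: "real \<Rightarrow> 'a::euclidean_space set \<Rightarrow> real \<Rightarrow> 'a L2 \<Rightarrow> 'a L2" where
  "A_pow s \<Omega> r = op_apply (op_power (L2_on \<Omega>) (A_op s \<Omega>) r)"


section \<open>The two minimization problems\<close>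

definition bounded_linear_H0_L2 ::
    "real \<Rightarrow> 'a::euclidean_space set \<Rightarrow> ('a L2 \<Rightarrow> 'a L2) \<Rightarrow> bool" where
  "bounded_linear_H0_L2 s \<Omega> K \<longleftrightarrow>
     linear_between (H0 s \<Omega>) (L2_on \<Omega>) K \<and>
     (\<exists>M. \<forall>u \<in> H0 s \<Omega>. norm (K u) \<le> M * H0_norm s \<Omega> u)"

definition J_fun ::
    "real \<Rightarrow> 'a::euclidean_space set \<Rightarrow> ('a L2 \<Rightarrow> 'a L2) \<Rightarrow> 'a L2 \<Rightarrow> real \<Rightarrow> 'a L2 \<Rightarrow> real" where
  "J_fun s \<Omega> K y \<alpha> u = 1 / 2 * (norm (K u - y))\<^sup>2 + \<alpha> / 2 * (H0_norm s \<Omega> u)\<^sup>2"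

definition J_tilde ::
    "real \<Rightarrow> 'a::euclidean_space set \<Rightarrow> ('a L2 \<Rightarrow> 'a L2) \<Rightarrow> 'a L2 \<Rightarrow> real \<Rightarrow> 'a L2 \<Rightarrow> real" where
  "J_tilde s \<Omega> K y \<alpha> z =
     (let B = K \<circ> A_pow s \<Omega> (- 1 / 2)
      in 1 / 2 * (norm (B z - y))\<^sup>2 + \<alpha> / 2 * (norm z)\<^sup>2)"

end

theory Submission
  imports Defs "HOL-Probability.Distribution_Functions"
begin

text \<open>The operator \<open>A\<close> of the form \<open>a\<close> is positive with a bounded symmetric inverse \<open>T\<close>
  (Lax--Milgram), so no compactness is needed for its spectral theorem: \<open>E t\<close> is the projection onto
  the kernel of the positive part of \<open>1 - t T\<close>, on which \<open>A \<le> t\<close>, while \<open>A \<ge> t\<close> on its orthogonal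
  complement. The powers of \<open>A\<close> are built from an arbitrarily chosen resolution of the identity, hence
  the calculus is developed for all of them. Coercivity forces its support into \<open>[1, \<infinity>)\<close>, where
  \<open>R = \<integral> t powr (- 1 / 2) dE(t)\<close> is bounded and satisfies \<open>R\<^sup>2 = T\<close>. From \<open>a (T f) (T f) = f \<bullet> T f = (norm (R f))\<^sup>2\<close>
  and density, \<open>R\<close> is an isometry of \<open>L2\<close> onto the energy space, so that the two functionals
  correspond to each other; the transformed one is strongly convex.\<close>

section \<open>Hilbert space preliminaries\<close>

text \<open>The definition of \<open>spectral_integral\<close> sees \<open>d<E(t) u, v>\<close> only
  through polarized differences of spectral measures, tested on vectors of the domain. No signed
  measures are formed: each identity becomes a vanishing linear combination of finite measures,
  which is checked on distribution functions and then integrated. An unbounded function is handled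
  through its reciprocal, bounded on the spectrum: the graph of its integral is the transposed graph
  of a bounded operator. This serves the square root, and also \<open>A\<close> itself, once the
  integral of \<open>1 / t\<close> is known to be \<open>T\<close>. That fact is a comparison of
  increments: on the range of \<open>E b - E a\<close> both lie between \<open>1 / b\<close> and
  \<open>1 / a\<close>, and the errors vanish under refinement. Two analytic facts feed the abstract
  theory: the energy is complete, by Fatou's lemma along an a.e. convergent subsequence, and the
  energy space is dense because it contains Lipschitz bumps, for which the kernel must be integrable
  near 0 (\<open>s < 1\<close>) and at infinity (\<open>0 < s\<close>).\<close>

lemma discriminant_le:
  fixes q b c :: real
  assumes "\<And>t. 0 \<le> t\<^sup>2 * q + 2 * t * b + c" and "0 \<le> q"
  shows "b\<^sup>2 \<le> q * c"
proof (cases "q = 0")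
  case True
  have "b = 0"
  proof (rule ccontr)
    assume "b \<noteq> 0"
    \<comment> \<open>For \<open>q = 0\<close> the polynomial is affine in \<open>t\<close>, and
      this point is chosen to give it the value -1.\<close>
    then have "2 * (- (c + 1) / (2 * b)) * b + c = -1" by (simp add: field_simps)
    with assms(1)[of "- (c + 1) / (2 * b)"] True show False by simp
  qed
  with True show ?thesis by simp
next
  case False
  then have "0 < q" using assms(2) by simp
  have "0 \<le> q * ((- b / q)\<^sup>2 * q + 2 * (- b / q) * b + c)"
    by (rule mult_nonneg_nonneg[OF assms(2,1)])
  also have "\<dots> = q * c - b\<^sup>2"
    using False by (simp add: field_simps power2_eq_square)
  finally show ?thesis by simp
qed

text \<open>A Hilbert space structure on a subspace. Completeness is phrased through
  \<open>a\<close> alone, since the type carries no norm. Instances are the inner product on closed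
  subspaces, the Sobolev form, and the form of the normal equation.\<close>

locale complete_form =
  fixes V :: "'h::real_vector set" and a :: "'h \<Rightarrow> 'h \<Rightarrow> real"
  assumes V: "subspace V"
    and add_left: "\<And>u v w. u \<in> V \<Longrightarrow> v \<in> V \<Longrightarrow> w \<in> V \<Longrightarrow> a (u + v) w = a u w + a v w"
    and scale_left: "\<And>c u w. u \<in> V \<Longrightarrow> w \<in> V \<Longrightarrow> a (c *\<^sub>R u) w = c * a u w"
    and sym: "\<And>u v. u \<in> V \<Longrightarrow> v \<in> V \<Longrightarrow> a u v = a v u"
    and nonneg: "\<And>u. u \<in> V \<Longrightarrow> 0 \<le> a u u"
    and limit_exists: "\<And>x :: nat \<Rightarrow> 'h. (\<And>n. x n \<in> V) \<Longrightarrow>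
      (\<And>e. 0 < e \<Longrightarrow> \<exists>N. \<forall>m\<ge>N. \<forall>n\<ge>N. a (x m - x n) (x m - x n) < e) \<Longrightarrow>
      \<exists>u\<in>V. (\<lambda>n. a (x n - u) (x n - u)) \<longlonglongrightarrow> 0"
begin

lemma add_mem: "u \<in> V \<Longrightarrow> v \<in> V \<Longrightarrow> u + v \<in> V"
  and diff_mem: "u \<in> V \<Longrightarrow> v \<in> V \<Longrightarrow> u - v \<in> V"
  and scale_mem: "u \<in> V \<Longrightarrow> c *\<^sub>R u \<in> V"
  and zero_mem: "0 \<in> V"
  using V by (auto intro: subspace_add subspace_diff subspace_mul subspace_0)

lemma add_right: "u \<in> V \<Longrightarrow> v \<in> V \<Longrightarrow> w \<in> V \<Longrightarrow> a w (u + v) = a w u + a w v"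
  by (metis add_left add_mem sym)

lemma scale_right: "u \<in> V \<Longrightarrow> w \<in> V \<Longrightarrow> a w (c *\<^sub>R u) = c * a w u"
  by (metis scale_left scale_mem sym)

lemma diff_left: "u \<in> V \<Longrightarrow> v \<in> V \<Longrightarrow> w \<in> V \<Longrightarrow> a (u - v) w = a u w - a v w"
  using add_left[of u "(-1) *\<^sub>R v" w] scale_left[of v w "-1"] scale_mem[of v "-1"] by simp

lemma diff_right: "u \<in> V \<Longrightarrow> v \<in> V \<Longrightarrow> w \<in> V \<Longrightarrow> a w (u - v) = a w u - a w v"
  by (metis diff_left diff_mem sym)

lemma square_add_scale:
  assumes "u \<in> V" "v \<in> V"
  shows "a (u + t *\<^sub>R v) (u + t *\<^sub>R v) = a u u + 2 * t * a u v + t\<^sup>2 * a v v"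
  using assms sym[of v u]
  by (simp add: add_left add_right scale_left scale_right add_mem scale_mem power2_eq_square algebra_simps)

lemma Cauchy_Schwarz:
  assumes "u \<in> V" "v \<in> V"
  shows "(a u v)\<^sup>2 \<le> a u u * a v v"
proof -
  have "(a u v)\<^sup>2 \<le> a v v * a u u"
  proof (rule discriminant_le)
    show "0 \<le> t\<^sup>2 * a v v + 2 * t * a u v + a u u" for t
      using nonneg[of "u + t *\<^sub>R v"] square_add_scale[OF assms, of t] assms
      by (simp add: add_mem scale_mem)
  qed (use assms nonneg in auto)
  then show ?thesis by (simp add: mult.commute)
qed

lemma parallelogram:
  assumes "u \<in> V" "v \<in> V"
  shows "a (u - v) (u - v) =
    2 * a u u + 2 * a v v - 4 * a ((1/2) *\<^sub>R (u + v)) ((1/2) *\<^sub>R (u + v))"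
  using assms sym[of v u]
  by (simp add: add_left add_right scale_left scale_right diff_left diff_right
      add_mem scale_mem diff_mem field_simps)

text \<open>A minimizing sequence of the energy \<open>a v v - 2 l v\<close> is Cauchy by the parallelogram
  identity.\<close>

theorem riesz:
  assumes l_add: "\<And>u v. u \<in> V \<Longrightarrow> v \<in> V \<Longrightarrow> l (u + v) = l u + l v"
    and l_scale: "\<And>c u. u \<in> V \<Longrightarrow> l (c *\<^sub>R u) = c * l u"
    and l_bound: "\<And>u. u \<in> V \<Longrightarrow> \<bar>l u\<bar> \<le> M * sqrt (a u u)"
  shows "\<exists>u\<in>V. \<forall>v\<in>V. a u v = l v"
proof -
  define F where "F v = a v v - 2 * l v" for v
  have F_ge: "- M\<^sup>2 \<le> F v" if "v \<in> V" for v
  proof -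
    have "0 \<le> (sqrt (a v v) - M)\<^sup>2" by simp
    also have "\<dots> = a v v - 2 * (M * sqrt (a v v)) + M\<^sup>2"
      using nonneg[OF that] by (simp add: power2_diff)
    finally show ?thesis
      using l_bound[OF that] unfolding F_def by linarith
  qed
  define d where "d = Inf (F ` V)"
  have ne: "F ` V \<noteq> {}" using zero_mem by auto
  have bdd: "bdd_below (F ` V)" using F_ge by (auto intro!: bdd_belowI)
  have d_le: "d \<le> F v" if "v \<in> V" for v
    unfolding d_def using bdd that by (intro cInf_lower) auto
  have "\<exists>v\<in>V. F v < d + 1 / real (Suc n)" for n
  proof -
    have "d < d + 1 / real (Suc n)" by simp
    then show ?thesis
      unfolding d_def using cInf_lessD[OF ne] by blast
  qed
  then obtain x where xV: "\<And>n. x n \<in> V" and xF: "\<And>n. F (x n) < d + 1 / real (Suc n)"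
    by metis
  have near: "a (x m - x n) (x m - x n) \<le> 2 / real (Suc m) + 2 / real (Suc n)" for m n
  proof -
    have "l ((1/2) *\<^sub>R (x m + x n)) = (l (x m) + l (x n)) / 2"
      using xV by (simp add: l_scale l_add add_mem)
    then have "a (x m - x n) (x m - x n) =
      2 * F (x m) + 2 * F (x n) - 4 * F ((1/2) *\<^sub>R (x m + x n))"
      unfolding F_def parallelogram[OF xV xV] by simp
    moreover have "d \<le> F ((1/2) *\<^sub>R (x m + x n))"
      by (intro d_le scale_mem add_mem xV)
    ultimately show ?thesis using xF[of m] xF[of n] by simp
  qed
  have "\<exists>u\<in>V. (\<lambda>n. a (x n - u) (x n - u)) \<longlonglongrightarrow> 0"
  proof (rule limit_exists[OF xV])
    fix e :: real assume "0 < e"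
    then obtain N where N: "1 / real (Suc N) < e / 4"
      using nat_approx_posE[of "e / 4"] by auto
    show "\<exists>N. \<forall>m\<ge>N. \<forall>n\<ge>N. a (x m - x n) (x m - x n) < e"
    proof (intro exI[of _ N] allI impI)
      fix m n assume "N \<le> m" "N \<le> n"
      then have "1 / real (Suc m) \<le> 1 / real (Suc N)" "1 / real (Suc n) \<le> 1 / real (Suc N)"
        by (simp_all add: frac_le)
      then show "a (x m - x n) (x m - x n) < e"
        using near[of m n] N by simp
    qed
  qed
  then obtain u where u: "u \<in> V" and lim: "(\<lambda>n. a (x n - u) (x n - u)) \<longlonglongrightarrow> 0" by blast
  have "a u v = l v" if v: "v \<in> V" for v
  proof -
    \<comment> \<open>\<open>x n\<close> minimizes the energy up to \<open>1 / real (Suc n)\<close>,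
      so the energy along the line in direction \<open>v\<close> gives a nonnegative polynomial in
      \<open>t\<close>. Its discriminant bounds the linear coefficient, which is the defect in the
      weak equation.\<close>
    have 1: "(a (x n) v - l v)\<^sup>2 \<le> a v v * (1 / real (Suc n))" for n
    proof (rule discriminant_le)
      fix t :: real
      have "d \<le> F (x n + t *\<^sub>R v)" by (intro d_le add_mem scale_mem xV v)
      also have "\<dots> = F (x n) + 2 * t * (a (x n) v - l v) + t\<^sup>2 * a v v"
        unfolding F_def using v xV[of n]
        by (simp add: square_add_scale l_add l_scale scale_mem algebra_simps)
      finally show "0 \<le> t\<^sup>2 * a v v + 2 * t * (a (x n) v - l v) + 1 / real (Suc n)"
        using xF[of n] by simp
    qed (use nonneg v in auto)
    have "(\<lambda>n. a v v * (1 / real (Suc n))) \<longlonglongrightarrow> a v v * 0"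
      by (intro tendsto_intros LIMSEQ_Suc[OF lim_1_over_n])
    then have "(\<lambda>n. a v v * (1 / real (Suc n))) \<longlonglongrightarrow> 0" by simp
    then have "(\<lambda>n. (a (x n) v - l v)\<^sup>2) \<longlonglongrightarrow> 0"
      by (rule tendsto_sandwich[OF _ _ tendsto_const, rotated 2]) (intro always_eventually allI 1 zero_le_power2)+
    then have A: "(\<lambda>n. a (x n) v - l v) \<longlonglongrightarrow> 0" by (simp add: tendsto_null_power)
    have "(\<lambda>n. a (x n - u) (x n - u) * a v v) \<longlonglongrightarrow> 0 * a v v"
      by (intro tendsto_intros lim)
    then have "(\<lambda>n. a (x n - u) (x n - u) * a v v) \<longlonglongrightarrow> 0" by simp
    then have "(\<lambda>n. (a (x n - u) v)\<^sup>2) \<longlonglongrightarrow> 0"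
      by (rule tendsto_sandwich[OF _ _ tendsto_const, rotated 2])
        (auto intro!: always_eventually Cauchy_Schwarz diff_mem xV u v)
    then have B: "(\<lambda>n. a (x n - u) v) \<longlonglongrightarrow> 0" by (simp add: tendsto_null_power)
    have "(\<lambda>n. (a (x n) v - l v) - a (x n - u) v) \<longlonglongrightarrow> 0 - 0"
      by (intro tendsto_diff A B)
    then have "(\<lambda>n. a u v - l v) \<longlonglongrightarrow> 0"
      using xV u v by (simp add: diff_left)
    then show ?thesis by (simp add: tendsto_const_iff LIMSEQ_const_iff)
  qed
  with u show ?thesis by blast
qed

end

lemma complete_form_inner:
  fixes X :: "'h::real_inner set"
  assumes "subspace X" "complete X"
  shows "complete_form X (\<bullet>)"
proof
  fix x :: "nat \<Rightarrow> 'h"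
  assume x: "\<And>n. x n \<in> X"
    and C: "\<And>e. 0 < e \<Longrightarrow> \<exists>N. \<forall>m\<ge>N. \<forall>n\<ge>N. (x m - x n) \<bullet> (x m - x n) < e"
  have "Cauchy x"
  proof (rule metric_CauchyI)
    fix e :: real assume "0 < e"
    then obtain N where "\<forall>m\<ge>N. \<forall>n\<ge>N. (x m - x n) \<bullet> (x m - x n) < e\<^sup>2"
      using C[of "e\<^sup>2"] by auto
    then show "\<exists>N. \<forall>m\<ge>N. \<forall>n\<ge>N. dist (x m) (x n) < e"
      using \<open>0 < e\<close>
      by (metis dist_norm less_eq_real_def power2_less_imp_less power2_norm_eq_inner)
  qed
  then obtain u where "u \<in> X" "x \<longlonglongrightarrow> u"
    using assms(2) x unfolding complete_def by blast
  moreover from this have "(\<lambda>n. (x n - u) \<bullet> (x n - u)) \<longlonglongrightarrow> (u - u) \<bullet> (u - u)"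
    by (intro tendsto_intros)
  ultimately show "\<exists>u\<in>X. (\<lambda>n. (x n - u) \<bullet> (x n - u)) \<longlonglongrightarrow> 0" by auto
qed (use assms in \<open>auto simp: inner_add_left inner_commute[of _ "_ :: 'h"] inner_add_right\<close>)

lemma orthogonal_projection:
  fixes N :: "'h::real_inner set"
  assumes "subspace N" "complete N"
  shows "\<exists>w\<in>N. \<forall>v\<in>N. w \<bullet> v = u \<bullet> v"
proof -
  interpret complete_form N "(\<bullet>)" by (rule complete_form_inner[OF assms])
  show ?thesis
    by (rule riesz[of _ "norm u"])
      (auto simp: inner_add_right Cauchy_Schwarz_ineq2 simp flip: norm_eq_sqrt_inner)
qed

section \<open>Linear relations between measures on the line\<close>

text \<open>A Dynkin system argument over the closed half lines. Zero combinations of finite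
  measures take the place of identities between signed measures.\<close>

lemma measure_linear_relation:
  fixes M :: "'i \<Rightarrow> real measure" and c :: "'i \<Rightarrow> real"
  assumes fin: "\<And>i. i \<in> I \<Longrightarrow> finite_borel_measure (M i)"
    and rel: "\<And>t. (\<Sum>i\<in>I. c i * measure (M i) {..t}) = 0"
    and A: "A \<in> sets borel"
  shows "(\<Sum>i\<in>I. c i * measure (M i) A) = 0"
proof -
  have borel: "sets (borel :: real measure) = sigma_sets UNIV (range (\<lambda>a. {..a}))"
    by (subst borel_eq_atMost) auto
  have space: "space (M i) = UNIV" if "i \<in> I" for i
    using fin[OF that] by (rule finite_borel_measure.borel_UNIV)
  have sets: "sets (M i) = sets borel" if "i \<in> I" for i
    using fin[OF that] by (rule finite_borel_measure.M_is_borel)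
  \<comment> \<open>Closure under complements needs the relation for the whole line, which is the
    limit of growing half lines.\<close>
  have total: "(\<Sum>i\<in>I. c i * measure (M i) UNIV) = 0"
  proof -
    have "(\<lambda>n. \<Sum>i\<in>I. c i * cdf (M i) (real n)) \<longlonglongrightarrow> (\<Sum>i\<in>I. c i * measure (M i) UNIV)"
      by (intro tendsto_intros)
        (use finite_borel_measure.cdf_lim_infty[OF fin] space in auto)
    then show ?thesis
      by (simp add: cdf_def rel LIMSEQ_const_iff)
  qed
  have "Int_stable (range (\<lambda>a::real. {..a}))"
    by (auto simp: Int_stable_def)
  moreover have "range (\<lambda>a::real. {..a}) \<subseteq> Pow UNIV" by auto
  moreover have "A \<in> sigma_sets UNIV (range (\<lambda>a. {..a}))" using A borel by simp
  ultimately show ?thesis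
  proof (induction rule: sigma_sets_induct_disjoint)
    case (compl B)
    then have "measure (M i) (UNIV - B) = measure (M i) UNIV - measure (M i) B" if "i \<in> I" for i
      using finite_measure.finite_measure_compl[of "M i" B] fin[OF that] space[OF that]
        sets[OF that] borel
      by (simp add: finite_borel_measure_def)
    then have "(\<Sum>i\<in>I. c i * measure (M i) (UNIV - B)) =
        (\<Sum>i\<in>I. c i * measure (M i) UNIV) - (\<Sum>i\<in>I. c i * measure (M i) B)"
      by (simp add: right_diff_distrib sum_subtractf)
    with compl total show ?case by simp
  next
    case (union B)
    have "(\<lambda>n. \<Sum>i\<in>I. c i * measure (M i) (B n)) sums (\<Sum>i\<in>I. c i * measure (M i) (\<Union>n. B n))"
      using union(1,2) fin sets borel
      by (intro sums_sum sums_mult finite_measure.finite_measure_UNION)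
        (auto simp: finite_borel_measure_def)
    then show ?case using union(3) by (simp add: sums_iff)
  qed (use rel in auto)
qed

text \<open>The simple approximants are chosen on the Borel space and are therefore the same for
  every \<open>M i\<close>; the bound \<open>2 * \<bar>f t\<bar>\<close> serves dominated
  convergence for each of them.\<close>

lemma integral_linear_relation:
  fixes M :: "'i \<Rightarrow> real measure" and c :: "'i \<Rightarrow> real" and f :: "real \<Rightarrow> real"
  assumes fin: "\<And>i. i \<in> I \<Longrightarrow> finite_borel_measure (M i)"
    and rel: "\<And>t. (\<Sum>i\<in>I. c i * measure (M i) {..t}) = 0"
    and f: "\<And>i. i \<in> I \<Longrightarrow> integrable (M i) f" "f \<in> borel_measurable borel"
  shows "(\<Sum>i\<in>I. c i * (LINT t|M i. f t)) = 0"
proof -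
  obtain F where F: "\<And>n. simple_function borel (F n)" "\<And>t. (\<lambda>n. F n t) \<longlonglongrightarrow> f t"
    "\<And>n t. \<bar>F n t\<bar> \<le> 2 * \<bar>f t\<bar>"
    using borel_measurable_implies_sequence_metric[OF f(2), of 0] by auto
  have "(\<Sum>i\<in>I. c i * (LINT t|M i. F n t)) = 0" for n
  proof -
    have fin_range: "finite (range (F n))" and sets: "\<And>y. F n -` {y} \<in> sets borel"
      using F(1)[of n] simple_functionD[of borel "F n"] by auto
    have *: "F n t = (\<Sum>y\<in>range (F n). y * indicator (F n -` {y}) t)" for t
      by (rule simple_function_indicator_representation_banach[OF F(1)[of n], of t, simplified space_borel Int_UNIV_right real_scaleR_def mult.commute[of "indicator _ _"]]) simp
    have "(LINT t|M i. F n t) = (\<Sum>y\<in>range (F n). y * measure (M i) (F n -` {y}))" if "i \<in> I" for i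
    proof -
      interpret finite_borel_measure "M i" by (rule fin[OF that])
      have "(LINT t|M i. F n t) = (LINT t|M i. (\<Sum>y\<in>range (F n). y * indicator (F n -` {y}) t))"
        by (rule Bochner_Integration.integral_cong[OF refl *])
      also have "\<dots> = (\<Sum>y\<in>range (F n). LINT t|M i. y * indicator (F n -` {y}) t)"
        by (subst Bochner_Integration.integral_sum)
          (auto intro!: integrable_mult_right integrable_real_indicator
            simp: sets M_is_borel less_top[symmetric])
      also have "\<dots> = (\<Sum>y\<in>range (F n). y * measure (M i) (F n -` {y}))"
        by (simp add: sets M_is_borel borel_UNIV)
      finally show ?thesis .
    qed
    then have "(\<Sum>i\<in>I. c i * (LINT t|M i. F n t)) =
        (\<Sum>i\<in>I. \<Sum>y\<in>range (F n). y * (c i * measure (M i) (F n -` {y})))"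
      by (intro sum.cong refl) (simp add: sum_distrib_left mult.left_commute)
    also have "\<dots> = (\<Sum>y\<in>range (F n). y * (\<Sum>i\<in>I. c i * measure (M i) (F n -` {y})))"
      by (subst sum.swap) (simp add: sum_distrib_left)
    also have "\<dots> = 0"
      by (simp add: measure_linear_relation[OF fin rel sets])
    finally show ?thesis .
  qed
  moreover have "(\<lambda>n. \<Sum>i\<in>I. c i * (LINT t|M i. F n t)) \<longlonglongrightarrow> (\<Sum>i\<in>I. c i * (LINT t|M i. f t))"
  proof (intro tendsto_intros)
    fix i assume i: "i \<in> I"
    interpret finite_borel_measure "M i" by (rule fin[OF i])
    show "(\<lambda>n. LINT t|M i. F n t) \<longlonglongrightarrow> (LINT t|M i. f t)"
    proof (rule integral_dominated_convergence)
      show "integrable (M i) (\<lambda>t. 2 * \<bar>f t\<bar>)" using f(1)[OF i] by auto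
      show "F n \<in> borel_measurable (M i)" for n
        using F(1)[of n] borel_measurable_simple_function
        by (auto simp: measurable_cong_sets[OF M_is_borel refl])
    qed (use f(1)[OF i] F in auto)
  qed
  ultimately show ?thesis by (simp add: LIMSEQ_const_iff)
qed

text \<open>In this form a concrete identity between a few spectral measures can be written down
  directly, even if some of the measures coincide.\<close>

lemma integral_linear_relation_list:
  fixes ps :: "(real \<times> real measure) list" and f :: "real \<Rightarrow> real"
  assumes "\<And>c M. (c, M) \<in> set ps \<Longrightarrow> finite_borel_measure M \<and> integrable M f"
    and "\<And>t. (\<Sum>(c, M)\<leftarrow>ps. c * measure M {..t}) = 0"
    and "f \<in> borel_measurable borel"
  shows "(\<Sum>(c, M)\<leftarrow>ps. c * (LINT t|M. f t)) = 0"
proof -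
  have *: "(\<Sum>(c, M)\<leftarrow>ps. c * h M) = (\<Sum>i<length ps. fst (ps ! i) * h (snd (ps ! i)))"
    for h :: "real measure \<Rightarrow> real"
    by (simp add: sum_list_sum_nth case_prod_beta atLeast0LessThan)
  have "finite_borel_measure (snd (ps ! i)) \<and> integrable (snd (ps ! i)) f" if "i < length ps" for i
    using assms(1)[of "fst (ps ! i)" "snd (ps ! i)"] that by simp
  then show ?thesis
    using assms(2,3) unfolding * by (intro integral_linear_relation) auto
qed

lemma finite_borel_measure_density:
  assumes "finite_borel_measure M" and g: "g \<in> borel_measurable borel" "\<And>t. 0 \<le> g t"
    and "integrable M g"
  shows "finite_borel_measure (density M (\<lambda>t. ennreal (g t)))"
    and "\<And>t. measure (density M (\<lambda>t. ennreal (g t))) {..t} = (LINT r|M. indicator {..t} r * g r)"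
proof -
  interpret finite_borel_measure M by fact
  have "emeasure (density M g) (space M) = ennreal (LINT t|M. g t)"
    using assms by (simp add: emeasure_density measurable_cong_sets[OF M_is_borel refl]
        nn_integral_eq_integral cong: nn_integral_cong)
  then show *: "finite_borel_measure (density M (\<lambda>t. ennreal (g t)))"
    by (intro finite_borel_measure.intro finite_measureI) (auto simp: finite_borel_measure_axioms_def M_is_borel)
  fix t
  have "measure (density M g) {..t} = (LINT r|density M g. indicator {..t} r)"
    by (simp add: M_is_borel borel_UNIV)
  also have "\<dots> = (LINT r|M. g r *\<^sub>R indicator {..t} r)"
    using g by (intro integral_density) (auto simp: measurable_cong_sets[OF M_is_borel refl])
  finally show "measure (density M (\<lambda>t. ennreal (g t))) {..t} = (LINT r|M. indicator {..t} r * g r)"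
    by (simp add: mult.commute)
qed

section \<open>Functional calculus of a resolution of the identity\<close>

locale spectral_family =
  fixes X :: "'h::real_inner set" and E :: "real \<Rightarrow> 'h \<Rightarrow> 'h"
  assumes X: "subspace X" "complete X"
    and res: "resolution_of_identity X E"
begin

sublocale complete_form X "(\<bullet>)"
  by (rule complete_form_inner[OF X])

lemma E_mem: "u \<in> X \<Longrightarrow> E t u \<in> X"
  and E_add: "u \<in> X \<Longrightarrow> v \<in> X \<Longrightarrow> E t (u + v) = E t u + E t v"
  and E_scale: "u \<in> X \<Longrightarrow> E t (c *\<^sub>R u) = c *\<^sub>R E t u"
  and E_idem: "u \<in> X \<Longrightarrow> E t (E t u) = E t u"
  and E_sym: "u \<in> X \<Longrightarrow> v \<in> X \<Longrightarrow> E t u \<bullet> v = u \<bullet> E t v"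
  and E_le: "u \<in> X \<Longrightarrow> r \<le> t \<Longrightarrow> E r (E t u) = E r u"
  and E_right_cont: "u \<in> X \<Longrightarrow> continuous (at_right t) (\<lambda>r. E r u)"
  and E_at_bot: "u \<in> X \<Longrightarrow> ((\<lambda>t. E t u) \<longlongrightarrow> 0) at_bot"
  and E_at_top: "u \<in> X \<Longrightarrow> ((\<lambda>t. E t u) \<longlongrightarrow> u) at_top"
  using res unfolding resolution_of_identity_def linear_between_def by blast+

lemma E_diff: "u \<in> X \<Longrightarrow> v \<in> X \<Longrightarrow> E t (u - v) = E t u - E t v"
  using E_add[of u "(-1) *\<^sub>R v" t] E_scale[of v t "-1"] scale_mem[of v "-1"] by simp

lemma eq_if_inner_eq:
  assumes "u \<in> X" "v \<in> X" "\<And>w. w \<in> X \<Longrightarrow> u \<bullet> w = v \<bullet> w"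
  shows "u = v"
proof -
  have "(u - v) \<bullet> (u - v) = 0"
    using assms(3)[OF diff_mem[OF assms(1,2)]] by (simp add: inner_diff_left)
  then show ?thesis by simp
qed

text \<open>The axioms give only the composition with the smaller parameter outside; symmetry of the
  projections yields the other order.\<close>

lemma E_E: "u \<in> X \<Longrightarrow> E r (E t u) = E (min r t) u"
proof (cases "r \<le> t")
  case False
  assume u: "u \<in> X"
  have "E r (E t u) = E t u"
  proof (rule eq_if_inner_eq)
    fix v assume v: "v \<in> X"
    have "E r (E t u) \<bullet> v = u \<bullet> E t (E r v)"
      using u v by (simp add: E_sym E_mem)
    also have "\<dots> = E t u \<bullet> v"
      using u v False by (simp add: E_le E_sym)
    finally show "E r (E t u) \<bullet> v = E t u \<bullet> v" .
  qed (use u in \<open>auto intro: E_mem\<close>)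
  with False show ?thesis by simp
qed (simp add: E_le)

lemma E_inner_self: "u \<in> X \<Longrightarrow> E t u \<bullet> u = (norm (E t u))\<^sup>2"
  by (metis E_idem E_mem E_sym power2_norm_eq_inner)

lemma norm_E_le:
  assumes "u \<in> X" shows "norm (E t u) \<le> norm u"
proof -
  have "(norm (E t u))\<^sup>2 \<le> norm (E t u) * norm u"
    using E_inner_self[OF assms] Cauchy_Schwarz_ineq2[of "E t u" u] by (metis abs_le_D1)
  then show ?thesis
    by (cases "E t u = 0") (auto simp: power2_eq_square)
qed

lemma cdf_mono: "u \<in> X \<Longrightarrow> r \<le> t \<Longrightarrow> E r u \<bullet> u \<le> E t u \<bullet> u"
  using norm_E_le[of "E t u" r] by (simp add: E_inner_self E_le E_mem power_mono)

section \<open>Spectral measures of single vectors\<close>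

abbreviation "mu \<equiv> spectral_measure E"

lemma
  assumes u: "u \<in> X"
  shows finite_mu: "finite_borel_measure (mu u)"
    and measure_mu_atMost: "measure (mu u) {..t} = E t u \<bullet> u"
    and measure_mu_UNIV: "measure (mu u) UNIV = (norm u)\<^sup>2"
proof -
  have bot: "((\<lambda>t. E t u \<bullet> u) \<longlongrightarrow> 0) at_bot"
    using tendsto_inner[OF E_at_bot[OF u] tendsto_const[of u]] by simp
  have top: "((\<lambda>t. E t u \<bullet> u) \<longlongrightarrow> u \<bullet> u) at_top"
    by (intro tendsto_inner E_at_top u tendsto_const)
  have right: "continuous (at_right t) (\<lambda>t. E t u \<bullet> u)" for t
    using E_right_cont[OF u, of t] unfolding continuous_within by (intro tendsto_intros)
  show "finite_borel_measure (mu u)"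
    unfolding spectral_measure_def
    by (rule finite_borel_measure_interval_measure[OF cdf_mono[OF u] right bot top]) auto
  show "measure (mu u) {..t} = E t u \<bullet> u"
    unfolding spectral_measure_def
    by (rule measure_interval_measure_Iic[OF cdf_mono[OF u] right bot])
  have "emeasure (mu u) UNIV = u \<bullet> u"
    unfolding spectral_measure_def
    by (rule interval_measure_UNIV[OF cdf_mono[OF u] right bot top]) auto
  then show "measure (mu u) UNIV = (norm u)\<^sup>2"
    by (simp add: measure_def power2_norm_eq_inner)
qed

lemma sets_mu [measurable_cong, simp]: "sets (mu u) = sets borel"
  by (simp add: spectral_measure_def)

lemma space_mu [simp]: "space (mu u) = UNIV"
  by (simp add: spectral_measure_def)

lemma borel_mu: "f \<in> borel_measurable borel \<Longrightarrow> f \<in> borel_measurable (mu u)"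
  by (simp add: measurable_cong_sets[OF sets_mu refl])

text \<open>The distribution function of the polarized measure is bilinear. The linear relations for
  \<open>polar\<close> are reduced to this fact.\<close>

lemma cdf_polar:
  assumes "u \<in> X" "v \<in> X"
  shows "measure (mu (u + v)) {..t} - measure (mu (u - v)) {..t} = 4 * (E t u \<bullet> v)"
proof -
  have "E t v \<bullet> u = E t u \<bullet> v" using E_sym[OF assms(2,1)] by (simp add: inner_commute)
  then show ?thesis
    using assms by (simp add: measure_mu_atMost add_mem diff_mem E_add E_diff
        inner_add_left inner_add_right inner_diff_left inner_diff_right)
qed

section \<open>The polarized integral and the bounded functional calculus\<close>

definition bounded_borel :: "(real \<Rightarrow> real) \<Rightarrow> bool" where
  "bounded_borel f \<longleftrightarrow> f \<in> borel_measurable borel \<and> (\<exists>C. \<forall>t. \<bar>f t\<bar> \<le> C)"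

lemma bounded_borel_measurable: "bounded_borel f \<Longrightarrow> f \<in> borel_measurable borel"
  by (simp add: bounded_borel_def)

lemma bounded_borel_mult:
  assumes "bounded_borel f" "bounded_borel g"
  shows "bounded_borel (\<lambda>t. f t * g t)"
proof -
  obtain C D where "\<And>t. \<bar>f t\<bar> \<le> C" "\<And>t. \<bar>g t\<bar> \<le> D"
    using assms unfolding bounded_borel_def by auto
  then have "\<bar>f t * g t\<bar> \<le> C * D" for t
    unfolding abs_mult by (intro mult_mono) (auto intro: order_trans[OF abs_ge_zero])
  then show ?thesis using assms unfolding bounded_borel_def by auto
qed

lemma bounded_borel_indicator: "A \<in> sets borel \<Longrightarrow> bounded_borel (indicator A)"
  unfolding bounded_borel_def by (auto intro!: exI[of _ 1] simp: indicator_def)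

lemma bounded_borel_const: "bounded_borel (\<lambda>_. c)"
  unfolding bounded_borel_def by auto

lemma integrable_bounded_borel:
  assumes "bounded_borel f" "u \<in> X"
  shows "integrable (mu u) f"
proof -
  interpret finite_borel_measure "mu u" by (rule finite_mu[OF assms(2)])
  obtain C where "\<And>t. \<bar>f t\<bar> \<le> C" using assms(1) unfolding bounded_borel_def by auto
  then show ?thesis
    using assms(1) by (intro integrable_const_bound[of _ C]) (auto simp: bounded_borel_def borel_mu)
qed

text \<open>The integral of \<open>f\<close> against \<open>d<E(t) u, v>\<close>, written exactly as
  in \<open>spectral_integral\<close>.\<close>

definition polar :: "(real \<Rightarrow> real) \<Rightarrow> 'h \<Rightarrow> 'h \<Rightarrow> real" where
  "polar f u v = ((LINT t|mu (u + v). f t) - (LINT t|mu (u - v). f t)) / 4"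

lemma spectral_integral_iff:
  "(u, w) \<in> spectral_integral X E f \<longleftrightarrow>
     u \<in> spectral_domain X E f \<and> w \<in> X \<and> (\<forall>v\<in>spectral_domain X E f. w \<bullet> v = polar f u v)"
  by (simp add: spectral_integral_def polar_def)

lemma mu_cong:
  assumes "u \<in> X" "v \<in> X" "\<And>t. E t u \<bullet> u = E t v \<bullet> v"
  shows "mu u = mu v"
  by (rule cdf_unique') (use assms in \<open>auto simp: finite_mu measure_mu_atMost cdf_def\<close>)

lemma polar_commute:
  assumes "u \<in> X" "v \<in> X"
  shows "polar f u v = polar f v u"
proof -
  have "mu (u - v) = mu (v - u)"
    by (rule mu_cong)
      (use assms in \<open>auto simp: diff_mem E_diff inner_diff_left inner_diff_right\<close>)
  then show ?thesis by (simp add: polar_def add.commute)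
qed

text \<open>Additivity is hidden by the definition, because spectral measures are quadratic in the
  vector. The six measures involved are linearly related since their distribution functions
  are.\<close>

lemma polar_add_right:
  assumes uv: "u \<in> X" "v \<in> X" "w \<in> X" and f: "bounded_borel f"
  shows "polar f u (v + w) = polar f u v + polar f u w"
proof -
  have "(\<Sum>(c, M)\<leftarrow>[(1, mu (u + (v + w))), (-1, mu (u - (v + w))), (-1, mu (u + v)),
      (1, mu (u - v)), (-1, mu (u + w)), (1, mu (u - w))]. c * (LINT t|M. f t)) = 0"
  proof (rule integral_linear_relation_list)
    fix t show "(\<Sum>(c, M)\<leftarrow>[(1, mu (u + (v + w))), (-1, mu (u - (v + w))), (-1, mu (u + v)),
      (1, mu (u - v)), (-1, mu (u + w)), (1, mu (u - w))]. c * measure M {..t}) = 0"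
      using cdf_polar[of u "v + w" t] cdf_polar[of u v t] cdf_polar[of u w t] uv
      by (simp add: add_mem inner_add_right)
  qed (use uv f in \<open>auto simp: finite_mu integrable_bounded_borel add_mem diff_mem bounded_borel_measurable\<close>)
  then show ?thesis by (simp add: polar_def field_simps)
qed

lemma polar_scale_right:
  assumes uv: "u \<in> X" "v \<in> X" and f: "bounded_borel f"
  shows "polar f u (c *\<^sub>R v) = c * polar f u v"
proof -
  have "(\<Sum>(c, M)\<leftarrow>[(1, mu (u + c *\<^sub>R v)), (-1, mu (u - c *\<^sub>R v)), (- c, mu (u + v)),
      (c, mu (u - v))]. c * (LINT t|M. f t)) = 0"
  proof (rule integral_linear_relation_list)
    fix t
    have "(measure (mu (u + c *\<^sub>R v)) {..t} - measure (mu (u - c *\<^sub>R v)) {..t}) -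
        c * (measure (mu (u + v)) {..t} - measure (mu (u - v)) {..t}) = 0"
      unfolding cdf_polar[OF uv] cdf_polar[OF uv(1) scale_mem[OF uv(2)]] by simp
    then show "(\<Sum>(c, M)\<leftarrow>[(1, mu (u + c *\<^sub>R v)), (-1, mu (u - c *\<^sub>R v)), (- c, mu (u + v)),
      (c, mu (u - v))]. c * measure M {..t}) = 0"
      by (simp add: algebra_simps)
  qed (use uv f in \<open>auto simp: finite_mu integrable_bounded_borel add_mem diff_mem scale_mem bounded_borel_measurable\<close>)
  then show ?thesis by (simp add: polar_def field_simps)
qed

lemma polar_indicator_atMost:
  assumes "u \<in> X" "v \<in> X"
  shows "polar (indicator {..t}) u v = E t u \<bullet> v"
  using cdf_polar[OF assms, of t] by (simp add: polar_def)

lemma polar_one: "u \<in> X \<Longrightarrow> v \<in> X \<Longrightarrow> polar (\<lambda>_. 1) u v = u \<bullet> v"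
  by (simp add: polar_def measure_mu_UNIV add_mem diff_mem power2_norm_eq_inner
      inner_add_left inner_add_right inner_diff_left inner_diff_right inner_commute)

lemma polar_self:
  assumes u: "u \<in> X" and f: "bounded_borel f"
  shows "polar f u u = (LINT t|mu u. f t)"
proof -
  have "(\<Sum>(c, M)\<leftarrow>[(1, mu (u + u)), (-1, mu (u - u)), (- 4, mu u)]. c * (LINT t|M. f t)) = 0"
  proof (rule integral_linear_relation_list)
    fix t
    show "(\<Sum>(c, M)\<leftarrow>[(1, mu (u + u)), (-1, mu (u - u)), (- 4, mu u)]. c * measure M {..t}) = 0"
      using cdf_polar[OF u u, of t] measure_mu_atMost[OF u, of t] by simp
  qed (use u f zero_mem in \<open>auto simp: finite_mu integrable_bounded_borel add_mem bounded_borel_measurable\<close>)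
  then show ?thesis by (simp add: polar_def)
qed

text \<open>Only continuity in \<open>v\<close> for fixed \<open>u\<close> is wanted, so a crude
  dependence on \<open>u\<close> is enough; the parallelogram law bounds the two total masses
  together.\<close>

lemma polar_bound:
  assumes uv: "u \<in> X" "v \<in> X" "norm v \<le> 1" and f: "bounded_borel f" "\<And>t. \<bar>f t\<bar> \<le> C"
  shows "\<bar>polar f u v\<bar> \<le> C * ((norm u)\<^sup>2 + 1)"
proof -
  have C: "0 \<le> C" using f(2)[of 0] by linarith
  have *: "\<bar>LINT t|mu w. f t\<bar> \<le> C * (norm w)\<^sup>2" if w: "w \<in> X" for w
  proof -
    interpret finite_borel_measure "mu w" by (rule finite_mu[OF w])
    have "\<bar>LINT t|mu w. f t\<bar> \<le> (LINT t|mu w. \<bar>f t\<bar>)" by (rule integral_abs_bound)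
    also have "\<dots> \<le> (LINT t|mu w. C)"
      using f integrable_bounded_borel[OF f(1) w] by (intro integral_mono) auto
    finally show ?thesis by (simp add: measure_mu_UNIV w mult.commute)
  qed
  have "(norm (u + v))\<^sup>2 + (norm (u - v))\<^sup>2 = 2 * (norm u)\<^sup>2 + 2 * (norm v)\<^sup>2"
    by (simp add: power2_norm_eq_inner inner_add_left inner_add_right inner_diff_left
        inner_diff_right)
  moreover have "(norm v)\<^sup>2 \<le> 1" using uv(3) by (simp add: power_le_one)
  ultimately have "(norm (u + v))\<^sup>2 + (norm (u - v))\<^sup>2 \<le> 4 * ((norm u)\<^sup>2 + 1)"
    using zero_le_power2[of "norm u"] unfolding distrib_left by linarith
  then have "C * ((norm (u + v))\<^sup>2 + (norm (u - v))\<^sup>2) \<le> C * (4 * ((norm u)\<^sup>2 + 1))"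
    using C by (rule mult_left_mono)
  then have "\<bar>(LINT t|mu (u + v). f t) - (LINT t|mu (u - v). f t)\<bar> \<le> 4 * (C * ((norm u)\<^sup>2 + 1))"
    using *[OF add_mem[OF uv(1,2)]] *[OF diff_mem[OF uv(1,2)]]
      abs_triangle_ineq4[of "LINT t|mu (u + v). f t" "LINT t|mu (u - v). f t"]
    unfolding distrib_left[of C "(norm (u + v))\<^sup>2"] by linarith
  then show ?thesis
    unfolding polar_def by simp
qed

lemma polar_representation:
  assumes u: "u \<in> X" and f: "bounded_borel f"
  shows "\<exists>w\<in>X. \<forall>v\<in>X. w \<bullet> v = polar f u v"
proof -
  obtain C where C: "\<And>t. \<bar>f t\<bar> \<le> C" using f unfolding bounded_borel_def by auto
  show ?thesis
  proof (rule riesz[of _ "C * ((norm u)\<^sup>2 + 1)"])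
    fix v assume v: "v \<in> X"
    have "\<bar>polar f u v\<bar> \<le> C * ((norm u)\<^sup>2 + 1) * norm v"
    proof (cases "v = 0")
      case True
      then show ?thesis by (simp add: polar_def)
    next
      case False
      have "\<bar>polar f u ((1 / norm v) *\<^sub>R v)\<bar> \<le> C * ((norm u)\<^sup>2 + 1)"
        using False u v by (intro polar_bound f C scale_mem) auto
      then show ?thesis
        using False unfolding polar_scale_right[OF u v f] by (simp add: abs_mult field_simps)
    qed
    then show "\<bar>polar f u v\<bar> \<le> C * ((norm u)\<^sup>2 + 1) * sqrt (v \<bullet> v)"
      by (simp flip: norm_eq_sqrt_inner)
  qed (use u f in \<open>auto intro: polar_add_right polar_scale_right\<close>)
qed

definition Phi :: "(real \<Rightarrow> real) \<Rightarrow> 'h \<Rightarrow> 'h" where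
  "Phi f u = (SOME w. w \<in> X \<and> (\<forall>v\<in>X. w \<bullet> v = polar f u v))"

lemma
  assumes "bounded_borel f" "u \<in> X"
  shows Phi_mem: "Phi f u \<in> X"
    and Phi_inner: "v \<in> X \<Longrightarrow> Phi f u \<bullet> v = polar f u v"
proof -
  have "\<exists>w. w \<in> X \<and> (\<forall>v\<in>X. w \<bullet> v = polar f u v)"
    using polar_representation[OF assms(2,1)] by blast
  from someI_ex[OF this]
  show "Phi f u \<in> X" "v \<in> X \<Longrightarrow> Phi f u \<bullet> v = polar f u v"
    unfolding Phi_def by blast+
qed

lemma Phi_commute:
  "bounded_borel f \<Longrightarrow> u \<in> X \<Longrightarrow> v \<in> X \<Longrightarrow> Phi f u \<bullet> v = u \<bullet> Phi f v"
  by (metis Phi_inner polar_commute inner_commute)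

text \<open>Linearity in \<open>u\<close> is obtained by moving \<open>Phi f\<close> to the other
  factor, where the inner product is linear.\<close>

lemma Phi_add:
  assumes "bounded_borel f" "u \<in> X" "v \<in> X"
  shows "Phi f (u + v) = Phi f u + Phi f v"
  by (rule eq_if_inner_eq)
    (use assms in \<open>auto simp: Phi_mem add_mem Phi_commute inner_add_left\<close>)

lemma Phi_scale:
  assumes "bounded_borel f" "u \<in> X"
  shows "Phi f (c *\<^sub>R u) = c *\<^sub>R Phi f u"
  by (rule eq_if_inner_eq)
    (use assms in \<open>auto simp: Phi_mem scale_mem Phi_commute\<close>)

lemma Phi_indicator_atMost: "u \<in> X \<Longrightarrow> Phi (indicator {..t}) u = E t u"
  by (rule eq_if_inner_eq)
    (auto simp: Phi_mem Phi_inner bounded_borel_indicator polar_indicator_atMost E_mem)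

section \<open>Densities and multiplicativity\<close>

text \<open>The hypothesis says that the signed measure \<open>d\<langle>E(t) w, z\<rangle>\<close> has density \<open>g\<close> with
  respect to \<open>d\<langle>E(t) u, v\<rangle>\<close>.\<close>

lemma polar_density:
  assumes X: "u \<in> X" "v \<in> X" "w \<in> X" "z \<in> X"
    and g: "bounded_borel g" "\<And>t. 0 \<le> g t"
    and dens: "\<And>t. E t w \<bullet> z = polar (\<lambda>r. indicator {..t} r * g r) u v"
    and f: "f \<in> borel_measurable borel" "integrable (mu (w + z)) f" "integrable (mu (w - z)) f"
      "integrable (mu (u + v)) (\<lambda>t. f t * g t)" "integrable (mu (u - v)) (\<lambda>t. f t * g t)"
  shows "polar f w z = polar (\<lambda>t. f t * g t) u v"
proof -
  let ?D = "\<lambda>x. density (mu x) (\<lambda>t. ennreal (g t))"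
  have gm: "g \<in> borel_measurable borel" using g(1) by (rule bounded_borel_measurable)
  have D: "finite_borel_measure (?D x)"
    and D_atMost: "measure (?D x) {..t} = (LINT r|mu x. indicator {..t} r * g r)"
    and D_int: "(LINT t|?D x. f t) = (LINT t|mu x. f t * g t)"
    and D_integrable: "integrable (?D x) f \<longleftrightarrow> integrable (mu x) (\<lambda>t. f t * g t)"
    if x: "x \<in> X" for x t
    using finite_borel_measure_density[OF finite_mu[OF x] gm g(2) integrable_bounded_borel[OF g(1) x]]
      integral_density[OF borel_mu[OF f(1)] borel_mu[OF gm], of x]
      integrable_density[OF borel_mu[OF f(1)] borel_mu[OF gm], of x] g(2)
    by (auto simp: mult.commute)
  have mem: "w + z \<in> X" "w - z \<in> X" "u + v \<in> X" "u - v \<in> X"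
    using X by (auto intro: add_mem diff_mem)
  have "(\<Sum>(c, M)\<leftarrow>[(1, mu (w + z)), (-1, mu (w - z)), (-1, ?D (u + v)), (1, ?D (u - v))].
    c * (LINT t|M. f t)) = 0"
  proof (rule integral_linear_relation_list)
    fix t
    show "(\<Sum>(c, M)\<leftarrow>[(1, mu (w + z)), (-1, mu (w - z)), (-1, ?D (u + v)), (1, ?D (u - v))].
      c * measure M {..t}) = 0"
      using cdf_polar[OF X(3,4), of t] dens[of t] mem by (simp add: D_atMost polar_def)
  qed (use mem f D D_integrable finite_mu in auto)
  then show ?thesis using mem by (simp add: polar_def D_int)
qed

text \<open>Since \<open>E s u \<bullet> E t v\<close> is \<open>E (min t s) u \<bullet> v\<close>,
  replacing \<open>v\<close> by \<open>E t v\<close> gives the polarized measure the density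
  \<open>indicator {..t}\<close>.\<close>

lemma polar_E_right:
  assumes X: "u \<in> X" "v \<in> X"
    and f: "f \<in> borel_measurable borel"
      "integrable (mu (u + E t v)) f" "integrable (mu (u - E t v)) f"
      "integrable (mu (u + v)) f" "integrable (mu (u - v)) f"
  shows "polar f u (E t v) = polar (\<lambda>r. f r * indicator {..t} r) u v"
proof (rule polar_density)
  fix s
  have "E s u \<bullet> E t v = E t (E s u) \<bullet> v" using X by (simp add: E_sym E_mem)
  also have "\<dots> = polar (indicator {..min t s}) u v"
    using X by (simp add: E_E polar_indicator_atMost)
  also have "indicator {..min t s} = (\<lambda>r. indicator {..s} r * indicator {..t} r :: real)"
    by (auto simp: indicator_def)
  finally show "E s u \<bullet> E t v = polar (\<lambda>r. indicator {..s} r * indicator {..t} r) u v" .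
  show "integrable (mu (u + v)) (\<lambda>r. f r * indicator {..t} r)"
    "integrable (mu (u - v)) (\<lambda>r. f r * indicator {..t} r)"
    by (intro integrable_real_mult_indicator f; simp)+
qed (use X f in \<open>auto simp: E_mem bounded_borel_indicator\<close>)

text \<open>This supplies the hypothesis \<open>dens\<close> of \<open>polar_density\<close> for
  \<open>w = Phi g u\<close> and \<open>z = v\<close>.\<close>

lemma E_Phi_inner:
  assumes g: "bounded_borel g" and X: "u \<in> X" "v \<in> X"
  shows "E t (Phi g u) \<bullet> v = polar (\<lambda>r. indicator {..t} r * g r) u v"
proof -
  have "E t (Phi g u) \<bullet> v = polar g u (E t v)"
    using g X by (simp add: E_sym Phi_mem E_mem Phi_inner)
  also have "\<dots> = polar (\<lambda>r. g r * indicator {..t} r) u v"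
    using g X by (intro polar_E_right)
      (auto simp: bounded_borel_measurable integrable_bounded_borel add_mem diff_mem E_mem)
  finally show ?thesis by (simp add: mult.commute)
qed

text \<open>Here \<open>f\<close> may be unbounded, as is needed for inverting unbounded integrals;
  \<open>g\<close> is nonnegative so that it can serve as a density.\<close>

lemma polar_Phi:
  assumes "u \<in> X" "v \<in> X" "bounded_borel g" "\<And>t. 0 \<le> g t" "f \<in> borel_measurable borel"
    "integrable (mu (Phi g u + v)) f" "integrable (mu (Phi g u - v)) f"
    "integrable (mu (u + v)) (\<lambda>t. f t * g t)" "integrable (mu (u - v)) (\<lambda>t. f t * g t)"
  shows "polar f (Phi g u) v = polar (\<lambda>t. f t * g t) u v"
  using assms by (intro polar_density) (auto simp: Phi_mem E_Phi_inner)

lemma Phi_Phi: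
  assumes "bounded_borel f" "bounded_borel g" "\<And>t. 0 \<le> g t" "u \<in> X"
  shows "Phi f (Phi g u) = Phi (\<lambda>t. f t * g t) u"
  by (rule eq_if_inner_eq)
    (use assms in \<open>auto simp: Phi_mem Phi_inner bounded_borel_mult polar_Phi add_mem diff_mem
      integrable_bounded_borel bounded_borel_measurable\<close>)

text \<open>One factor \<open>g\<close> comes from \<open>E_Phi_inner\<close>, the other from
  composing \<open>Phi h\<close> with \<open>Phi g\<close>. The formula decides which vectors
  \<open>Phi g u\<close> lie in the domain of an unbounded integral.\<close>

lemma mu_Phi:
  assumes g: "bounded_borel g" "\<And>t. 0 \<le> g t" and u: "u \<in> X"
  shows "mu (Phi g u) = density (mu u) (\<lambda>t. ennreal ((g t)\<^sup>2))"
proof -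
  have g2: "bounded_borel (\<lambda>t. (g t)\<^sup>2)"
    using bounded_borel_mult[OF g(1) g(1)] by (simp add: power2_eq_square)
  note D = finite_borel_measure_density[OF finite_mu[OF u] bounded_borel_measurable[OF g2] zero_le_power2
      integrable_bounded_borel[OF g2 u]]
  show ?thesis
  proof (rule cdf_unique')
    show "cdf (mu (Phi g u)) = cdf (density (mu u) (\<lambda>t. ennreal ((g t)\<^sup>2)))"
    proof
      fix t
      define h where "h = (\<lambda>r. indicator {..t} r * g r)"
      have h: "bounded_borel h"
        unfolding h_def by (intro bounded_borel_mult bounded_borel_indicator g) simp
      have "cdf (mu (Phi g u)) t = polar h u (Phi g u)"
        using g u by (simp add: cdf_def measure_mu_atMost Phi_mem E_Phi_inner h_def)
      also have "\<dots> = Phi h (Phi g u) \<bullet> u"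
        using g u h by (simp add: Phi_inner Phi_mem polar_commute)
      also have "\<dots> = polar (\<lambda>r. h r * g r) u u"
        using g u h by (simp add: Phi_Phi Phi_inner bounded_borel_mult)
      also have "\<dots> = (LINT r|mu u. indicator {..t} r * (g r)\<^sup>2)"
        using polar_self[OF u bounded_borel_mult[OF h g(1)]]
        by (simp add: h_def power2_eq_square mult.assoc)
      finally show "cdf (mu (Phi g u)) t = cdf (density (mu u) (\<lambda>t. ennreal ((g t)\<^sup>2))) t"
        by (simp add: cdf_def D)
    qed
  qed (use g u D in \<open>auto simp: finite_mu Phi_mem\<close>)
qed

section \<open>Domains of unbounded integrals\<close>

lemma integrable_mu_Phi:
  fixes h :: "real \<Rightarrow> real"
  assumes "bounded_borel g" "\<And>t. 0 \<le> g t" "u \<in> X" "h \<in> borel_measurable borel"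
  shows "integrable (mu (Phi g u)) h \<longleftrightarrow> integrable (mu u) (\<lambda>t. (g t)\<^sup>2 * h t)"
proof -
  have "(\<lambda>t. (g t)\<^sup>2) \<in> borel_measurable borel"
    using bounded_borel_measurable[OF assms(1)] by simp
  then show ?thesis
    unfolding mu_Phi[OF assms(1-3)] using assms(4)
    by (subst integrable_density) (auto simp: borel_mu)
qed

text \<open>The measures of \<open>u + v\<close> and \<open>u - v\<close> add up to twice those of
  \<open>u\<close> and \<open>v\<close>. Integrability on the left is what has to be proved, so the
  identity is applied to truncations of \<open>h\<close> and followed by monotone convergence. It
  makes spectral domains closed under sums and differences.\<close>

lemma integrable_parallelogram:
  fixes h :: "real \<Rightarrow> real"
  assumes X: "u \<in> X" "v \<in> X" and h: "h \<in> borel_measurable borel" "\<And>t. 0 \<le> h t"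
    and int: "integrable (mu u) h" "integrable (mu v) h"
  shows "integrable (mu (u + v)) h" "integrable (mu (u - v)) h"
proof -
  define H where "H n t = min (h t) (real n)" for n t
  have H: "bounded_borel (H n)" "\<And>t. 0 \<le> H n t" "\<And>t. H n t \<le> h t" for n
    unfolding H_def bounded_borel_def using h by (auto intro!: exI[of _ "real n"])
  have mem: "u + v \<in> X" "u - v \<in> X" using X by (auto intro: add_mem diff_mem)
  let ?C = "2 * (LINT t|mu u. h t) + 2 * (LINT t|mu v. h t)"
  have bound: "(LINT t|mu (u + v). H n t) + (LINT t|mu (u - v). H n t) \<le> ?C" for n
  proof -
    have "(\<Sum>(c, M)\<leftarrow>[(1, mu (u + v)), (1, mu (u - v)), (-2, mu u), (-2, mu v)].
      c * (LINT t|M. H n t)) = 0"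
    proof (rule integral_linear_relation_list)
      fix t
      have "measure (mu (u + v)) {..t} + measure (mu (u - v)) {..t} =
          2 * measure (mu u) {..t} + 2 * measure (mu v) {..t}"
        using X mem by (simp add: measure_mu_atMost E_add E_diff
            inner_add_left inner_add_right inner_diff_left inner_diff_right)
      then show "(\<Sum>(c, M)\<leftarrow>[(1, mu (u + v)), (1, mu (u - v)), (-2, mu u), (-2, mu v)].
        c * measure M {..t}) = 0" by simp
    qed (use X mem H in \<open>auto simp: finite_mu integrable_bounded_borel bounded_borel_measurable\<close>)
    moreover have "(LINT t|mu u. H n t) \<le> (LINT t|mu u. h t)" "(LINT t|mu v. H n t) \<le> (LINT t|mu v. h t)"
      using X H int by (auto intro!: integral_mono integrable_bounded_borel)
    ultimately show ?thesis by simp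
  qed
  have pos: "0 \<le> (LINT t|mu x. H n t)" for x n using H by simp
  have "integrable (mu x) h" if x: "x \<in> X" and b: "\<And>n. (LINT t|mu x. H n t) \<le> ?C" for x
  proof (rule integrable_monotone_convergence)
    have "incseq (\<lambda>n. LINT t|mu x. H n t)"
      by (intro incseq_SucI integral_mono integrable_bounded_borel H x) (auto simp: H_def)
    then show "(\<lambda>n. LINT t|mu x. H n t) \<longlonglongrightarrow> (SUP n. LINT t|mu x. H n t)"
      using b by (intro LIMSEQ_incseq_SUP) (auto intro!: bdd_aboveI)
    show "AE t in mu x. mono (\<lambda>n. H n t)"
      by (auto simp: H_def mono_def intro!: AE_I2)
    show "AE t in mu x. (\<lambda>n. H n t) \<longlonglongrightarrow> h t"
    proof (rule AE_I2)
      fix t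
      have "\<forall>\<^sub>F n in sequentially. H n t = h t"
      proof (rule eventually_sequentiallyI)
        fix n assume "nat \<lceil>h t\<rceil> \<le> n"
        then show "H n t = h t" unfolding H_def by (intro min_absorb1) linarith
      qed
      then show "(\<lambda>n. H n t) \<longlonglongrightarrow> h t" by (rule tendsto_eventually)
    qed
  qed (use x H h in \<open>auto simp: integrable_bounded_borel borel_mu\<close>)
  moreover have "(LINT t|mu (u + v). H n t) \<le> ?C" "(LINT t|mu (u - v). H n t) \<le> ?C" for n
    using bound[of n] pos[of "u + v" n] pos[of "u - v" n] by linarith+
  ultimately show "integrable (mu (u + v)) h" "integrable (mu (u - v)) h"
    using mem by blast+
qed

lemma spectral_domain_add_diff:
  assumes "u \<in> spectral_domain X E f" "v \<in> spectral_domain X E f" "f \<in> borel_measurable borel"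
  shows "u + v \<in> spectral_domain X E f" "u - v \<in> spectral_domain X E f"
  using assms integrable_parallelogram[of u v "\<lambda>t. (f t)\<^sup>2"]
  by (auto simp: spectral_domain_def add_mem diff_mem)

text \<open>Spectral measures are finite, so square integrability suffices. Applied to
  \<open>u + v\<close> and \<open>u - v\<close>, this shows that the two integrals in
  \<open>spectral_integral\<close> exist on the domain.\<close>

lemma integrable_spectral_domain:
  assumes "u \<in> spectral_domain X E f" "f \<in> borel_measurable borel"
  shows "integrable (mu u) f"
proof (rule Bochner_Integration.integrable_bound)
  have u: "u \<in> X" using assms(1) by (simp add: spectral_domain_def)
  interpret finite_borel_measure "mu u" by (rule finite_mu[OF u])
  show "integrable (mu u) (\<lambda>t. 1 + (f t)\<^sup>2)"
    using assms by (auto simp: spectral_domain_def)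
  have "\<bar>x\<bar> \<le> 1 + x\<^sup>2" for x :: real
    using zero_le_power2[of "\<bar>x\<bar> - 1"] unfolding power2_diff by simp
  then show "AE t in mu u. norm (f t) \<le> norm (1 + (f t)\<^sup>2)" by simp
qed (use assms in \<open>auto simp: borel_mu\<close>)

lemma spectral_domain_bounded_borel: "bounded_borel f \<Longrightarrow> spectral_domain X E f = X"
  using bounded_borel_mult[of f f]
  by (auto simp: spectral_domain_def integrable_bounded_borel power2_eq_square)

lemma spectral_integral_bounded_borel:
  assumes "bounded_borel f"
  shows "spectral_integral X E f = {(u, Phi f u) |u. u \<in> X}"
  using assms
  by (auto simp: spectral_integral_iff spectral_domain_bounded_borel Phi_mem Phi_inner
      intro!: eq_if_inner_eq[OF _ Phi_mem])

section \<open>The lower bound of the spectrum\<close>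

lemma polar_diff:
  assumes "bounded_borel f" "bounded_borel g" "u \<in> X" "v \<in> X"
  shows "polar (\<lambda>t. f t - g t) u v = polar f u v - polar g u v"
  using assms by (simp add: polar_def integrable_bounded_borel add_mem diff_mem field_simps)

lemma Phi_indicator_Ioc:
  assumes "q < r" "u \<in> X"
  shows "Phi (indicator {q<..r}) u = E r u - E q u"
proof (rule eq_if_inner_eq)
  fix v assume v: "v \<in> X"
  have "(indicator {q<..r} :: real \<Rightarrow> real) = (\<lambda>t. indicator {..r} t - indicator {..q} t)"
    using assms by (auto simp: indicator_def)
  then have "polar (indicator {q<..r}) u v = E r u \<bullet> v - E q u \<bullet> v"
    using assms v by (simp add: polar_diff bounded_borel_indicator polar_indicator_atMost)
  then show "Phi (indicator {q<..r}) u \<bullet> v = (E r u - E q u) \<bullet> v"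
    using assms v by (simp add: Phi_inner bounded_borel_indicator inner_diff_left)
qed (use assms in \<open>auto simp: Phi_mem bounded_borel_indicator diff_mem E_mem\<close>)

text \<open>A nonzero vector of the form \<open>E r u - E q u\<close> with \<open>q < r < 1\<close>
  would lie in the domain of the integral of \<open>t\<close> and have a Rayleigh quotient below 1,
  against \<open>below\<close>. Hence \<open>E\<close> is constant below \<open>r\<close>, and its
  limit at minus infinity is 0.\<close>

lemma E_zero_if_bounded_below:
  assumes below: "\<And>v w. (v, w) \<in> spectral_integral X E (\<lambda>t. t) \<Longrightarrow> (norm v)\<^sup>2 \<le> w \<bullet> v"
    and r: "r < 1" and u: "u \<in> X"
  shows "E r u = 0"
proof -
  have eq: "E r u = E q u" if q: "q < r" for q
  proof -
    \<comment> \<open>The interval is bounded so that \<open>h\<close>, which is \<open>t\<close>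
      restricted to it, stays bounded and \<open>Phi h u\<close> is the value of the integral of
      \<open>t\<close> at \<open>Phi g u\<close>.\<close>
    define g where "g = (indicator {q<..r} :: real \<Rightarrow> real)"
    define h where "h t = t * g t" for t
    have h_eq: "h = (\<lambda>t. t * g t)" by (rule ext) (rule h_def)
    have g: "bounded_borel g" "\<And>t. 0 \<le> g t" by (auto simp: g_def bounded_borel_indicator)
    have [measurable]: "g \<in> borel_measurable borel" using g(1) by (rule bounded_borel_measurable)
    have "\<bar>h t\<bar> \<le> \<bar>q\<bar> + \<bar>r\<bar>" for t by (auto simp: h_def g_def indicator_def)
    then have h: "bounded_borel h" unfolding bounded_borel_def h_def by auto
    have hg: "bounded_borel (\<lambda>t. h t * g t)" by (rule bounded_borel_mult[OF h g(1)])
    have gg: "bounded_borel (\<lambda>t. g t * g t)" by (rule bounded_borel_mult[OF g(1) g(1)])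
    define v where "v = Phi g u"
    have v: "v \<in> X" unfolding v_def by (rule Phi_mem[OF g(1) u])
    have "integrable (mu u) (\<lambda>t. (g t)\<^sup>2 * t\<^sup>2)"
      using integrable_bounded_borel[OF bounded_borel_mult[OF h h] u]
      by (simp add: h_def power2_eq_square mult_ac)
    then have dom: "v \<in> spectral_domain X E (\<lambda>t. t)"
      using v unfolding v_def by (simp add: spectral_domain_def integrable_mu_Phi[OF g u])
    have "Phi h u \<bullet> v' = polar (\<lambda>t. t) v v'" if v': "v' \<in> spectral_domain X E (\<lambda>t. t)" for v'
    proof -
      have v'X: "v' \<in> X" using v' by (simp add: spectral_domain_def)
      have id: "(\<lambda>t :: real. t) \<in> borel_measurable borel" by simp
      note dom' = spectral_domain_add_diff[OF dom v' id]
      have "polar (\<lambda>t. t) v v' = polar (\<lambda>t. t * g t) u v'"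
        unfolding v_def
      proof (rule polar_Phi[OF u v'X g id])
        show "integrable (mu (Phi g u + v')) (\<lambda>t. t)"
          using integrable_spectral_domain[OF dom'(1) id] by (simp only: v_def)
        show "integrable (mu (Phi g u - v')) (\<lambda>t. t)"
          using integrable_spectral_domain[OF dom'(2) id] by (simp only: v_def)
        show "integrable (mu (u + v')) (\<lambda>t. t * g t)"
          using integrable_bounded_borel[OF h add_mem[OF u v'X]] by (simp only: h_eq)
        show "integrable (mu (u - v')) (\<lambda>t. t * g t)"
          using integrable_bounded_borel[OF h diff_mem[OF u v'X]] by (simp only: h_eq)
      qed
      then show ?thesis using Phi_inner[OF h u v'X] by (simp only: h_eq)
    qed
    then have "(v, Phi h u) \<in> spectral_integral X E (\<lambda>t. t)"
      using dom h u by (simp add: spectral_integral_iff Phi_mem)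
    then have 1: "(norm v)\<^sup>2 \<le> Phi h u \<bullet> v" by (rule below)
    have self: "polar f u (Phi g u) = (LINT t|mu u. f t * g t)" if f: "bounded_borel f" for f
    proof -
      have "polar f u (Phi g u) = Phi f (Phi g u) \<bullet> u"
        using f u v by (simp add: Phi_inner v_def polar_commute)
      also have "\<dots> = (LINT t|mu u. f t * g t)"
        using f g u by (simp add: Phi_Phi Phi_inner bounded_borel_mult polar_self)
      finally show ?thesis .
    qed
    have 2: "Phi h u \<bullet> v = (LINT t|mu u. h t * g t)"
      using h u v by (simp add: Phi_inner self v_def)
    have 3: "(norm v)\<^sup>2 = (LINT t|mu u. g t * g t)"
      using g u v self[OF g(1)] by (simp add: power2_norm_eq_inner Phi_inner v_def)
    have "(LINT t|mu u. h t * g t) \<le> (LINT t|mu u. max r 0 * (g t * g t))"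
      using integrable_bounded_borel[OF hg u] integrable_bounded_borel[OF gg u]
      by (intro integral_mono) (auto simp: h_def g_def indicator_def)
    with 1 2 3 have "(1 - max r 0) * (norm v)\<^sup>2 \<le> 0" by (simp add: left_diff_distrib)
    then have "v = 0" using r by (auto simp: mult_le_0_iff max_def split: if_splits)
    then show ?thesis using Phi_indicator_Ioc[OF q u] by (simp add: v_def g_def)
  qed
  have "((\<lambda>t. E t u) \<longlongrightarrow> E r u) at_bot"
    by (rule tendsto_eventually) (auto simp: eventually_at_bot_dense intro!: exI[of _ r] eq[symmetric])
  then show ?thesis using E_at_bot[OF u] by (rule tendsto_unique[rotated]) simp
qed

end

locale bounded_below_spectral_family = spectral_family +
  assumes E_zero: "\<And>r u. r < 1 \<Longrightarrow> u \<in> X \<Longrightarrow> E r u = 0"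
begin

text \<open>The point 1 may carry mass, so the open half line below it is exhausted by countably
  many closed null half lines.\<close>

lemma AE_mu:
  assumes u: "u \<in> X" shows "AE t in mu u. 1 \<le> t"
proof -
  interpret finite_borel_measure "mu u" by (rule finite_mu[OF u])
  have "AE t in mu u. \<not> t \<le> 1 - 1 / real (Suc n)" for n
  proof (rule AE_not_in[of "{..1 - 1 / real (Suc n)}", simplified atMost_iff])
    show "{..1 - 1 / real (Suc n)} \<in> null_sets (mu u)"
      using measure_mu_atMost[OF u, of "1 - 1 / real (Suc n)"] E_zero[OF _ u]
      by (intro null_setsI) (auto simp: emeasure_eq_measure)
  qed
  then have "AE t in mu u. \<forall>n. \<not> t \<le> 1 - 1 / real (Suc n)" by (simp add: AE_all_countable)
  then show ?thesis
  proof eventually_elim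
    case (elim t)
    show ?case
    proof (rule ccontr)
      assume "\<not> 1 \<le> t"
      then obtain n where "1 / real (Suc n) < 1 - t"
        using nat_approx_posE[of "1 - t"] by auto
      then show False using elim[rule_format, of n] by linarith
    qed
  qed
qed

lemma
  fixes f g :: "real \<Rightarrow> real"
  assumes fg: "f \<in> borel_measurable borel" "g \<in> borel_measurable borel"
    "\<And>t. 1 \<le> t \<Longrightarrow> f t = g t" and u: "u \<in> X"
  shows integral_mu_cong: "(LINT t|mu u. f t) = (LINT t|mu u. g t)"
    and integrable_mu_cong: "integrable (mu u) f \<longleftrightarrow> integrable (mu u) g"
proof -
  have "AE t in mu u. f t = g t"
    using AE_mu[OF u] by eventually_elim (rule fg(3))
  then show "(LINT t|mu u. f t) = (LINT t|mu u. g t)" "integrable (mu u) f \<longleftrightarrow> integrable (mu u) g"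
    using borel_mu[OF fg(1)] borel_mu[OF fg(2)]
    by (intro integral_cong_AE integrable_cong_AE; simp)+
qed

lemma polar_cong:
  assumes "f \<in> borel_measurable borel" "g \<in> borel_measurable borel"
    "\<And>t. 1 \<le> t \<Longrightarrow> f t = g t" "u \<in> X" "v \<in> X"
  shows "polar f u v = polar g u v"
  unfolding polar_def using integral_mu_cong[OF assms(1-3)] assms(4,5) by (simp add: add_mem diff_mem)

text \<open>Allows \<open>t powr r\<close> to be altered below 1, where a negative power would be
  unbounded.\<close>

lemma spectral_integral_cong:
  assumes "f \<in> borel_measurable borel" "g \<in> borel_measurable borel"
    "\<And>t. 1 \<le> t \<Longrightarrow> f t = g t"
  shows "spectral_integral X E f = spectral_integral X E g"
proof -
  have dom: "spectral_domain X E f = spectral_domain X E g"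
    unfolding spectral_domain_def
    using integrable_mu_cong[of "\<lambda>t. (f t)\<^sup>2" "\<lambda>t. (g t)\<^sup>2"] assms by auto
  have "(u, w) \<in> spectral_integral X E f \<longleftrightarrow> (u, w) \<in> spectral_integral X E g" for u w
    unfolding spectral_integral_iff dom
    by (auto simp: polar_cong[OF assms] spectral_domain_def)
  then show ?thesis by auto
qed

text \<open>By \<open>mu_Phi\<close> the measure of \<open>Phi g z\<close> has density
  \<open>g\<^sup>2\<close>, which cancels the growth of \<open>f\<^sup>2\<close>; so the range of
  \<open>Phi g\<close> lies in the domain of \<open>f\<close>, and \<open>polar_Phi\<close>
  evaluates the integral there. Symmetry shows that the domain contains nothing else.\<close>

lemma spectral_integral_inverse:
  assumes f: "f \<in> borel_measurable borel" and g: "bounded_borel g" "\<And>t. 0 \<le> g t"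
    and fg: "\<And>t. 1 \<le> t \<Longrightarrow> f t * g t = 1"
  shows "spectral_integral X E f = {(Phi g z, z) |z. z \<in> X}"
proof -
  have gm: "g \<in> borel_measurable borel" using g(1) by (rule bounded_borel_measurable)
  note [measurable] = f gm
  have dom: "Phi g z \<in> spectral_domain X E f" if z: "z \<in> X" for z
  proof -
    have "(g t)\<^sup>2 * (f t)\<^sup>2 = 1" if "1 \<le> t" for t
      using fg[OF that] by (simp add: mult.commute flip: power_mult_distrib)
    then have "integrable (mu z) (\<lambda>t. (g t)\<^sup>2 * (f t)\<^sup>2) \<longleftrightarrow> integrable (mu z) (\<lambda>_. 1 :: real)"
      using z by (intro integrable_mu_cong) measurable
    then show ?thesis
      using g z by (simp add: spectral_domain_def Phi_mem integrable_mu_Phi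
          integrable_bounded_borel bounded_borel_const)
  qed
  have inner: "polar f (Phi g z) v = z \<bullet> v" if z: "z \<in> X" and v: "v \<in> spectral_domain X E f" for z v
  proof -
    have vX: "v \<in> X" using v by (simp add: spectral_domain_def)
    have "integrable (mu x) (\<lambda>t. f t * g t)" if x: "x \<in> X" for x
    proof -
      have "integrable (mu x) (\<lambda>t. f t * g t) \<longleftrightarrow> integrable (mu x) (\<lambda>_. 1 :: real)"
        using fg x by (intro integrable_mu_cong) auto
      then show ?thesis using x by (simp add: integrable_bounded_borel bounded_borel_const)
    qed
    note int = this[OF add_mem[OF z vX]] this[OF diff_mem[OF z vX]]
    have "polar f (Phi g z) v = polar (\<lambda>t. f t * g t) z v"
      using spectral_domain_add_diff[OF dom[OF z] v f, THEN integrable_spectral_domain, OF f]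
      by (intro polar_Phi z vX g f int)
    also have "\<dots> = polar (\<lambda>_. 1) z v"
      using fg z vX by (intro polar_cong) auto
    finally show ?thesis using z vX by (simp add: polar_one)
  qed
  have "u = Phi g w" if uw: "(u, w) \<in> spectral_integral X E f" for u w
  proof -
    have u: "u \<in> spectral_domain X E f" "u \<in> X" and w: "w \<in> X"
      using uw by (auto simp: spectral_integral_iff spectral_domain_def)
    show ?thesis
    proof (rule eq_if_inner_eq)
      fix v assume v: "v \<in> X"
      have "Phi g w \<bullet> v = w \<bullet> Phi g v" using g w v by (simp add: Phi_commute)
      \<comment> \<open>The defining identity of \<open>(u, w)\<close> holds only for test vectors
        in the domain, and \<open>Phi g v\<close> is one for every \<open>v\<close> in
        \<open>X\<close>.\<close>
      also have "\<dots> = polar f u (Phi g v)"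
        using uw dom[OF v] by (simp add: spectral_integral_iff)
      also have "\<dots> = polar f (Phi g v) u"
        using u g v by (intro polar_commute) (auto simp: Phi_mem)
      also have "\<dots> = u \<bullet> v" using inner[OF v u(1)] by (simp add: inner_commute)
      finally show "u \<bullet> v = Phi g w \<bullet> v" by simp
    qed (use u w g in \<open>auto simp: Phi_mem\<close>)
  qed
  moreover have "(Phi g z, z) \<in> spectral_integral X E f" if "z \<in> X" for z
    using that dom inner by (simp add: spectral_integral_iff)
  ultimately show ?thesis
    by (auto simp: spectral_integral_iff)
qed

end

section \<open>The absolute value of a self-adjoint contraction\<close>

text \<open>With \<open>B = 1 - C\<^sup>2\<close>, the iteration \<open>Y\<^sub>n\<^sub>+\<^sub>1 = (B + Y\<^sub>n\<^sup>2) / 2\<close> converges to \<open>Y\<close> with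
  \<open>(1 - Y)\<^sup>2 = C\<^sup>2\<close>. Convergence is controlled by the same iteration for \<open>B = 1\<close> in the reals,
  because the differences of the iterates are polynomials in \<open>B\<close> with nonnegative coefficients.\<close>

locale symmetric_contraction =
  fixes C :: "'h::{real_inner, complete_space} \<Rightarrow> 'h"
  assumes linear_C: "linear C"
    and C_sym: "\<And>x y. C x \<bullet> y = x \<bullet> C y"
    and norm_C: "\<And>x. norm (C x) \<le> norm x"
begin

section \<open>The iteration and its scalar majorant\<close>

primrec iter :: "nat \<Rightarrow> 'h \<Rightarrow> 'h" where
  "iter 0 x = 0"
| "iter (Suc n) x = (1/2) *\<^sub>R (x - C (C x) + iter n (iter n x))"

primrec bnd :: "nat \<Rightarrow> real" where
  "bnd 0 = 0"
| "bnd (Suc n) = (1 + (bnd n)\<^sup>2) / 2"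

lemma linear_iter: "linear (iter n)"
proof (induction n)
  case (Suc n)
  show ?case
    by (rule linearI) (simp_all add: linear_add[OF linear_C] linear_scale[OF linear_C]
        linear_add[OF Suc] linear_scale[OF Suc] algebra_simps)
qed (simp add: linearI)

text \<open>Used with \<open>Q\<close> an earlier iterate, so that iterates commute with each other,
  and later with the operators that must preserve spectral subspaces.\<close>

lemma iter_commute:
  assumes "linear Q" "\<And>x. Q (C x) = C (Q x)"
  shows "Q (iter n x) = iter n (Q x)"
  by (induction n arbitrary: x)
    (simp_all add: linear_0 linear_scale linear_add linear_diff assms)

lemma iter_iter: "iter n (iter m x) = iter m (iter n x)"
  by (rule iter_commute[OF linear_iter])
    (rule iter_commute[OF linear_C, symmetric], simp)

lemma iter_sym: "iter n x \<bullet> y = x \<bullet> iter n y"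
  by (induction n arbitrary: x y)
    (simp_all add: inner_add_left inner_add_right inner_diff_left inner_diff_right C_sym)

lemma norm_defect: "norm (x - C (C x)) \<le> norm x"
proof -
  have "(norm (x - C (C x)))\<^sup>2 = (norm x)\<^sup>2 - 2 * (norm (C x))\<^sup>2 + (norm (C (C x)))\<^sup>2"
    unfolding power2_norm_eq_inner by (simp add: inner_diff_left inner_diff_right C_sym inner_commute)
  also have "\<dots> \<le> (norm x)\<^sup>2"
    using power_mono[OF norm_C[of "C x"] norm_ge_zero, of 2] zero_le_power2[of "norm (C x)"] by linarith
  finally show ?thesis by (rule power2_le_imp_le) simp
qed

lemma bnd_bounds: "0 \<le> bnd n" "bnd n \<le> 1"
proof (induction n)
  case (Suc n)
  then have "(bnd n)\<^sup>2 \<le> 1" by (intro power_le_one) auto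
  then show "0 \<le> bnd (Suc n)" "bnd (Suc n) \<le> 1" by (auto simp: field_simps)
qed auto

lemma bnd_incseq: "incseq bnd"
proof (rule incseq_SucI)
  fix n
  have "0 \<le> (1 - bnd n)\<^sup>2" by simp
  then show "bnd n \<le> bnd (Suc n)" by (simp add: power2_diff)
qed

lemma norm_iter: "norm (iter n x) \<le> bnd n * norm x"
proof (induction n arbitrary: x)
  case (Suc n)
  have "norm (iter n (iter n x)) \<le> bnd n * (bnd n * norm x)"
    using Suc[of "iter n x"] mult_left_mono[OF Suc[of x], of "bnd n"] bnd_bounds by force
  then have "norm (x - C (C x) + iter n (iter n x)) \<le> norm x + bnd n * (bnd n * norm x)"
    using norm_triangle_ineq[of "x - C (C x)" "iter n (iter n x)"] norm_defect[of x] by linarith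
  then have "norm (iter (Suc n) x) \<le> (norm x + bnd n * (bnd n * norm x)) / 2" by simp
  then show ?case by (simp add: power2_eq_square field_simps)
qed simp

lemma norm_iter_le: "norm (iter n x) \<le> norm x"
  using norm_iter[of n x] mult_right_mono[OF bnd_bounds(2)[of n], of "norm x"] by simp

text \<open>Because the iterates commute, the difference of the squares of two consecutive ones
  factors into their sum and their difference. The sum is bounded by the scalar sum and the
  difference by induction, and the product is the scalar increment by the same
  factorization.\<close>

lemma norm_iter_diff: "norm (iter (Suc n) x - iter n x) \<le> (bnd (Suc n) - bnd n) * norm x"
proof (induction n)
  case 0
  show ?case using norm_defect[of x] by simp
next
  case (Suc n)
  define d where "d = iter (Suc n) x - iter n x"
  have "iter (Suc (Suc n)) x - iter (Suc n) x =
      (1/2) *\<^sub>R (iter (Suc n) (iter (Suc n) x) - iter n (iter n x))"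
    unfolding iter.simps(2)[of "Suc n" x] by (subst (3) iter.simps(2)) (simp add: algebra_simps)
  also have "iter (Suc n) (iter (Suc n) x) - iter n (iter n x) = iter (Suc n) d + iter n d"
    unfolding d_def linear_diff[OF linear_iter] using iter_iter[of n "Suc n" x] by (simp del: iter.simps)
  finally have "norm (iter (Suc (Suc n)) x - iter (Suc n) x) \<le> (norm (iter (Suc n) d) + norm (iter n d)) / 2"
    using norm_triangle_ineq[of "iter (Suc n) d" "iter n d"] by (simp del: iter.simps)
  also have "\<dots> \<le> (bnd (Suc n) * norm d + bnd n * norm d) / 2"
    by (intro divide_right_mono add_mono norm_iter) simp
  also have "\<dots> = (bnd (Suc n) + bnd n) / 2 * norm d" by (simp only: distrib_right times_divide_eq_left)
  also have "\<dots> \<le> (bnd (Suc n) + bnd n) / 2 * ((bnd (Suc n) - bnd n) * norm x)"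
    using Suc bnd_bounds[of n] bnd_bounds[of "Suc n"] unfolding d_def by (intro mult_left_mono) auto
  also have "\<dots> = (bnd (Suc (Suc n)) - bnd (Suc n)) * norm x"
  proof -
    have "(bnd (Suc n) + bnd n) / 2 * (bnd (Suc n) - bnd n) = ((bnd (Suc n))\<^sup>2 - (bnd n)\<^sup>2) / 2"
      by (simp add: power2_eq_square algebra_simps del: bnd.simps)
    also have "\<dots> = bnd (Suc (Suc n)) - bnd (Suc n)"
      unfolding bnd.simps(2)[of "Suc n"] by (simp add: field_simps)
    finally show ?thesis by (simp only: mult.assoc[symmetric])
  qed
  finally show ?case .
qed

lemma norm_iter_diff_le:
  assumes "n \<le> m"
  shows "norm (iter m x - iter n x) \<le> (bnd m - bnd n) * norm x"
  using assms
proof (induction m rule: dec_induct)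
  case (step m)
  then show ?case
    using norm_triangle_ineq[of "iter (Suc m) x - iter m x" "iter m x - iter n x"] norm_iter_diff[of m x]
    by (simp add: algebra_simps del: iter.simps bnd.simps)
qed simp

lemma convergent_iter: "convergent (\<lambda>n. iter n x)"
proof (rule Cauchy_convergent, rule metric_CauchyI)
  fix e :: real assume e: "0 < e"
  have "convergent bnd"
    by (rule Bseq_mono_convergent)
      (use bnd_bounds bnd_incseq in \<open>auto simp: incseq_def intro!: BseqI'[of _ 1]\<close>)
  then have "Cauchy bnd" by (rule convergent_Cauchy)
  \<comment> \<open>The added 1 covers \<open>x = 0\<close>.\<close>
  then obtain N where N: "\<And>m n. N \<le> m \<Longrightarrow> N \<le> n \<Longrightarrow> dist (bnd m) (bnd n) < e / (norm x + 1)"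
    using e unfolding Cauchy_def by (metis add_nonneg_pos divide_pos_pos norm_ge_zero zero_less_one)
  have *: "dist (iter m x) (iter n x) < e" if "N \<le> n" "n \<le> m" for m n
  proof -
    have "dist (iter m x) (iter n x) \<le> (bnd m - bnd n) * norm x"
      unfolding dist_norm by (rule norm_iter_diff_le[OF that(2)])
    also have "\<dots> \<le> (bnd m - bnd n) * (norm x + 1)"
      using bnd_incseq that by (intro mult_left_mono) (auto simp: incseq_def)
    also have "\<dots> < e / (norm x + 1) * (norm x + 1)"
      using N[of m n] that by (intro mult_strict_right_mono) (auto simp: dist_real_def add_nonneg_pos)
    also have "\<dots> = e" using norm_ge_zero[of x] by (simp add: add_nonneg_eq_0_iff)
    finally show ?thesis .
  qed
  show "\<exists>N. \<forall>m\<ge>N. \<forall>n\<ge>N. dist (iter m x) (iter n x) < e"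
    using * by (metis dist_commute nle_le)
qed

definition iter_lim :: "'h \<Rightarrow> 'h" where "iter_lim x = lim (\<lambda>n. iter n x)"

lemma iter_tendsto: "(\<lambda>n. iter n x) \<longlonglongrightarrow> iter_lim x"
  unfolding iter_lim_def using convergent_iter by (simp add: convergent_LIMSEQ_iff)

lemma linear_iter_lim: "linear iter_lim"
proof (rule linearI)
  show "iter_lim (x + y) = iter_lim x + iter_lim y" for x y
    by (rule LIMSEQ_unique[OF iter_tendsto])
      (simp add: linear_add[OF linear_iter] tendsto_add iter_tendsto)
  show "iter_lim (c *\<^sub>R x) = c *\<^sub>R iter_lim x" for c x
    by (rule LIMSEQ_unique[OF iter_tendsto])
      (simp add: linear_scale[OF linear_iter] tendsto_scaleR iter_tendsto)
qed

lemma norm_iter_lim: "norm (iter_lim x) \<le> norm x"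
  by (rule LIMSEQ_le_const2[OF tendsto_norm[OF iter_tendsto]]) (auto intro: norm_iter_le)

lemma iter_lim_sym: "iter_lim x \<bullet> y = x \<bullet> iter_lim y"
proof (rule LIMSEQ_unique)
  show "(\<lambda>n. iter n x \<bullet> y) \<longlonglongrightarrow> iter_lim x \<bullet> y" by (intro tendsto_intros iter_tendsto)
  show "(\<lambda>n. iter n x \<bullet> y) \<longlonglongrightarrow> x \<bullet> iter_lim y"
    unfolding iter_sym by (intro tendsto_intros iter_tendsto)
qed

lemma iter_lim_commute:
  assumes "bounded_linear Q" "\<And>x. Q (C x) = C (Q x)"
  shows "Q (iter_lim x) = iter_lim (Q x)"
proof (rule LIMSEQ_unique)
  show "(\<lambda>n. Q (iter n x)) \<longlonglongrightarrow> Q (iter_lim x)"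
    by (rule bounded_linear.tendsto[OF assms(1) iter_tendsto])
  show "(\<lambda>n. Q (iter n x)) \<longlonglongrightarrow> iter_lim (Q x)"
    using iter_tendsto[of "Q x"] by (simp add: iter_commute[OF bounded_linear.linear[OF assms(1)] assms(2)])
qed

text \<open>Pointwise convergence survives squaring because the iterates are contractions:
  \<open>iter n (iter n x - iter_lim x)\<close> tends to 0.\<close>

lemma iter_lim_fixpoint: "iter_lim x = (1/2) *\<^sub>R (x - C (C x) + iter_lim (iter_lim x))"
proof (rule LIMSEQ_unique)
  show "(\<lambda>n. iter (Suc n) x) \<longlonglongrightarrow> iter_lim x" by (rule LIMSEQ_Suc[OF iter_tendsto])
  have "(\<lambda>n. iter n (iter n x - iter_lim x)) \<longlonglongrightarrow> 0"
  proof (rule Lim_null_comparison)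
    show "\<forall>\<^sub>F n in sequentially. norm (iter n (iter n x - iter_lim x)) \<le> norm (iter n x - iter_lim x)"
      by (simp add: norm_iter_le)
    show "(\<lambda>n. norm (iter n x - iter_lim x)) \<longlonglongrightarrow> 0"
      using iter_tendsto[of x] by (simp add: LIM_zero tendsto_norm_zero)
  qed
  from tendsto_add[OF this iter_tendsto[of "iter_lim x"]]
  have "(\<lambda>n. iter n (iter n x)) \<longlonglongrightarrow> iter_lim (iter_lim x)"
    by (simp add: linear_diff[OF linear_iter])
  then show "(\<lambda>n. iter (Suc n) x) \<longlonglongrightarrow> (1/2) *\<^sub>R (x - C (C x) + iter_lim (iter_lim x))"
    unfolding iter.simps by (intro tendsto_intros)
qed

section \<open>The absolute value and the splitting of the space\<close>

definition absval :: "'h \<Rightarrow> 'h" where "absval x = x - iter_lim x"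

lemma linear_absval: "linear absval"
  unfolding absval_def by (intro linear_compose_sub linear_iter_lim linear_ident)

lemma absval_sym: "absval x \<bullet> y = x \<bullet> absval y"
  by (simp add: absval_def inner_diff_left inner_diff_right iter_lim_sym)

lemma absval_nonneg: "0 \<le> absval x \<bullet> x"
proof -
  have "iter_lim x \<bullet> x \<le> norm x * norm x"
    using Cauchy_Schwarz_ineq2[of "iter_lim x" x] mult_right_mono[OF norm_iter_lim[of x] norm_ge_zero[of x]]
    by linarith
  then show ?thesis by (simp add: absval_def inner_diff_left power2_eq_square flip: power2_norm_eq_inner)
qed

lemma absval_absval: "absval (absval x) = C (C x)"
proof -
  have "2 *\<^sub>R iter_lim x = x - C (C x) + iter_lim (iter_lim x)"
    by (subst iter_lim_fixpoint) simp
  then show ?thesis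
    by (simp add: absval_def linear_diff[OF linear_iter_lim] scaleR_2 algebra_simps)
qed

lemma absval_commute:
  "bounded_linear Q \<Longrightarrow> (\<And>x. Q (C x) = C (Q x)) \<Longrightarrow> Q (absval x) = absval (Q x)"
  by (simp add: absval_def linear_diff[OF bounded_linear.linear] iter_lim_commute)

lemma bounded_linear_C: "bounded_linear C"
  using linear_C norm_C by (intro bounded_linear_intro[of _ 1]) (auto simp: linear_add linear_scale)

lemma bounded_linear_absval: "bounded_linear absval"
proof (rule bounded_linear_intro[of _ 2])
  show "norm (absval x) \<le> norm x * 2" for x
    using norm_triangle_ineq4[of x "iter_lim x"] norm_iter_lim[of x] by (simp add: absval_def)
qed (simp_all add: linear_add[OF linear_absval] linear_scale[OF linear_absval])

text \<open>Cauchy-Schwarz for the semidefinite form of \<open>absval\<close>, applied to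
  \<open>u\<close> and \<open>absval u\<close>.\<close>

lemma absval_null:
  assumes "absval u \<bullet> u = 0" shows "absval u = 0"
proof -
  define q where "q = absval (absval u) \<bullet> absval u"
  have "((norm (absval u))\<^sup>2)\<^sup>2 \<le> q * 0"
  proof (rule discriminant_le)
    fix t
    have "0 \<le> absval (u + t *\<^sub>R absval u) \<bullet> (u + t *\<^sub>R absval u)" by (rule absval_nonneg)
    also have "\<dots> = t\<^sup>2 * q + 2 * t * (norm (absval u))\<^sup>2 + 0"
      using assms unfolding q_def power2_norm_eq_inner
      by (simp add: linear_add[OF linear_absval] linear_scale[OF linear_absval] inner_add_left
          inner_add_right absval_sym[of "absval u" u] power2_eq_square algebra_simps)
    finally show "0 \<le> t\<^sup>2 * q + 2 * t * (norm (absval u))\<^sup>2 + 0" .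
  qed (simp add: q_def absval_nonneg)
  then show ?thesis by simp
qed

text \<open>The kernel of the positive part \<open>(\<bar>C\<bar> + C) / 2\<close>.\<close>

definition nonpos_space :: "'h set" where "nonpos_space = {u. absval u + C u = 0}"

lemma subspace_nonpos_space: "subspace nonpos_space"
proof -
  have "linear (\<lambda>u. absval u + C u)" by (intro linear_compose_add linear_absval linear_C)
  then show ?thesis unfolding nonpos_space_def by (rule linear_subspace_kernel)
qed

lemma closed_nonpos_space: "closed nonpos_space"
proof -
  have "continuous_on UNIV (\<lambda>u. absval u + C u)"
    by (intro continuous_intros linear_continuous_on bounded_linear_absval bounded_linear_C)
  then show ?thesis
    unfolding nonpos_space_def by (intro closed_Collect_eq) auto
qed

lemma nonpos_space_le: "u \<in> nonpos_space \<Longrightarrow> C u \<bullet> u \<le> 0"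
  using absval_nonneg[of u] by (simp add: nonpos_space_def add_eq_0_iff)

lemma nonpos_space_invariant:
  assumes "bounded_linear Q" "\<And>x. Q (C x) = C (Q x)" "u \<in> nonpos_space"
  shows "Q u \<in> nonpos_space"
proof -
  have "absval (Q u) + C (Q u) = Q (absval u + C u)"
    using assms(1,2) by (simp add: absval_commute linear_add[OF bounded_linear.linear])
  then show ?thesis
    using assms(1,3) by (simp add: nonpos_space_def linear_0[OF bounded_linear.linear])
qed

text \<open>The product of \<open>\<bar>C\<bar> + C\<close> and \<open>\<bar>C\<bar> - C\<close> is
  0, so the range of the second operator lies in \<open>nonpos_space\<close>. A vector orthogonal to
  that space is then in the kernel of \<open>\<bar>C\<bar> - C\<close>, that is,
  \<open>C u = \<bar>C\<bar> u\<close>.\<close>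

lemma
  assumes u: "\<And>v. v \<in> nonpos_space \<Longrightarrow> u \<bullet> v = 0"
  shows nonpos_space_orth: "0 \<le> C u \<bullet> u"
    and nonpos_space_orth_null: "C u \<bullet> u = 0 \<Longrightarrow> u = 0"
proof -
  have comm: "C (absval x) = absval (C x)" for x
    by (rule absval_commute[OF bounded_linear_C refl])
  have mem: "absval x - C x \<in> nonpos_space" for x
    by (simp add: nonpos_space_def linear_diff[OF linear_absval] linear_diff[OF linear_C]
        absval_absval comm)
  have "(absval u - C u) \<bullet> (absval u - C u) = u \<bullet> (absval (absval u - C u) - C (absval u - C u))"
    by (simp add: inner_diff_left inner_diff_right absval_sym C_sym
        linear_diff[OF linear_absval] linear_diff[OF linear_C])
  also have "\<dots> = 0" by (rule u[OF mem])
  finally have eq: "C u = absval u" by simp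
  show "0 \<le> C u \<bullet> u" unfolding eq by (rule absval_nonneg)
  assume "C u \<bullet> u = 0"
  then have "absval u = 0" unfolding eq by (rule absval_null)
  then have "u \<in> nonpos_space" by (simp add: nonpos_space_def eq)
  then have "u \<bullet> u = 0" by (rule u)
  then show "u = 0" by simp
qed

end

text \<open>\<open>N\<close> is the subspace where \<open>1 \<le> t T\<close>. The strictness on the
  complement puts the kernel of \<open>1 - t T\<close> into \<open>N\<close>; monotonicity and right
  continuity in \<open>t\<close> depend on it. The last clause makes the projection commute with
  symmetric bounded operators that commute with \<open>T\<close>.\<close>

lemma spectral_subspace_exists:
  fixes T :: "'h::{real_inner, complete_space} \<Rightarrow> 'h"
  assumes lin: "linear T" and sym: "\<And>x y. T x \<bullet> y = x \<bullet> T y" and norm: "\<And>x. norm (T x) \<le> norm x"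
  shows "\<exists>N. subspace N \<and> closed N \<and> (\<forall>u\<in>N. (norm u)\<^sup>2 \<le> t * (T u \<bullet> u)) \<and>
    (\<forall>u. (\<forall>v\<in>N. u \<bullet> v = 0) \<longrightarrow>
      t * (T u \<bullet> u) \<le> (norm u)\<^sup>2 \<and> (t * (T u \<bullet> u) = (norm u)\<^sup>2 \<longrightarrow> u = 0)) \<and>
    (\<forall>Q. bounded_linear Q \<longrightarrow> (\<forall>x. Q (T x) = T (Q x)) \<longrightarrow> (\<forall>u\<in>N. Q u \<in> N))"
proof -
  \<comment> \<open>Normalizes \<open>1 - t T\<close>, whose norm is at most
    \<open>1 + \<bar>t\<bar>\<close>, to a contraction.\<close>
  define c where "c = 1 / (1 + \<bar>t\<bar>)"
  have c: "0 < c" by (simp add: c_def add_pos_nonneg)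
  define C where "C x = c *\<^sub>R (x - t *\<^sub>R T x)" for x
  interpret symmetric_contraction C
  proof (rule symmetric_contraction.intro)
    show "linear C"
      unfolding C_def by (rule linearI) (simp_all add: linear_add[OF lin] linear_scale[OF lin] algebra_simps)
    show "C x \<bullet> y = x \<bullet> C y" for x y
      by (simp add: C_def inner_diff_left inner_diff_right sym)
    show "norm (C x) \<le> norm x" for x
    proof -
      have "norm (x - t *\<^sub>R T x) \<le> norm x + \<bar>t\<bar> * norm (T x)"
        using norm_triangle_ineq4[of x "t *\<^sub>R T x"] by simp
      also have "\<dots> \<le> norm x + \<bar>t\<bar> * norm x"
        by (intro add_left_mono mult_left_mono norm) simp
      also have "\<dots> = (1 + \<bar>t\<bar>) * norm x" by (simp add: distrib_right)
      finally have "c * norm (x - t *\<^sub>R T x) \<le> c * ((1 + \<bar>t\<bar>) * norm x)"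
        using c by (intro mult_left_mono) auto
      also have "\<dots> = norm x" by (simp add: c_def add_nonneg_eq_0_iff)
      finally show ?thesis using c by (simp add: C_def)
    qed
  qed
  have C_inner: "C u \<bullet> u = c * ((norm u)\<^sup>2 - t * (T u \<bullet> u))" for u
    by (simp add: C_def inner_diff_left power2_norm_eq_inner)
  show ?thesis
  proof (intro exI[of _ nonpos_space] conjI ballI allI impI)
    show "(norm u)\<^sup>2 \<le> t * (T u \<bullet> u)" if "u \<in> nonpos_space" for u
      using nonpos_space_le[OF that] c unfolding C_inner by (simp add: mult_le_0_iff)
    show "t * (T u \<bullet> u) \<le> (norm u)\<^sup>2" if "\<forall>v\<in>nonpos_space. u \<bullet> v = 0" for u
      using nonpos_space_orth[of u] that c unfolding C_inner by (simp add: zero_le_mult_iff)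
    show "u = 0" if "\<forall>v\<in>nonpos_space. u \<bullet> v = 0" "t * (T u \<bullet> u) = (norm u)\<^sup>2" for u
      using nonpos_space_orth_null[of u] that unfolding C_inner by simp
    show "Q u \<in> nonpos_space"
      if "bounded_linear Q" "\<forall>x. Q (T x) = T (Q x)" "u \<in> nonpos_space" for Q u
      by (rule nonpos_space_invariant)
        (use that in \<open>auto simp: C_def linear_diff[OF bounded_linear.linear] linear_scale[OF bounded_linear.linear]\<close>)
  qed (rule subspace_nonpos_space closed_nonpos_space)+
qed

section \<open>The spectral theorem for the inverse of a bounded operator\<close>

text \<open>Over \<open>n\<close> equal pieces the bounds telescope in \<open>F\<close> and leave a
  factor \<open>1 / n\<close>. No continuity of \<open>F\<close> is involved; it will be a
  distribution function, which may jump.\<close>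

lemma eq_if_small_increments:
  fixes f F :: "real \<Rightarrow> real"
  assumes inc: "\<And>r t. a \<le> r \<Longrightarrow> r \<le> t \<Longrightarrow> \<bar>f t - f r\<bar> \<le> C * (t - r) * (F t - F r)"
    and x: "a \<le> x"
  shows "f x = f a"
proof -
  have le: "\<bar>f x - f a\<bar> \<le> C * (x - a) * (F x - F a) * (1 / real (Suc m))" for m
  proof -
    define n where "n = Suc m"
    have n: "0 < real n" by (simp add: n_def)
    define p where "p i = a + real i * ((x - a) / n)" for i
    have p: "a \<le> p i" "p i \<le> p (Suc i)" "p (Suc i) - p i = (x - a) / n" for i
      using x n by (auto simp: p_def field_simps mult_right_mono)
    have ends: "p 0 = a" "p n = x" using n by (auto simp: p_def)
    have "f x - f a = (\<Sum>i<n. f (p (Suc i)) - f (p i))"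
      by (simp add: sum_lessThan_telescope[of "\<lambda>i. f (p i)"] ends)
    also have "\<bar>\<dots>\<bar> \<le> (\<Sum>i<n. C * ((x - a) / n) * (F (p (Suc i)) - F (p i)))"
      by (rule order_trans[OF sum_abs sum_mono]) (metis inc p)
    also have "\<dots> = C * ((x - a) / n) * (F x - F a)"
      by (simp only: sum_distrib_left[symmetric] sum_lessThan_telescope[of "\<lambda>i. F (p i)"] ends)
    finally show ?thesis by (simp add: n_def)
  qed
  have "(\<lambda>m. C * (x - a) * (F x - F a) * (1 / real (Suc m))) \<longlonglongrightarrow> C * (x - a) * (F x - F a) * 0"
    by (intro tendsto_intros LIMSEQ_Suc[OF lim_1_over_n])
  then have "\<bar>f x - f a\<bar> \<le> C * (x - a) * (F x - F a) * 0"
    by (rule LIMSEQ_le_const) (use le in blast)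
  then show ?thesis by simp
qed

text \<open>\<open>T\<close> acts on the whole complete type, so that the operators are total and
  linear, while injectivity is asked only on \<open>X\<close>. The projection \<open>P\<close>
  commuting with \<open>T\<close> brings the spectral projections back to \<open>X\<close>.\<close>

locale spectral_inverse =
  fixes T P :: "'h::{real_inner, complete_space} \<Rightarrow> 'h" and X :: "'h set"
  assumes linear_T: "linear T" and T_sym: "\<And>x y. T x \<bullet> y = x \<bullet> T y"
    and norm_T: "\<And>x. norm (T x) \<le> norm x" and T_nonneg: "\<And>x. 0 \<le> T x \<bullet> x"
    and X: "subspace X" "closed X"
    and P: "bounded_linear P" and P_sym: "\<And>x y. P x \<bullet> y = x \<bullet> P y"
    and P_mem: "\<And>x. P x \<in> X" and P_id: "\<And>x. x \<in> X \<Longrightarrow> P x = x"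
    and P_T: "\<And>x. P (T x) = T (P x)"
    and T_inj: "\<And>x. x \<in> X \<Longrightarrow> T x = 0 \<Longrightarrow> x = 0"
begin

lemma bounded_linear_T: "bounded_linear T"
  using linear_T norm_T by (intro bounded_linear_intro[of _ 1]) (auto simp: linear_add linear_scale)

lemma T_le: "T x \<bullet> x \<le> (norm x)\<^sup>2"
  using Cauchy_Schwarz_ineq2[of "T x" x] mult_right_mono[OF norm_T[of x] norm_ge_zero[of x]]
  by (simp add: power2_eq_square)

section \<open>Spectral subspaces and their projections\<close>

definition N :: "real \<Rightarrow> 'h set" where
  "N t = (SOME N. subspace N \<and> closed N \<and> (\<forall>u\<in>N. (norm u)\<^sup>2 \<le> t * (T u \<bullet> u)) \<and>
    (\<forall>u. (\<forall>v\<in>N. u \<bullet> v = 0) \<longrightarrow>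
      t * (T u \<bullet> u) \<le> (norm u)\<^sup>2 \<and> (t * (T u \<bullet> u) = (norm u)\<^sup>2 \<longrightarrow> u = 0)) \<and>
    (\<forall>Q. bounded_linear Q \<longrightarrow> (\<forall>x. Q (T x) = T (Q x)) \<longrightarrow> (\<forall>u\<in>N. Q u \<in> N)))"

lemma
  shows subspace_N: "subspace (N t)" and closed_N: "closed (N t)"
    and N_le: "u \<in> N t \<Longrightarrow> (norm u)\<^sup>2 \<le> t * (T u \<bullet> u)"
    and N_orth: "(\<And>v. v \<in> N t \<Longrightarrow> u \<bullet> v = 0) \<Longrightarrow> t * (T u \<bullet> u) \<le> (norm u)\<^sup>2"
    and N_orth_eq: "(\<And>v. v \<in> N t \<Longrightarrow> u \<bullet> v = 0) \<Longrightarrow> t * (T u \<bullet> u) = (norm u)\<^sup>2 \<Longrightarrow> u = 0"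
    and N_invariant: "bounded_linear Q \<Longrightarrow> (\<And>x. Q (T x) = T (Q x)) \<Longrightarrow> u \<in> N t \<Longrightarrow> Q u \<in> N t"
  using someI_ex[OF spectral_subspace_exists[OF linear_T T_sym norm_T, of t]]
  unfolding N_def[symmetric] by blast+

definition E :: "real \<Rightarrow> 'h \<Rightarrow> 'h" where
  "E t u = (SOME w. w \<in> N t \<and> (\<forall>v\<in>N t. w \<bullet> v = u \<bullet> v))"

lemma E_mem: "E t u \<in> N t" and E_inner: "v \<in> N t \<Longrightarrow> E t u \<bullet> v = u \<bullet> v"
proof -
  have "\<exists>w. w \<in> N t \<and> (\<forall>v\<in>N t. w \<bullet> v = u \<bullet> v)"
    using orthogonal_projection[OF subspace_N complete_eq_closed[THEN iffD2, OF closed_N]] by blast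
  from someI_ex[OF this] show "E t u \<in> N t" "v \<in> N t \<Longrightarrow> E t u \<bullet> v = u \<bullet> v"
    unfolding E_def by blast+
qed

lemma E_orth: "v \<in> N t \<Longrightarrow> (u - E t u) \<bullet> v = 0"
  by (simp add: inner_diff_left E_inner)

lemma E_eqI:
  assumes "w \<in> N t" "\<And>v. v \<in> N t \<Longrightarrow> w \<bullet> v = u \<bullet> v"
  shows "E t u = w"
proof -
  have "E t u - w \<in> N t" by (intro subspace_diff subspace_N E_mem assms)
  then have "(E t u - w) \<bullet> (E t u - w) = 0"
    using assms(2) by (simp add: inner_diff_left E_inner)
  then show ?thesis by simp
qed

lemma E_id: "u \<in> N t \<Longrightarrow> E t u = u"
  by (rule E_eqI) auto

lemma linear_E: "linear (E t)"
  by (intro linearI E_eqI subspace_add subspace_mul subspace_N E_mem)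
    (simp_all add: inner_add_left E_inner)

lemma E_sym: "E t u \<bullet> v = u \<bullet> E t v"
  using E_inner[OF E_mem, of t u v] E_inner[OF E_mem, of t v u] by (simp add: inner_commute)

lemma norm_E: "norm (E t u) \<le> norm u"
proof -
  have "(norm (E t u))\<^sup>2 \<le> norm u * norm (E t u)"
    using E_inner[OF E_mem, of t u u] Cauchy_Schwarz_ineq2[of u "E t u"] by (simp add: power2_norm_eq_inner)
  then show ?thesis
    by (cases "E t u = 0") (auto simp: power2_eq_square)
qed

lemma bounded_linear_E: "bounded_linear (E t)"
  using linear_E norm_E by (intro bounded_linear_intro[of _ 1]) (auto simp: linear_add linear_scale)

text \<open>\<open>Q\<close> preserves \<open>N t\<close>, and being symmetric it also preserves the
  orthogonal complement.\<close>

lemma E_commute: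
  assumes Q: "bounded_linear Q" "\<And>x y. Q x \<bullet> y = x \<bullet> Q y" "\<And>x. Q (T x) = T (Q x)"
  shows "Q (E t u) = E t (Q u)"
proof (rule E_eqI[symmetric])
  show "Q (E t u) \<in> N t" by (rule N_invariant[OF Q(1,3) E_mem])
  show "Q (E t u) \<bullet> v = Q u \<bullet> v" if "v \<in> N t" for v
    using E_inner[OF N_invariant[OF Q(1,3) that]] by (simp add: Q(2))
qed

lemma T_E: "T (E t u) = E t (T u)"
  by (rule E_commute[OF bounded_linear_T T_sym refl])

lemma P_E: "P (E t u) = E t (P u)"
  by (rule E_commute[OF P P_sym P_T])

lemma E_X: "u \<in> X \<Longrightarrow> E t u \<in> X"
  using P_mem[of "E t u"] by (simp add: P_E P_id)

lemma E_E: "E r (E t u) = E t (E r u)"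
  by (rule E_commute[OF bounded_linear_E E_sym T_E[symmetric]])

text \<open>The part \<open>w\<close> of \<open>u\<close> orthogonal to \<open>N t\<close> is still
  in \<open>N r\<close>. It satisfies both opposite inequalities for \<open>t\<close>, and equality
  on the complement forces \<open>w = 0\<close>.\<close>

lemma N_mono:
  assumes "r \<le> t" "u \<in> N r" shows "u \<in> N t"
proof -
  define w where "w = u - E t u"
  have "E t u \<in> N r"
    by (rule N_invariant[OF bounded_linear_E T_E[symmetric] assms(2)])
  then have "w \<in> N r" unfolding w_def by (intro subspace_diff subspace_N assms)
  then have "(norm w)\<^sup>2 \<le> r * (T w \<bullet> w)" by (rule N_le)
  also have "\<dots> \<le> t * (T w \<bullet> w)" by (intro mult_right_mono assms T_nonneg)
  finally have "(norm w)\<^sup>2 \<le> t * (T w \<bullet> w)" .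
  moreover have orth: "w \<bullet> v = 0" if "v \<in> N t" for v
    unfolding w_def by (rule E_orth[OF that])
  ultimately have "w = 0" using N_orth[of t w, OF orth] by (intro N_orth_eq[of t w, OF orth]) auto
  then show ?thesis using E_mem[of t u] by (simp add: w_def)
qed

lemma E_E_le: "r \<le> t \<Longrightarrow> E r (E t u) = E r u" "r \<le> t \<Longrightarrow> E t (E r u) = E r u"
  using E_id[OF N_mono[OF _ E_mem], of r t u] by (simp_all add: E_E)

lemma N_small: "t < 1 \<Longrightarrow> u \<in> N t \<Longrightarrow> u = 0"
proof -
  assume t: "t < 1" and u: "u \<in> N t"
  have "(norm u)\<^sup>2 \<le> t * (T u \<bullet> u)" by (rule N_le[OF u])
  \<comment> \<open>A nonnegative factor is needed before the upper bound \<open>T_le\<close> can be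
    inserted, and \<open>t\<close> may be negative.\<close>
  also have "\<dots> \<le> max 0 t * (T u \<bullet> u)" by (intro mult_right_mono T_nonneg) simp
  also have "\<dots> \<le> max 0 t * (norm u)\<^sup>2" by (intro mult_left_mono T_le) simp
  finally have "(1 - max 0 t) * (norm u)\<^sup>2 \<le> 0" by (simp add: left_diff_distrib)
  then show ?thesis using t by (auto simp: mult_le_0_iff max_def split: if_splits)
qed

lemma E_small: "t < 1 \<Longrightarrow> E t u = 0"
  using N_small E_mem by blast

section \<open>Limits of the projections\<close>

lemma E_inner_self: "E t u \<bullet> u = (norm (E t u))\<^sup>2"
  using E_inner[OF E_mem, of t u u] by (simp add: power2_norm_eq_inner inner_commute)

lemma norm_E_diff: "r \<le> t \<Longrightarrow> (norm (E t u - E r u))\<^sup>2 = E t u \<bullet> u - E r u \<bullet> u"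
proof -
  assume rt: "r \<le> t"
  have 1: "E t u \<bullet> E r u = E r u \<bullet> u"
    using E_sym[of r "E t u" u] rt by (simp add: E_E_le inner_commute)
  have "(norm (E t u - E r u))\<^sup>2 = (norm (E t u))\<^sup>2 - 2 * (E t u \<bullet> E r u) + (norm (E r u))\<^sup>2"
    by (simp add: power2_norm_eq_inner inner_diff_left inner_diff_right inner_commute)
  then show ?thesis by (simp add: 1 flip: E_inner_self)
qed

lemma E_inner_mono: "r \<le> t \<Longrightarrow> E r u \<bullet> u \<le> E t u \<bullet> u"
  using norm_E_diff[of r t u] zero_le_power2[of "norm (E t u - E r u)"] by linarith

lemma E_inner_bounds: "0 \<le> E t u \<bullet> u" "E t u \<bullet> u \<le> (norm u)\<^sup>2"
  unfolding E_inner_self using norm_E[of t u] by (auto intro: power_mono)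

text \<open>Squared distances between these projections of \<open>u\<close> are differences of the
  bounded monotone function \<open>E t u \<bullet> u\<close>.\<close>

lemma convergent_E:
  assumes "monoseq x" shows "convergent (\<lambda>n::nat. E (x n) u)"
proof (rule Cauchy_convergent, rule metric_CauchyI)
  fix e :: real assume e: "0 < e"
  have "monoseq (\<lambda>n. E (x n) u \<bullet> u)"
    using assms unfolding monoseq_def by (meson E_inner_mono)
  moreover have "Bseq (\<lambda>n. E (x n) u \<bullet> u)"
    using E_inner_bounds by (intro BseqI'[of _ "(norm u)\<^sup>2"]) auto
  ultimately have "Cauchy (\<lambda>n. E (x n) u \<bullet> u)"
    by (intro convergent_Cauchy Bseq_monoseq_convergent)
  then obtain n0 where n0: "\<And>m n. n0 \<le> m \<Longrightarrow> n0 \<le> n \<Longrightarrow> dist (E (x m) u \<bullet> u) (E (x n) u \<bullet> u) < e\<^sup>2"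
    using e unfolding Cauchy_def by (meson zero_less_power)
  have sq: "(dist (E (x m) u) (E (x n) u))\<^sup>2 = dist (E (x m) u \<bullet> u) (E (x n) u \<bullet> u)" for m n
    using norm_E_diff[of "x m" "x n" u] norm_E_diff[of "x n" "x m" u]
      E_inner_mono[of "x m" "x n" u] E_inner_mono[of "x n" "x m" u]
    by (cases "x m \<le> x n") (auto simp: dist_norm norm_minus_commute dist_real_def)
  show "\<exists>n0. \<forall>m\<ge>n0. \<forall>n\<ge>n0. dist (E (x m) u) (E (x n) u) < e"
    using n0 e unfolding sq[symmetric] by (meson less_imp_le power2_less_imp_less)
qed

text \<open>Let \<open>w\<close> be the limit of \<open>E (x n) u\<close> for \<open>x n\<close>
  decreasing to \<open>t\<close>. It lies in every \<open>N (x m)\<close>, so its part orthogonal to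
  \<open>N t\<close> satisfies the inequality of \<open>N\<close> at \<open>t\<close> in the limit
  and vanishes by strictness.\<close>

lemma E_right_continuous: "continuous (at_right t) (\<lambda>r. E r u)"
proof -
  define x where "x n = t + 1 / real (Suc n)" for n
  have x: "t < x n" for n by (simp add: x_def)
  have xlim: "x \<longlonglongrightarrow> t"
    using tendsto_add[OF tendsto_const[of t] LIMSEQ_Suc[OF lim_1_over_n]] by (simp add: x_def[abs_def])
  have dec: "x m \<le> x n" if "n \<le> m" for m n using that by (simp add: x_def frac_le)
  then have "convergent (\<lambda>n. E (x n) u)" by (intro convergent_E) (auto simp: monoseq_def)
  then obtain w where w: "(\<lambda>n. E (x n) u) \<longlonglongrightarrow> w" by (auto simp: convergent_def)
  have wN: "w \<in> N (x m)" for m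
  proof (rule closed_sequentially[OF closed_N])
    show "(\<lambda>n. E (x (n + m)) u) \<longlonglongrightarrow> w" by (rule LIMSEQ_ignore_initial_segment[OF w])
    show "E (x (n + m)) u \<in> N (x m)" for n by (rule N_mono[OF dec E_mem]) simp
  qed
  define v where "v = w - E t w"
  have orth: "v \<bullet> z = 0" if "z \<in> N t" for z unfolding v_def by (rule E_orth[OF that])
  have vN: "v \<in> N (x m)" for m
    unfolding v_def using x[of m] by (intro subspace_diff subspace_N wN N_mono[OF _ E_mem]) simp
  have "(norm v)\<^sup>2 \<le> t * (T v \<bullet> v)"
    by (rule LIMSEQ_le_const[OF tendsto_mult_right[OF xlim]]) (use N_le[OF vN] in blast)
  then have "v = 0" using N_orth[of t v, OF orth] by (intro N_orth_eq[of t v, OF orth]) auto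
  then have "E t w = w" by (simp add: v_def)
  moreover have "E t w = E t u"
  proof (rule LIMSEQ_unique)
    show "(\<lambda>n. E t (E (x n) u)) \<longlonglongrightarrow> E t w" by (rule bounded_linear.tendsto[OF bounded_linear_E w])
    show "(\<lambda>n. E t (E (x n) u)) \<longlonglongrightarrow> E t u" using x by (simp add: E_E_le less_imp_le)
  qed
  ultimately have lim: "(\<lambda>n. norm (E (x n) u - E t u)) \<longlonglongrightarrow> 0"
    using w by (simp add: LIM_zero tendsto_norm_zero)
  show ?thesis
    unfolding continuous_within tendsto_iff
  proof (intro allI impI)
    fix e :: real assume "0 < e"
    then obtain n where n: "norm (E (x n) u - E t u) < e"
      using lim unfolding LIMSEQ_iff by fastforce
    \<comment> \<open>The distance to \<open>E t u\<close> increases with the parameter, so one term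
      of the sequence controls a whole right neighbourhood.\<close>
    have "dist (E r u) (E t u) < e" if r: "t < r" "r < x n" for r
    proof -
      have "(norm (E r u - E t u))\<^sup>2 \<le> (norm (E (x n) u - E t u))\<^sup>2"
        using r E_inner_mono[of r "x n" u] x[of n] by (simp add: norm_E_diff)
      then have "norm (E r u - E t u) \<le> norm (E (x n) u - E t u)"
        by (rule power2_le_imp_le) simp
      with n show ?thesis by (simp add: dist_norm)
    qed
    then show "\<forall>\<^sub>F r in at_right t. dist (E r u) (E t u) < e"
      unfolding eventually_at_right[OF x[of n]] using x[of n] by blast
  qed
qed

text \<open>The remainder \<open>v\<close> is orthogonal to all \<open>N m\<close>, hence
  \<open>m * (T v \<bullet> v) \<le> (norm v)\<^sup>2\<close> for every \<open>m\<close>. This gives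
  \<open>T v \<bullet> v = 0\<close>, then \<open>T v = 0\<close> by Cauchy-Schwarz, and finally
  \<open>v = 0\<close> by injectivity on \<open>X\<close>.\<close>

lemma E_at_top:
  assumes u: "u \<in> X" shows "((\<lambda>t. E t u) \<longlongrightarrow> u) at_top"
proof -
  have "convergent (\<lambda>n. E (real n) u)" by (intro convergent_E) (auto simp: monoseq_def)
  then obtain w where w: "(\<lambda>n. E (real n) u) \<longlonglongrightarrow> w" by (auto simp: convergent_def)
  define v where "v = u - w"
  have orth: "v \<bullet> z = 0" if z: "z \<in> N (real m)" for z m
  proof -
    have "(\<lambda>n. (u - E (real (n + m)) u) \<bullet> z) \<longlonglongrightarrow> v \<bullet> z"
      unfolding v_def by (intro tendsto_intros LIMSEQ_ignore_initial_segment w)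
    moreover have "(u - E (real (n + m)) u) \<bullet> z = 0" for n
      by (rule E_orth[OF N_mono[OF _ z]]) simp
    ultimately show ?thesis by (simp add: LIMSEQ_const_iff)
  qed
  have "T v \<bullet> v = 0"
  proof (rule ccontr)
    assume "T v \<bullet> v \<noteq> 0"
    then have pos: "0 < T v \<bullet> v" using T_nonneg[of v] by simp
    obtain m where "(norm v)\<^sup>2 < real m * (T v \<bullet> v)"
      using ex_less_of_nat_mult[OF pos] by blast
    then show False using N_orth[OF orth, of m] by simp
  qed
  have "T v = 0"
  proof -
    have "((norm (T v))\<^sup>2)\<^sup>2 \<le> (T (T v) \<bullet> T v) * 0"
    proof (rule discriminant_le)
      fix t
      have "0 \<le> T (v + t *\<^sub>R T v) \<bullet> (v + t *\<^sub>R T v)" by (rule T_nonneg)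
      also have "\<dots> = t\<^sup>2 * (T (T v) \<bullet> T v) + 2 * t * (norm (T v))\<^sup>2 + 0"
        using \<open>T v \<bullet> v = 0\<close> unfolding power2_norm_eq_inner
        by (simp add: linear_add[OF linear_T] linear_scale[OF linear_T] inner_add_left
            inner_add_right T_sym[of "T v" v] power2_eq_square algebra_simps)
      finally show "0 \<le> t\<^sup>2 * (T (T v) \<bullet> T v) + 2 * t * (norm (T v))\<^sup>2 + 0" .
    qed (rule T_nonneg)
    then show ?thesis by simp
  qed
  moreover have "v \<in> X"
    unfolding v_def using w u by (intro subspace_diff X u closed_sequentially[OF X(2) _ w] E_X)
  ultimately have "v = 0" using T_inj by blast
  then have lim: "(\<lambda>n. norm (E (real n) u - u)) \<longlonglongrightarrow> 0"
    using w by (simp add: v_def LIM_zero tendsto_norm_zero)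
  show ?thesis
    unfolding tendsto_iff
  proof (intro allI impI)
    fix e :: real assume "0 < e"
    then obtain n where n: "norm (E (real n) u - u) < e"
      using lim unfolding LIMSEQ_iff by fastforce
    have "dist (E r u) u < e" if r: "real n \<le> r" for r
    proof -
      have *: "(norm (E t u - u))\<^sup>2 = (norm u)\<^sup>2 - E t u \<bullet> u" for t
        using E_inner_self[of t u]
        by (simp add: power2_norm_eq_inner inner_diff_left inner_diff_right inner_commute)
      have "(norm (E r u - u))\<^sup>2 \<le> (norm (E (real n) u - u))\<^sup>2"
        using E_inner_mono[OF r, of u] by (simp add: *)
      then have "norm (E r u - u) \<le> norm (E (real n) u - u)"
        by (rule power2_le_imp_le) simp
      with n show ?thesis by (simp add: dist_norm)
    qed
    then show "\<forall>\<^sub>F r in at_top. dist (E r u) u < e"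
      unfolding eventually_at_top_linorder by blast
  qed
qed

section \<open>Identification of the operator with its spectral integral\<close>

lemma resolution_E: "resolution_of_identity X E"
proof -
  have "((\<lambda>t. E t u) \<longlongrightarrow> 0) at_bot" for u
  proof (rule tendsto_eventually)
    show "\<forall>\<^sub>F t in at_bot. E t u = 0"
      unfolding eventually_at_bot_dense by (intro exI[of _ 1]) (simp add: E_small)
  qed
  then show ?thesis
    unfolding resolution_of_identity_def linear_between_def
    by (auto simp: E_X linear_add[OF linear_E] linear_scale[OF linear_E] E_E_le E_sym
        E_right_continuous E_at_top)
qed

sublocale calc: bounded_below_spectral_family X E
  by standard (use X resolution_E E_small complete_eq_closed in auto)

text \<open>For \<open>w = E b u - E a u\<close>, of squared norm \<open>m\<close>, both
  \<open>T w \<bullet> w\<close> and the integral of \<open>1 / t\<close> over \<open>(a, b]\<close>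
  lie between \<open>m / b\<close> and \<open>m / a\<close>. Their difference is therefore of second
  order and sums to nothing. The maximum with 1/2 keeps the integrand bounded and changes it only
  below the spectrum.\<close>

lemma T_inner_self:
  assumes u: "u \<in> X"
  shows "T u \<bullet> u = (LINT t|calc.mu u. 1 / max t (1/2))"
proof -
  define g where "g t = 1 / max t (1/2)" for t :: real
  have [measurable]: "g \<in> borel_measurable borel" unfolding g_def by measurable
  have g_bounds: "0 \<le> g t" "g t \<le> 2" for t by (auto simp: g_def max_def field_simps)
  then have g: "calc.bounded_borel g" unfolding calc.bounded_borel_def by (auto intro!: exI[of _ 2])
  interpret mu: finite_borel_measure "calc.mu u" by (rule calc.finite_mu[OF u])
  define G where "G t = (LINT r|calc.mu u. indicator {..t} r * g r)" for t
  have int: "integrable (calc.mu u) (\<lambda>r. indicator A r * g r)" if "A \<in> sets borel" for A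
    by (intro calc.integrable_bounded_borel calc.bounded_borel_mult calc.bounded_borel_indicator g that u)
  define f where "f t = T (E t u) \<bullet> u - G t" for t
  define F where "F t = E t u \<bullet> u" for t
  \<comment> \<open>The 4 bounds \<open>1 / (a * b)\<close> for \<open>a\<close> and
    \<open>b\<close> at least 1/2. The base point lies below 1, so that \<open>f\<close> vanishes
    there.\<close>
  have const: "f t = f (1/2)" if "1/2 \<le> t" for t
  proof (rule eq_if_small_increments[of "1/2" f 4 F])
    fix a b :: real assume a: "1/2 \<le> a" and ab: "a \<le> b"
    define w where "w = E b u - E a u"
    define m where "m = F b - F a"
    have m: "m = (norm w)\<^sup>2" "0 \<le> m"
      unfolding w_def m_def F_def using norm_E_diff[OF ab] E_inner_mono[OF ab] by auto
    have TE: "T (E s u) \<bullet> E r u = T (E (min s r) u) \<bullet> u" for s r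
      using E_sym[of r "T (E s u)" u] E_E_le[of s r u] E_E_le[of r s u] E_E[of r s u]
      by (cases "s \<le> r") (simp_all add: min_def flip: T_E)
    have Tw: "T w \<bullet> w = T (E b u) \<bullet> u - T (E a u) \<bullet> u"
      using ab by (simp add: w_def linear_diff[OF linear_T] inner_diff_left inner_diff_right TE min_def)
    have "w \<in> N b"
      unfolding w_def by (intro subspace_diff subspace_N E_mem N_mono[OF ab E_mem])
    then have "m \<le> b * (T w \<bullet> w)" unfolding m by (rule N_le)
    then have T1: "m / b \<le> T w \<bullet> w" using a ab by (simp add: field_simps)
    have "w \<bullet> v = 0" if "v \<in> N a" for v
      using E_inner[OF N_mono[OF ab that]] E_inner[OF that] by (simp add: w_def inner_diff_left)
    then have "a * (T w \<bullet> w) \<le> m" unfolding m by (rule N_orth)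
    then have T2: "T w \<bullet> w \<le> m / a" using a by (simp add: field_simps)
    have ind: "indicator {..b} r * g r = indicator {..a} r * g r + indicator {a<..b} r * g r" for r
      using ab by (auto simp: indicator_def)
    have Gb: "G b = G a + (LINT r|calc.mu u. indicator {a<..b} r * g r)"
      unfolding G_def ind by (intro Bochner_Integration.integral_add int) auto
    have mm: "measure (calc.mu u) {a<..b} = m"
      using mu.finite_measure_Diff[of "{..b}" "{..a}"] ab
      by (simp add: m_def F_def calc.measure_mu_atMost u greaterThanAtMost_def Diff_eq Int_commute)
    have G1: "m / b \<le> G b - G a"
    proof -
      have "m / b = (LINT r|calc.mu u. indicator {a<..b} r * (1 / b))" by (simp add: mm)
      also have "\<dots> \<le> (LINT r|calc.mu u. indicator {a<..b} r * g r)"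
        using a by (intro integral_mono int calc.integrable_bounded_borel calc.bounded_borel_mult
            calc.bounded_borel_indicator calc.bounded_borel_const u)
          (auto simp: indicator_def g_def max_def field_simps)
      finally show ?thesis using Gb by simp
    qed
    have G2: "G b - G a \<le> m / a"
    proof -
      have "(LINT r|calc.mu u. indicator {a<..b} r * g r) \<le> (LINT r|calc.mu u. indicator {a<..b} r * (1 / a))"
        using a by (intro integral_mono int calc.integrable_bounded_borel calc.bounded_borel_mult
            calc.bounded_borel_indicator calc.bounded_borel_const u)
          (auto simp: indicator_def g_def max_def field_simps)
      also have "\<dots> = m / a" by (simp add: mm)
      finally show ?thesis using Gb by simp
    qed
    have "1 / a - 1 / b = (b - a) / (a * b)" using a ab by (simp add: field_simps)
    also have "\<dots> \<le> (b - a) / (1/2 * (1/2))"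
      using a ab by (intro divide_left_mono mult_mono) auto
    finally have "(1 / a - 1 / b) * m \<le> 4 * (b - a) * m"
      using m by (intro mult_right_mono) auto
    then show "\<bar>f b - f a\<bar> \<le> 4 * (b - a) * (F b - F a)"
      using T1 T2 G1 G2 Tw unfolding f_def m_def[symmetric] by (simp add: left_diff_distrib)
  qed (rule that)
  have "G (1/2) = (LINT r|calc.mu u. 0)"
    unfolding G_def by (intro calc.integral_mu_cong u) auto
  then have f0: "f (1/2) = 0"
    by (simp add: f_def E_small linear_0[OF linear_T])
  have "(\<lambda>n. T (E (real (Suc n)) u) \<bullet> u - G (real (Suc n))) \<longlonglongrightarrow> T u \<bullet> u - (LINT r|calc.mu u. g r)"
  proof (intro tendsto_intros)
    show "(\<lambda>n. T (E (real (Suc n)) u)) \<longlonglongrightarrow> T u"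
      by (intro bounded_linear.tendsto[OF bounded_linear_T] LIMSEQ_Suc
          filterlim_compose[OF E_at_top[OF u] filterlim_real_sequentially])
    have "(\<lambda>n. G (real n)) \<longlonglongrightarrow> (LINT r|calc.mu u. g r)"
      unfolding G_def
    proof (rule integral_dominated_convergence)
      show "integrable (calc.mu u) (\<lambda>_. 2)" by simp
      show "AE r in calc.mu u. (\<lambda>n. indicator {..real n} r * g r) \<longlonglongrightarrow> g r"
      proof (rule AE_I2, rule tendsto_eventually, rule eventually_sequentiallyI)
        fix r :: real and n :: nat assume "nat \<lceil>r\<rceil> \<le> n"
        then show "indicator {..real n} r * g r = g r" by (simp add: indicator_def)
      qed
    qed (use g_bounds in \<open>auto simp: indicator_def\<close>)
    then show "(\<lambda>n. G (real (Suc n))) \<longlonglongrightarrow> (LINT r|calc.mu u. g r)" by (rule LIMSEQ_Suc)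
  qed
  moreover have "T (E (real (Suc n)) u) \<bullet> u - G (real (Suc n)) = 0" for n
    using const[of "real (Suc n)"] f0 by (simp add: f_def)
  ultimately show ?thesis by (simp add: LIMSEQ_const_iff g_def)
qed

text \<open>Polarizing \<open>T_inner_self\<close> identifies \<open>T\<close> with the bounded
  integral of \<open>g\<close>; inverting \<open>g\<close> on the spectrum turns this into the
  integral of \<open>t\<close>.\<close>

theorem spectral_theorem: "spectral_integral X E (\<lambda>t. t) = {(T z, z) |z. z \<in> X}"
proof -
  define g where "g t = 1 / max t (1/2)" for t :: real
  have g_nonneg: "0 \<le> g t" for t by (simp add: g_def max_def)
  have g: "calc.bounded_borel g"
    unfolding calc.bounded_borel_def g_def
    by (intro conjI exI[of _ 2]) (measurable, auto simp: max_def field_simps)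
  have "calc.Phi g z = T z" if z: "z \<in> X" for z
  proof (rule calc.eq_if_inner_eq)
    show "T z \<in> X" using P_mem[of "T z"] z by (simp add: P_T P_id)
    fix v assume v: "v \<in> X"
    have "calc.polar g z v = (T (z + v) \<bullet> (z + v) - T (z - v) \<bullet> (z - v)) / 4"
      using z v by (simp add: calc.polar_def T_inner_self calc.add_mem calc.diff_mem g_def)
    also have "\<dots> = T z \<bullet> v"
      using T_sym[of v z]
      by (simp add: linear_add[OF linear_T] linear_diff[OF linear_T] inner_add_left inner_add_right
          inner_diff_left inner_diff_right inner_commute)
    finally show "calc.Phi g z \<bullet> v = T z \<bullet> v" using z v g by (simp add: calc.Phi_inner)
  qed (use z g in \<open>simp add: calc.Phi_mem\<close>)
  moreover have "spectral_integral X E (\<lambda>t. t) = {(calc.Phi g z, z) |z. z \<in> X}"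
    by (rule calc.spectral_integral_inverse[OF _ g g_nonneg]) (auto simp: g_def)
  ultimately show ?thesis by auto
qed

end

section \<open>The Hilbert space of square integrable functions\<close>

text \<open>For completeness of L2 and of the energy there is no dominating function, only a uniform
  bound on the integrals along an a.e. convergent sequence.\<close>

lemma integrable_Fatou:
  fixes f :: "'a \<Rightarrow> real"
  assumes int: "\<And>n. integrable M (F n)" "\<And>n x. 0 \<le> F n x" and le: "\<And>n. integral\<^sup>L M (F n) \<le> c"
    and f: "f \<in> borel_measurable M" and lim: "AE x in M. (\<lambda>n. F n x) \<longlonglongrightarrow> f x"
  shows "integrable M f" "integral\<^sup>L M f \<le> c"
proof -
  have nonneg: "AE x in M. 0 \<le> f x"
    using lim by eventually_elim (rule LIMSEQ_le_const, auto simp: int)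
  have "0 \<le> integral\<^sup>L M (F 0)" by (simp add: int)
  with le[of 0] have c: "0 \<le> c" by linarith
  have "(\<integral>\<^sup>+x. ennreal (f x) \<partial>M) = (\<integral>\<^sup>+x. liminf (\<lambda>n. ennreal (F n x)) \<partial>M)"
  proof (rule nn_integral_cong_AE)
    show "AE x in M. ennreal (f x) = liminf (\<lambda>n. ennreal (F n x))"
      using lim by eventually_elim (metis lim_imp_Liminf sequentially_bot tendsto_ennrealI)
  qed
  also have "\<dots> \<le> liminf (\<lambda>n. \<integral>\<^sup>+x. ennreal (F n x) \<partial>M)"
    using int(1) by (intro nn_integral_liminf) auto
  also have "\<dots> \<le> liminf (\<lambda>n::nat. ennreal c)"
    using int le by (intro Liminf_mono always_eventually allI)
      (auto simp: nn_integral_eq_integral ennreal_leI)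
  also have "\<dots> = ennreal c" by (simp add: Liminf_const)
  finally have le: "(\<integral>\<^sup>+x. ennreal (f x) \<partial>M) \<le> ennreal c" .
  show f_int: "integrable M f"
    using le nonneg by (intro integrableI_nonneg f) (auto simp: order_le_less_trans)
  show "integral\<^sup>L M f \<le> c"
    using le nonneg c by (simp add: nn_integral_eq_integral[OF f_int nonneg])
qed

section \<open>Representatives of L2 classes\<close>

lemma square_integrable_rep: "square_integrable (rep_L2 u)"
  using Quotient_rep_reflp[OF Quotient_L2, of u] by (simp add: L2_rel_def)

lemma measurable_rep_L2 [measurable]: "rep_L2 u \<in> borel_measurable lborel"
  using square_integrable_rep[of u] by (simp add: square_integrable_def)

lemma rep_abs_L2:
  assumes "square_integrable f" shows "AE x in lborel. rep_L2 (abs_L2 f) x = f x"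
proof -
  have "L2_rel f f" using assms by (simp add: L2_rel_def)
  then have "L2_rel (rep_L2 (abs_L2 f)) f" by (rule Quotient3_rep_abs[OF Quotient3_L2])
  then show ?thesis by (simp add: L2_rel_def)
qed

lemma L2_eqI:
  assumes "AE x in lborel. rep_L2 u x = rep_L2 v x" shows "u = v"
proof -
  have "L2_rel (rep_L2 u) (rep_L2 v)" using assms by (simp add: L2_rel_def square_integrable_rep)
  then show ?thesis using Quotient3_rel_rep[OF Quotient3_L2] by blast
qed

lemma rep_add: "AE x in lborel. rep_L2 (u + v) x = rep_L2 u x + rep_L2 v x"
  unfolding plus_L2_def map_fun_def o_def
  by (rule rep_abs_L2[OF square_integrable_add[OF square_integrable_rep square_integrable_rep]])

lemma rep_diff: "AE x in lborel. rep_L2 (u - v) x = rep_L2 u x - rep_L2 v x"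
  unfolding minus_L2_def map_fun_def o_def
  by (rule rep_abs_L2[OF square_integrable_diff[OF square_integrable_rep square_integrable_rep]])

lemma rep_scale: "AE x in lborel. rep_L2 (c *\<^sub>R u) x = c * rep_L2 u x"
  unfolding scaleR_L2_def map_fun_def o_def id_def
  by (rule rep_abs_L2[OF square_integrable_scale[OF square_integrable_rep]])

lemma rep_zero: "AE x in lborel. rep_L2 0 x = 0"
  unfolding zero_L2_def by (rule rep_abs_L2[OF square_integrable_zero])

lemma inner_L2: "u \<bullet> v = (LINT x|lborel. rep_L2 u x * rep_L2 v x)"
  unfolding inner_L2_def map_fun_def o_def id_def ..

lemma norm_L2_square: "(norm u)\<^sup>2 = (LINT x|lborel. (rep_L2 u x)\<^sup>2)"
  by (simp only: power2_norm_eq_inner inner_L2) (simp only: power2_eq_square)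

lemma integrable_rep_square: "integrable lborel (\<lambda>x. (rep_L2 u x)\<^sup>2)"
  using square_integrable_rep[of u] by (simp add: square_integrable_def)

text \<open>The weights turn summability of L2 norms into pointwise convergence: a.e. finiteness of
  the weighted sum of squares makes the terms decay like \<open>sqrt (1/2) ^ k\<close>.\<close>

lemma summable_if_weighted_squares:
  fixes h :: "nat \<Rightarrow> real"
  assumes "summable (\<lambda>k. 2 ^ k * (h k)\<^sup>2)"
  shows "summable h"
proof -
  obtain C where C: "\<And>k. norm (2 ^ k * (h k)\<^sup>2) \<le> C"
    using summable_imp_Bseq[OF assms] unfolding Bseq_def by blast
  show ?thesis
  proof (rule summable_comparison_test')
    show "summable (\<lambda>k. sqrt C * sqrt (1/2) ^ k)"
      by (intro summable_mult summable_geometric) (simp add: real_sqrt_divide)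
    fix k
    have "(h k)\<^sup>2 \<le> C * (1/2) ^ k" using C[of k] by (simp add: power_divide field_simps)
    then have "\<bar>h k\<bar> \<le> sqrt (C * (1/2) ^ k)"
      unfolding real_sqrt_abs[symmetric] by (rule real_sqrt_le_mono)
    then show "norm (h k) \<le> sqrt C * sqrt (1/2) ^ k"
      by (simp add: real_sqrt_mult real_sqrt_power)
  qed
qed

lemma L2_Cauchy_AE_subsequence:
  fixes U :: "nat \<Rightarrow> 'a::euclidean_space L2"
  assumes "Cauchy U"
  shows "\<exists>r. strict_mono r \<and> (AE x in lborel. convergent (\<lambda>n. rep_L2 (U (r n)) x))"
proof -
  have "\<exists>r. strict_mono r \<and> (\<forall>k. norm (U (r (Suc k)) - U (r k)) < (1/2) ^ k)"
  proof -
    have ex: "\<exists>N. \<forall>m\<ge>N. \<forall>n\<ge>N. norm (U m - U n) < (1/2) ^ k" for k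
      using CauchyD[OF assms, of "(1/2) ^ k"] by simp
    obtain N where N: "\<And>k m n. N k \<le> m \<Longrightarrow> N k \<le> n \<Longrightarrow> norm (U m - U n) < (1/2) ^ k"
      using ex by metis
    \<comment> \<open>Partial sums with an added 1 are strictly increasing and dominate each
      \<open>N k\<close>.\<close>
    define r where "r k = (\<Sum>i\<le>k. N i + 1)" for k
    have "strict_mono r" by (rule strict_mono_Suc_iff[THEN iffD2]) (simp add: r_def)
    moreover have "N k \<le> r k" for k
      using member_le_sum[of k "{..k}" "\<lambda>i. N i + 1"] by (simp add: r_def)
    moreover have "r k \<le> r (Suc k)" for k by (simp add: r_def)
    ultimately show ?thesis using N by (meson order_trans)
  qed
  then obtain r where r: "strict_mono r" "\<And>k. norm (U (r (Suc k)) - U (r k)) < (1/2) ^ k"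
    by blast
  define h where "h k = U (r (Suc k)) - U (r k)" for k
  have "(\<integral>\<^sup>+x. (\<Sum>k. ennreal (2 ^ k * (rep_L2 (h k) x)\<^sup>2)) \<partial>lborel) =
      (\<Sum>k. \<integral>\<^sup>+x. ennreal (2 ^ k * (rep_L2 (h k) x)\<^sup>2) \<partial>lborel)"
    by (intro nn_integral_suminf) measurable
  also have "\<dots> = (\<Sum>k. ennreal (2 ^ k * (norm (h k))\<^sup>2))"
  proof (intro arg_cong[where f=suminf] ext)
    fix k
    have "(\<integral>\<^sup>+x. ennreal (2 ^ k * (rep_L2 (h k) x)\<^sup>2) \<partial>lborel) =
        ennreal (LINT x|lborel. 2 ^ k * (rep_L2 (h k) x)\<^sup>2)"
      using integrable_rep_square by (intro nn_integral_eq_integral) auto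
    then show "(\<integral>\<^sup>+x. ennreal (2 ^ k * (rep_L2 (h k) x)\<^sup>2) \<partial>lborel) = ennreal (2 ^ k * (norm (h k))\<^sup>2)"
      by (simp add: norm_L2_square)
  qed
  also have "\<dots> \<le> (\<Sum>k. ennreal ((1/2) ^ k))"
  proof (rule suminf_le)
    fix k
    have "(norm (h k))\<^sup>2 \<le> ((1/2) ^ k)\<^sup>2"
      using r(2)[of k] by (intro power_mono) (auto simp: h_def)
    then have "2 ^ k * (norm (h k))\<^sup>2 \<le> 2 ^ k * ((1/2) ^ k)\<^sup>2" by (rule mult_left_mono) simp
    also have "\<dots> = (1/2) ^ k" by (simp add: power_divide field_simps power2_eq_square)
    finally show "ennreal (2 ^ k * (norm (h k))\<^sup>2) \<le> ennreal ((1/2) ^ k)" by (rule ennreal_leI)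
  qed auto
  also have "\<dots> < \<infinity>"
    by (subst suminf_ennreal2) (auto intro!: summable_geometric)
  finally have "AE x in lborel. (\<Sum>k. ennreal (2 ^ k * (rep_L2 (h k) x)\<^sup>2)) \<noteq> \<infinity>"
    by (intro nn_integral_PInf_AE borel_measurable_suminf_order) auto
  moreover have "AE x in lborel. \<forall>k. rep_L2 (h k) x = rep_L2 (U (r (Suc k))) x - rep_L2 (U (r k)) x"
    unfolding h_def by (subst AE_all_countable) (intro allI rep_diff)
  ultimately have "AE x in lborel. convergent (\<lambda>n. rep_L2 (U (r n)) x)"
  proof eventually_elim
    case (elim x)
    have "summable (\<lambda>k. 2 ^ k * (rep_L2 (h k) x)\<^sup>2)"
      by (rule summable_suminf_not_top) (use elim(1) in auto)
    then have "summable (\<lambda>k. rep_L2 (h k) x)" by (rule summable_if_weighted_squares)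
    then have "convergent (\<lambda>n. rep_L2 (U (r 0)) x + (\<Sum>k<n. rep_L2 (h k) x))"
      by (intro convergent_add convergent_const) (simp add: summable_iff_convergent)
    moreover have "rep_L2 (U (r 0)) x + (\<Sum>k<n. rep_L2 (h k) x) = rep_L2 (U (r n)) x" for n
      using sum_lessThan_telescope[of "\<lambda>k. rep_L2 (U (r k)) x" n] elim(2) by simp
    ultimately show ?case by simp
  qed
  with r(1) show ?thesis by blast
qed

text \<open>The a.e. convergent subsequence stays in the conclusion because the Gagliardo density
  depends on pointwise values, where Fatou's lemma is applied again.\<close>

theorem L2_Cauchy:
  fixes U :: "nat \<Rightarrow> 'a::euclidean_space L2"
  assumes "Cauchy U"
  shows "\<exists>u r. U \<longlonglongrightarrow> u \<and> strict_mono r \<and> (AE x in lborel. (\<lambda>n. rep_L2 (U (r n)) x) \<longlonglongrightarrow> rep_L2 u x)"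
proof -
  obtain r where r: "strict_mono r" and conv: "AE x in lborel. convergent (\<lambda>n. rep_L2 (U (r n)) x)"
    using L2_Cauchy_AE_subsequence[OF assms] by blast
  define f where "f x = lim (\<lambda>n. rep_L2 (U (r n)) x)" for x
  have [measurable]: "f \<in> borel_measurable lborel"
    unfolding f_def by (rule borel_measurable_lim_metric) measurable
  have lim: "AE x in lborel. (\<lambda>n. rep_L2 (U (r n)) x) \<longlonglongrightarrow> f x"
    using conv by eventually_elim (simp add: f_def convergent_LIMSEQ_iff)
  have near: "integrable lborel (\<lambda>x. (f x - rep_L2 (U m) x)\<^sup>2) \<and>
      (LINT x|lborel. (f x - rep_L2 (U m) x)\<^sup>2) \<le> e\<^sup>2"
    if N: "\<And>m n. N \<le> m \<Longrightarrow> N \<le> n \<Longrightarrow> norm (U m - U n) < e" and m: "N \<le> m" for N e m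
  proof -
    have AE: "AE x in lborel. (rep_L2 (U (r (n + N)) - U m) x)\<^sup>2 = (rep_L2 (U (r (n + N))) x - rep_L2 (U m) x)\<^sup>2" for n
      using rep_diff[of "U (r (n + N))" "U m"] by eventually_elim simp
    have sq: "square_integrable (\<lambda>x. rep_L2 (U (r (n + N))) x - rep_L2 (U m) x)" for n
      by (intro square_integrable_diff square_integrable_rep)
    have le: "(LINT x|lborel. (rep_L2 (U (r (n + N))) x - rep_L2 (U m) x)\<^sup>2) \<le> e\<^sup>2" for n
    proof -
      have "N \<le> r (n + N)" using seq_suble[OF r, of "n + N"] by simp
      then have "(norm (U (r (n + N)) - U m))\<^sup>2 \<le> e\<^sup>2"
        using N[OF _ m, of "r (n + N)"] by (intro power_mono) auto
      moreover have "(norm (U (r (n + N)) - U m))\<^sup>2 =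
          (LINT x|lborel. (rep_L2 (U (r (n + N))) x - rep_L2 (U m) x)\<^sup>2)"
        unfolding norm_L2_square by (rule integral_cong_AE[OF _ _ AE]) measurable
      ultimately show ?thesis by simp
    qed
    have limsq: "AE x in lborel. (\<lambda>n. (rep_L2 (U (r (n + N))) x - rep_L2 (U m) x)\<^sup>2) \<longlonglongrightarrow> (f x - rep_L2 (U m) x)\<^sup>2"
      using lim by eventually_elim (intro tendsto_intros LIMSEQ_ignore_initial_segment)
    show ?thesis
      using integrable_Fatou[OF _ _ le _ limsq] sq by (auto simp: square_integrable_def)
  qed
  obtain N1 where N1: "\<And>m n. N1 \<le> m \<Longrightarrow> N1 \<le> n \<Longrightarrow> norm (U m - U n) < 1"
    using CauchyD[OF assms, of 1] by auto
  have "square_integrable (\<lambda>x. f x - rep_L2 (U N1) x)"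
    using near[OF N1, of N1] by (simp add: square_integrable_def)
  from square_integrable_add[OF this square_integrable_rep[of "U N1"]]
  have sq: "square_integrable f" by simp
  define u where "u = abs_L2 f"
  have u: "AE x in lborel. rep_L2 u x = f x" unfolding u_def by (rule rep_abs_L2[OF sq])
  have "U \<longlonglongrightarrow> u"
  proof (rule LIMSEQ_I)
    fix e :: real assume e: "0 < e"
    obtain N where N: "\<And>m n. N \<le> m \<Longrightarrow> N \<le> n \<Longrightarrow> norm (U m - U n) < e / 2"
      using CauchyD[OF assms, of "e / 2"] e by auto
    have *: "norm (U m - u) < e" if "N \<le> m" for m
    proof -
      have "AE x in lborel. (rep_L2 (U m - u) x)\<^sup>2 = (f x - rep_L2 (U m) x)\<^sup>2"
        using rep_diff[of "U m" u] u by eventually_elim (simp add: power2_commute[of "f _"])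
      then have "(norm (U m - u))\<^sup>2 = (LINT x|lborel. (f x - rep_L2 (U m) x)\<^sup>2)"
        unfolding norm_L2_square by (intro integral_cong_AE) auto
      also have "\<dots> \<le> (e / 2)\<^sup>2" by (rule near[OF N that, THEN conjunct2])
      finally have "norm (U m - u) \<le> e / 2" by (rule power2_le_imp_le) (use e in simp)
      with e show ?thesis by simp
    qed
    show "\<exists>N. \<forall>n\<ge>N. norm (U n - u) < e"
      by (intro exI[of _ N] allI impI *)
  qed
  moreover have "AE x in lborel. (\<lambda>n. rep_L2 (U (r n)) x) \<longlonglongrightarrow> rep_L2 u x"
    using lim u by eventually_elim simp
  ultimately show ?thesis using r by blast
qed

instance L2 :: (euclidean_space) complete_space
  by standard (use L2_Cauchy in \<open>auto simp: convergent_def\<close>)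

subsection \<open>Restriction to a set\<close>

text \<open>The orthogonal projection onto \<open>L2_on \<Omega>\<close>, which plays the role of
  \<open>P\<close> in the abstract theory.\<close>

definition restrict_L2 :: "'a::euclidean_space set \<Rightarrow> 'a L2 \<Rightarrow> 'a L2" where
  "restrict_L2 \<Omega> u = abs_L2 (\<lambda>x. indicator \<Omega> x * rep_L2 u x)"

context
  fixes \<Omega> :: "'a::euclidean_space set"
  assumes \<Omega> [measurable]: "\<Omega> \<in> sets borel"
begin

lemma square_integrable_indicator:
  assumes "square_integrable f" shows "square_integrable (\<lambda>x. indicator \<Omega> x * f x)"
proof -
  have "integrable lborel (\<lambda>x. indicator \<Omega> x *\<^sub>R (f x)\<^sup>2)"
    using assms by (intro integrable_mult_indicator) (auto simp: square_integrable_def)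
  moreover have "(\<lambda>x. indicator \<Omega> x *\<^sub>R (f x)\<^sup>2) = (\<lambda>x. (indicator \<Omega> x * f x)\<^sup>2)"
    by (auto simp: indicator_def)
  moreover have [measurable]: "f \<in> borel_measurable borel"
    using assms by (simp add: square_integrable_def)
  ultimately show ?thesis by (simp add: square_integrable_def)
qed

lemma rep_restrict: "AE x in lborel. rep_L2 (restrict_L2 \<Omega> u) x = indicator \<Omega> x * rep_L2 u x"
  unfolding restrict_L2_def
  by (intro rep_abs_L2 square_integrable_indicator square_integrable_rep)

lemma restrict_L2_mem: "restrict_L2 \<Omega> u \<in> L2_on \<Omega>"
  unfolding L2_on_def mem_Collect_eq using rep_restrict[of u] by eventually_elim simp

lemma restrict_L2_id: "u \<in> L2_on \<Omega> \<Longrightarrow> restrict_L2 \<Omega> u = u"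
proof (rule L2_eqI)
  assume "u \<in> L2_on \<Omega>"
  then have "AE x in lborel. x \<notin> \<Omega> \<longrightarrow> rep_L2 u x = 0" by (simp add: L2_on_def)
  then show "AE x in lborel. rep_L2 (restrict_L2 \<Omega> u) x = rep_L2 u x"
    using rep_restrict[of u] by eventually_elim (auto simp: indicator_def)
qed

lemma restrict_L2_sym: "restrict_L2 \<Omega> u \<bullet> v = u \<bullet> restrict_L2 \<Omega> v"
  unfolding inner_L2
proof (rule integral_cong_AE)
  show "AE x in lborel. rep_L2 (restrict_L2 \<Omega> u) x * rep_L2 v x = rep_L2 u x * rep_L2 (restrict_L2 \<Omega> v) x"
    using rep_restrict[of u] rep_restrict[of v] by eventually_elim simp
qed measurable

lemma bounded_linear_restrict: "bounded_linear (restrict_L2 \<Omega>)"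
proof (rule bounded_linear_intro[of _ 1])
  show "restrict_L2 \<Omega> (u + v) = restrict_L2 \<Omega> u + restrict_L2 \<Omega> v" for u v
  proof (rule L2_eqI)
    show "AE x in lborel. rep_L2 (restrict_L2 \<Omega> (u + v)) x = rep_L2 (restrict_L2 \<Omega> u + restrict_L2 \<Omega> v) x"
      using rep_restrict[of u] rep_restrict[of v] rep_restrict[of "u + v"] rep_add[of u v]
        rep_add[of "restrict_L2 \<Omega> u" "restrict_L2 \<Omega> v"]
      by eventually_elim (simp add: distrib_left)
  qed
  show "restrict_L2 \<Omega> (c *\<^sub>R u) = c *\<^sub>R restrict_L2 \<Omega> u" for c u
  proof (rule L2_eqI)
    show "AE x in lborel. rep_L2 (restrict_L2 \<Omega> (c *\<^sub>R u)) x = rep_L2 (c *\<^sub>R restrict_L2 \<Omega> u) x"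
      using rep_restrict[of u] rep_restrict[of "c *\<^sub>R u"] rep_scale[of c u] rep_scale[of c "restrict_L2 \<Omega> u"]
      by eventually_elim simp
  qed
  show "norm (restrict_L2 \<Omega> u) \<le> norm u * 1" for u
  proof -
    have "(norm (restrict_L2 \<Omega> u))\<^sup>2 = u \<bullet> restrict_L2 \<Omega> u"
      by (simp add: power2_norm_eq_inner restrict_L2_sym restrict_L2_id[OF restrict_L2_mem])
    also have "\<dots> \<le> norm u * norm (restrict_L2 \<Omega> u)"
      using Cauchy_Schwarz_ineq2[of u "restrict_L2 \<Omega> u"] by simp
    finally show ?thesis
      by (cases "restrict_L2 \<Omega> u = 0") (auto simp: power2_eq_square)
  qed
qed

lemma L2_on_eq: "L2_on \<Omega> = {u. restrict_L2 \<Omega> u = u}"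
  by (auto simp: restrict_L2_id) (metis restrict_L2_mem)

lemma closed_L2_on: "closed (L2_on \<Omega>)"
  unfolding L2_on_eq
  by (intro closed_Collect_eq linear_continuous_on bounded_linear_restrict continuous_on_id)

lemma subspace_L2_on: "subspace (L2_on \<Omega>)"
  unfolding L2_on_eq using bounded_linear.linear[OF bounded_linear_restrict]
  by (auto simp: subspace_def linear_0 linear_add linear_scale)

end

section \<open>The energy space\<close>

abbreviation lborel2 :: "('a::euclidean_space \<times> 'a) measure" where
  "lborel2 \<equiv> lborel \<Otimes>\<^sub>M lborel"

section \<open>The Gagliardo density\<close>

lemma AE_lborel2:
  fixes P :: "'a::euclidean_space \<Rightarrow> bool"
  assumes "AE x in lborel. P x"
  shows "AE p in lborel2. P (fst p) \<and> P (snd p)"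
proof -
  obtain N where N: "N \<in> null_sets lborel" "{x. \<not> P x} \<subseteq> N"
    using assms by (auto simp: eventually_ae_filter)
  have [measurable]: "N \<in> sets borel" using N(1) by auto
  have ae: "AE x in lborel. x \<notin> N" using N(1) by (rule AE_not_in)
  have "AE p in lborel2. fst p \<notin> N \<and> snd p \<notin> N"
  proof (rule lborel_pair.AE_pair_measure)
    show "AE x in lborel. AE y in lborel. fst (x, y) \<notin> N \<and> snd (x, y) \<notin> N"
      using ae by eventually_elim (use ae in auto)
  qed measurable
  then show ?thesis by eventually_elim (use N(2) in auto)
qed

lemma measurable_gagliardo_density [measurable]:
  fixes u v :: "'a::euclidean_space L2"
  shows "gagliardo_density s u v \<in> borel_measurable lborel2"
proof -
  have [measurable]: "rep_L2 w \<in> borel_measurable (borel :: 'a measure)" for w :: "'a L2"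
    using measurable_rep_L2[of w] by simp
  show ?thesis unfolding gagliardo_density_def by measurable
qed

lemma gagliardo_density_nonneg: "0 \<le> gagliardo_density s u u p"
  by (auto simp: gagliardo_density_def split: prod.split)

lemma gagliardo_density_commute: "gagliardo_density s u v = gagliardo_density s v u"
  by (auto simp: gagliardo_density_def mult.commute)

lemma gagliardo_density_add:
  "AE p in lborel2. gagliardo_density s (u + v) w p = gagliardo_density s u w p + gagliardo_density s v w p"
  using AE_lborel2[OF rep_add[of u v]]
  by eventually_elim (auto simp: gagliardo_density_def distrib_right add_divide_distrib left_diff_distrib diff_divide_distrib)

lemma gagliardo_density_scale:
  "AE p in lborel2. gagliardo_density s (c *\<^sub>R u) w p = c * gagliardo_density s u w p"
  using AE_lborel2[OF rep_scale[of c u]]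
  by eventually_elim (auto simp: gagliardo_density_def algebra_simps)

lemma integrable_gagliardo:
  assumes "u \<in> fractional_sobolev s" "v \<in> fractional_sobolev s"
  shows "integrable lborel2 (gagliardo_density s u v)"
proof (rule Bochner_Integration.integrable_bound)
  show "integrable lborel2 (\<lambda>p. gagliardo_density s u u p + gagliardo_density s v v p)"
    using assms by (auto simp: fractional_sobolev_def)
  have "\<bar>a * b\<bar> \<le> a * a + b * b" for a b :: real
    using sum_squares_bound[of "\<bar>a\<bar>" "\<bar>b\<bar>"] mult_nonneg_nonneg[of "\<bar>a\<bar>" "\<bar>b\<bar>"]
    unfolding abs_mult power2_eq_square mult.assoc abs_mult_self_eq by (simp del: mult_nonneg_nonneg)
  then have "\<bar>a * b / c\<bar> \<le> a * a / c + b * b / c" if "0 \<le> c" for a b c :: real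
    using divide_right_mono[OF _ that, of "\<bar>a * b\<bar>"] that by (simp add: abs_divide flip: add_divide_distrib)
  then have "norm (gagliardo_density s u v p) \<le> gagliardo_density s u u p + gagliardo_density s v v p" for p
    by (auto simp: gagliardo_density_def split: prod.split)
  then show "AE p in lborel2. norm (gagliardo_density s u v p) \<le>
      norm (gagliardo_density s u u p + gagliardo_density s v v p)"
    by (simp add: gagliardo_density_nonneg)
qed measurable

lemma subspace_fractional_sobolev: "subspace (fractional_sobolev s :: 'a::euclidean_space L2 set)"
proof (rule subspaceI)
  have "AE p in lborel2. gagliardo_density s (0 :: 'a L2) 0 p = 0"
    using AE_lborel2[OF rep_zero] by eventually_elim (auto simp: gagliardo_density_def)
  then have "integrable lborel2 (gagliardo_density s (0 :: 'a L2) 0) \<longleftrightarrow> integrable lborel2 (\<lambda>_ :: 'a \<times> 'a. 0 :: real)"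
    by (intro integrable_cong_AE) auto
  then show "(0 :: 'a L2) \<in> fractional_sobolev s" by (simp add: fractional_sobolev_def)
next
  fix u v :: "'a L2" assume u: "u \<in> fractional_sobolev s" and v: "v \<in> fractional_sobolev s"
  have "AE p in lborel2. gagliardo_density s (u + v) (u + v) p =
      gagliardo_density s u u p + 2 * gagliardo_density s u v p + gagliardo_density s v v p"
    using AE_lborel2[OF rep_add[of u v]]
    by eventually_elim (auto simp: gagliardo_density_def algebra_simps add_divide_distrib diff_divide_distrib)
  then have "integrable lborel2 (gagliardo_density s (u + v) (u + v)) \<longleftrightarrow>
      integrable lborel2 (\<lambda>p. gagliardo_density s u u p + 2 * gagliardo_density s u v p + gagliardo_density s v v p)"
    by (intro integrable_cong_AE) auto
  then show "u + v \<in> fractional_sobolev s"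
    using integrable_gagliardo[OF u v] u v by (simp add: fractional_sobolev_def)
next
  fix c and u :: "'a L2" assume u: "u \<in> fractional_sobolev s"
  have "AE p in lborel2. gagliardo_density s (c *\<^sub>R u) (c *\<^sub>R u) p = c\<^sup>2 * gagliardo_density s u u p"
    using AE_lborel2[OF rep_scale[of c u]]
    by eventually_elim (auto simp: gagliardo_density_def power2_eq_square algebra_simps)
  then have "integrable lborel2 (gagliardo_density s (c *\<^sub>R u) (c *\<^sub>R u)) \<longleftrightarrow>
      integrable lborel2 (\<lambda>p. c\<^sup>2 * gagliardo_density s u u p)"
    by (intro integrable_cong_AE) auto
  then show "c *\<^sub>R u \<in> fractional_sobolev s"
    using u by (simp add: fractional_sobolev_def)
qed

lemma H0_eq: "H0 s \<Omega> = fractional_sobolev s \<inter> L2_on \<Omega>"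
  by (auto simp: H0_def L2_on_def)

lemma fractional_laplacian_const_pos: "0 < s \<Longrightarrow> s < 1 \<Longrightarrow> 0 < fractional_laplacian_const N s"
  unfolding fractional_laplacian_const_def by (auto intro!: divide_pos_pos mult_pos_pos Gamma_real_pos)

context
  fixes \<Omega> :: "'a::euclidean_space set" and s :: real
  assumes \<Omega> [measurable]: "\<Omega> \<in> sets borel" and s: "0 < s" "s < 1"
begin

section \<open>The Sobolev form and its completeness\<close>

lemma seminorm_weight_pos: "0 < fractional_laplacian_const DIM('a) s / 2"
  using fractional_laplacian_const_pos[OF s] by simp

lemma sobolev_form_eq:
  assumes "u \<in> H0 s \<Omega>"
  shows "sobolev_form s \<Omega> u v = u \<bullet> v + (fractional_laplacian_const DIM('a) s / 2) * (LINT p|lborel2. gagliardo_density s u v p)"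
proof -
  have "AE x in lborel. x \<notin> \<Omega> \<longrightarrow> rep_L2 u x = 0" using assms by (simp add: H0_def)
  then have "AE x in lborel. indicator \<Omega> x *\<^sub>R (rep_L2 u x * rep_L2 v x) = rep_L2 u x * rep_L2 v x"
    by eventually_elim (auto simp: indicator_def)
  then have "(LINT x:\<Omega>|lborel. rep_L2 u x * rep_L2 v x) = u \<bullet> v"
    unfolding inner_L2 set_lebesgue_integral_def by (intro integral_cong_AE) measurable
  then show ?thesis by (simp add: sobolev_form_def)
qed

lemma gagliardo_integral_nonneg: "0 \<le> (LINT p|lborel2. gagliardo_density s u u p)"
  by (simp add: gagliardo_density_nonneg)

lemma norm_le_sobolev_form: "u \<in> H0 s \<Omega> \<Longrightarrow> (norm u)\<^sup>2 \<le> sobolev_form s \<Omega> u u"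
  using mult_nonneg_nonneg[OF less_imp_le[OF seminorm_weight_pos] gagliardo_integral_nonneg[of u]]
  by (simp add: sobolev_form_eq power2_norm_eq_inner)

lemma subspace_H0: "subspace (H0 s \<Omega>)"
  unfolding H0_eq by (intro subspace_inter subspace_fractional_sobolev subspace_L2_on \<Omega>)

text \<open>The form dominates the L2 norm, so an L2 limit \<open>u\<close> exists. Letting
  \<open>n\<close> tend to infinity in the energy of \<open>x n - x m\<close> along the a.e.
  convergent subsequence, Fatou's lemma bounds the energy of \<open>u - x m\<close>, which also puts
  \<open>u\<close> into the space.\<close>

lemma sobolev_form_complete:
  fixes x :: "nat \<Rightarrow> 'a L2"
  assumes x: "\<And>n. x n \<in> H0 s \<Omega>"
    and C: "\<And>e. 0 < e \<Longrightarrow> \<exists>N. \<forall>m\<ge>N. \<forall>n\<ge>N. sobolev_form s \<Omega> (x m - x n) (x m - x n) < e"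
  shows "\<exists>u\<in>H0 s \<Omega>. (\<lambda>n. sobolev_form s \<Omega> (x n - u) (x n - u)) \<longlonglongrightarrow> 0"
proof -
  have diff: "x m - x n \<in> H0 s \<Omega>" for m n by (intro subspace_diff subspace_H0 x)
  have "Cauchy x"
  proof (rule metric_CauchyI)
    fix e :: real assume e: "0 < e"
    then obtain N where N: "\<And>m n. N \<le> m \<Longrightarrow> N \<le> n \<Longrightarrow> sobolev_form s \<Omega> (x m - x n) (x m - x n) < e\<^sup>2"
      using C[of "e\<^sup>2"] by auto
    have "dist (x m) (x n) < e" if "N \<le> m" "N \<le> n" for m n
    proof -
      have "(dist (x m) (x n))\<^sup>2 < e\<^sup>2"
        using N[OF that] norm_le_sobolev_form[OF diff, of m n] by (simp add: dist_norm)
      then show ?thesis using e by (simp add: power2_less_imp_less)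
    qed
    then show "\<exists>N. \<forall>m\<ge>N. \<forall>n\<ge>N. dist (x m) (x n) < e" by blast
  qed
  then obtain u r where u: "x \<longlonglongrightarrow> u" and r: "strict_mono r"
    and lim: "AE t in lborel. (\<lambda>n. rep_L2 (x (r n)) t) \<longlonglongrightarrow> rep_L2 u t"
    using L2_Cauchy by blast
  have uX: "u \<in> L2_on \<Omega>"
    by (rule closed_sequentially[OF closed_L2_on[OF \<Omega>] _ u]) (use x in \<open>auto simp: H0_eq\<close>)
  have near: "u - x m \<in> fractional_sobolev s \<and>
      (LINT p|lborel2. gagliardo_density s (u - x m) (u - x m) p) \<le> e / (fractional_laplacian_const DIM('a) s / 2)"
    if N: "\<And>m n. N \<le> m \<Longrightarrow> N \<le> n \<Longrightarrow> sobolev_form s \<Omega> (x m - x n) (x m - x n) < e" and m: "N \<le> m"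
    for N e m
  proof -
    define F where "F n = gagliardo_density s (x (r (n + N)) - x m) (x (r (n + N)) - x m)" for n
    have le: "(LINT p|lborel2. F n p) \<le> e / (fractional_laplacian_const DIM('a) s / 2)" for n
    proof -
      have "N \<le> r (n + N)" using seq_suble[OF r, of "n + N"] by simp
      then have "sobolev_form s \<Omega> (x (r (n + N)) - x m) (x (r (n + N)) - x m) < e"
        using N m by blast
      then have "(fractional_laplacian_const DIM('a) s / 2) * (LINT p|lborel2. F n p) \<le> e"
        unfolding sobolev_form_eq[OF diff] F_def using inner_ge_zero[of "x (r (n + N)) - x m"] by linarith
      then show ?thesis using seminorm_weight_pos by (simp add: field_simps)
    qed
    have rep: "AE t in lborel. \<forall>n. rep_L2 (x (r (n + N)) - x m) t = rep_L2 (x (r (n + N))) t - rep_L2 (x m) t"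
      by (subst AE_all_countable) (intro allI rep_diff)
    have conv: "AE t in lborel. (\<lambda>n. rep_L2 (x (r (n + N)) - x m) t) \<longlonglongrightarrow> rep_L2 (u - x m) t"
      using lim rep rep_diff[of u "x m"]
      by eventually_elim (auto intro!: tendsto_intros LIMSEQ_ignore_initial_segment)
    have "AE p in lborel2. (\<lambda>n. F n p) \<longlonglongrightarrow> gagliardo_density s (u - x m) (u - x m) p"
      using AE_lborel2[OF conv] unfolding F_def gagliardo_density_def
      by eventually_elim (auto simp: divide_inverse intro!: tendsto_intros)
    from integrable_Fatou[OF _ _ le _ this] diff[of "r (_ + N)" m]
    show ?thesis
      by (auto simp: F_def gagliardo_density_nonneg fractional_sobolev_def H0_eq)
  qed
  obtain N1 where N1: "\<And>m n. N1 \<le> m \<Longrightarrow> N1 \<le> n \<Longrightarrow> sobolev_form s \<Omega> (x m - x n) (x m - x n) < 1"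
    using C[of 1] by auto
  have "u - x N1 + x N1 \<in> fractional_sobolev s"
    using near[OF N1 order_refl] x[of N1] by (intro subspace_add subspace_fractional_sobolev) (auto simp: H0_eq)
  with uX have uH: "u \<in> H0 s \<Omega>" by (simp add: H0_eq)
  have sq_lim: "(\<lambda>n. (norm (u - x n))\<^sup>2) \<longlonglongrightarrow> 0"
    using tendsto_power[OF tendsto_norm[OF tendsto_diff[OF tendsto_const[of u] u]], of 2] by simp
  have "(\<lambda>n. sobolev_form s \<Omega> (u - x n) (u - x n)) \<longlonglongrightarrow> 0"
  proof (rule LIMSEQ_I)
    fix e :: real assume e: "0 < e"
    obtain N where N: "\<And>m n. N \<le> m \<Longrightarrow> N \<le> n \<Longrightarrow> sobolev_form s \<Omega> (x m - x n) (x m - x n) < e / 2"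
      using C[of "e / 2"] e by auto
    obtain N' where N': "\<And>n. N' \<le> n \<Longrightarrow> (norm (u - x n))\<^sup>2 < e / 2"
      using LIMSEQ_D[OF sq_lim, of "e / 2"] e by auto
    have "norm (sobolev_form s \<Omega> (u - x n) (u - x n) - 0) < e" if n: "max N N' \<le> n" for n
    proof -
      have mem: "u - x n \<in> H0 s \<Omega>" by (intro subspace_diff subspace_H0 uH x)
      have "(fractional_laplacian_const DIM('a) s / 2) * (LINT p|lborel2. gagliardo_density s (u - x n) (u - x n) p) \<le> e / 2"
        using near[OF N, of n] n seminorm_weight_pos by (simp add: field_simps)
      moreover have "0 \<le> sobolev_form s \<Omega> (u - x n) (u - x n)"
        using norm_le_sobolev_form[OF mem] zero_le_power2 order_trans by blast
      ultimately show ?thesis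
        using N'[of n] n by (simp add: sobolev_form_eq[OF mem] power2_norm_eq_inner)
    qed
    then show "\<exists>N. \<forall>n\<ge>N. norm (sobolev_form s \<Omega> (u - x n) (u - x n) - 0) < e" by blast
  qed
  moreover have "sobolev_form s \<Omega> (u - x n) (u - x n) = sobolev_form s \<Omega> (x n - u) (x n - u)" for n
  proof -
    have mem: "u - x n \<in> H0 s \<Omega>" "x n - u \<in> H0 s \<Omega>" by (intro subspace_diff subspace_H0 uH x)+
    have "AE p in lborel2. gagliardo_density s (u - x n) (u - x n) p = gagliardo_density s (x n - u) (x n - u) p"
      using AE_lborel2[OF rep_diff[of u "x n"]] AE_lborel2[OF rep_diff[of "x n" u]]
      by eventually_elim (clarsimp simp: gagliardo_density_def, simp add: algebra_simps)
    then have "(LINT p|lborel2. gagliardo_density s (u - x n) (u - x n) p) =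
        (LINT p|lborel2. gagliardo_density s (x n - u) (x n - u) p)"
      by (intro integral_cong_AE) auto
    then show ?thesis
      by (simp add: sobolev_form_eq mem inner_diff_left inner_diff_right)
  qed
  ultimately show ?thesis using uH by auto
qed

lemma complete_form_sobolev: "complete_form (H0 s \<Omega>) (sobolev_form s \<Omega>)"
proof (rule complete_form.intro)
  note mem = subspace_add[OF subspace_H0] subspace_mul[OF subspace_H0]
  fix u v w :: "'a L2" and c
  { assume H: "u \<in> H0 s \<Omega>" "v \<in> H0 s \<Omega>" "w \<in> H0 s \<Omega>"
    then have int: "integrable lborel2 (gagliardo_density s u w)" "integrable lborel2 (gagliardo_density s v w)"
      by (auto intro: integrable_gagliardo simp: H0_eq)
    have "(LINT p|lborel2. gagliardo_density s (u + v) w p) =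
        (LINT p|lborel2. gagliardo_density s u w p + gagliardo_density s v w p)"
      by (intro integral_cong_AE gagliardo_density_add) auto
    then show "sobolev_form s \<Omega> (u + v) w = sobolev_form s \<Omega> u w + sobolev_form s \<Omega> v w"
      using H int by (simp add: sobolev_form_eq mem inner_add_left distrib_left) }
  { assume H: "u \<in> H0 s \<Omega>" "w \<in> H0 s \<Omega>"
    have "(LINT p|lborel2. gagliardo_density s (c *\<^sub>R u) w p) = (LINT p|lborel2. c * gagliardo_density s u w p)"
      by (intro integral_cong_AE gagliardo_density_scale) auto
    then show "sobolev_form s \<Omega> (c *\<^sub>R u) w = c * sobolev_form s \<Omega> u w"
      using H by (simp add: sobolev_form_eq mem distrib_left) }
  show "sobolev_form s \<Omega> u v = sobolev_form s \<Omega> v u"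
    by (simp add: sobolev_form_def gagliardo_density_commute[of s u v] mult.commute)
  show "0 \<le> sobolev_form s \<Omega> u u" if "u \<in> H0 s \<Omega>"
    using norm_le_sobolev_form[OF that] zero_le_power2 order_trans by blast
qed (rule subspace_H0, rule sobolev_form_complete)

end

section \<open>Density of the energy space\<close>

text \<open>The truncated kernel is summed over the dyadic shells \<open>2\<^sup>i \<le> norm h < 2\<^sup>i\<^sup>+\<^sup>1\<close>,
  separately for \<open>i = j\<close> and \<open>i = - j - 1\<close> with \<open>j \<ge> 0\<close>.\<close>

definition truncated_kernel :: "real \<Rightarrow> 'a::euclidean_space \<Rightarrow> real" where
  "truncated_kernel s h = min ((norm h)\<^sup>2) 1 / norm h powr (real DIM('a) + 2 * s)"

lemma measurable_truncated_kernel [measurable]: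
  "truncated_kernel s \<in> borel_measurable borel"
  unfolding truncated_kernel_def by measurable

lemma truncated_kernel_nonneg: "0 \<le> truncated_kernel s h"
  by (simp add: truncated_kernel_def)

lemma emeasure_cball_powr:
  "emeasure lborel (cball (0 :: 'a::euclidean_space) (2 powr y)) =
    ennreal (unit_ball_vol DIM('a) * 2 powr (y * DIM('a)))"
  by (simp add: emeasure_cball powr_powr[symmetric] powr_realpow)

lemma suminf_geometric_finite:
  fixes C a :: real
  assumes "0 \<le> C" "0 < a"
  shows "(\<Sum>j. ennreal (C * 2 powr (- a * real j))) < \<infinity>"
proof -
  have "2 powr (- a * real j) = (2 powr (- a)) ^ j" for j
    by (simp only: powr_powr[symmetric]) (simp add: powr_realpow)
  moreover have "2 powr (- a) < (1 :: real)" using assms powr_less_mono[of "- a" 0 2] by simp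
  ultimately have "summable (\<lambda>j. C * 2 powr (- a * real j))"
    by (simp add: summable_geometric summable_mult)
  then show ?thesis using assms by (subst suminf_ennreal2) auto
qed

lemma nn_integral_truncated_kernel:
  assumes s: "0 < s" "s < 1"
  shows "(\<integral>\<^sup>+h. ennreal (truncated_kernel s (h :: 'a::euclidean_space)) \<partial>lborel) < \<infinity>"
proof -
  define N where "N = real DIM('a)"
  define p where "p = N + 2 * s"
  have p: "0 < p" using s by (simp add: p_def N_def add_nonneg_pos)
  define V where "V = unit_ball_vol N"
  have V: "0 \<le> V" by (simp add: V_def N_def)
  \<comment> \<open>\<open>c j\<close> bounds the kernel for \<open>norm h\<close> at least
    \<open>2 ^ j\<close>, and \<open>d j\<close> bounds it for \<open>norm h\<close> between
    \<open>2 powr (- real j - 1)\<close> and \<open>2 powr (- real j)\<close>. Each shell is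
    enlarged to a ball, \<open>B j\<close> or \<open>D j\<close>.\<close>
  define c d where "c j = 2 powr (- real j * p)" and "d j = 2 powr (- 2 * real j + (real j + 1) * p)" for j :: nat
  define B D where "B j = cball (0 :: 'a) (2 powr (real j + 1))" and "D j = cball (0 :: 'a) (2 powr (- real j))" for j :: nat
  have [measurable]: "B j \<in> sets borel" "D j \<in> sets borel" for j by (auto simp: B_def D_def)
  have bound: "ennreal (truncated_kernel s h) \<le>
      (\<Sum>j. ennreal (c j) * indicator (B j) h) + (\<Sum>j. ennreal (d j) * indicator (D j) h)" for h :: 'a
  proof (cases "h = 0")
    case True
    then show ?thesis by (simp add: truncated_kernel_def)
  next
    case False
    define x where "x = log 2 (norm h)"
    have h: "norm h = 2 powr x" using False by (simp add: x_def)
    have term_le: "f j \<le> (\<Sum>j. f j)" for f :: "nat \<Rightarrow> ennreal" and j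
      using sum_le_suminf[of f "{j}"] by simp
    show ?thesis
    proof (cases "0 \<le> x")
      case True
      define j where "j = nat \<lfloor>x\<rfloor>"
      have j: "real j \<le> x" "x \<le> real j + 1" using True by (auto simp: j_def)
      have "truncated_kernel s h \<le> 1 / norm h powr p"
        unfolding truncated_kernel_def p_def N_def by (intro divide_right_mono) auto
      also have "\<dots> = 2 powr (- (x * p))" by (simp add: h powr_powr powr_minus divide_inverse)
      also have "\<dots> \<le> c j" unfolding c_def using j p by (intro powr_mono) (auto intro: mult_right_mono)
      finally have "ennreal (truncated_kernel s h) \<le> ennreal (c j) * indicator (B j) h"
        using j by (simp add: B_def h ennreal_leI powr_mono)
      also have "\<dots> \<le> (\<Sum>j. ennreal (c j) * indicator (B j) h)"
        by (rule term_le[of "\<lambda>j. ennreal (c j) * indicator (B j) h"])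
      finally show ?thesis by (simp add: add_increasing2)
    next
      case False
      define j where "j = nat (- \<lfloor>x\<rfloor> - 1)"
      have rj: "real j = - real_of_int \<lfloor>x\<rfloor> - 1" using False by (simp add: j_def)
      have j: "- real j - 1 \<le> x" "x \<le> - real j"
        using of_int_floor_le[of x] real_of_int_floor_add_one_ge[of x] unfolding rj by linarith+
      have "truncated_kernel s h \<le> (norm h)\<^sup>2 / norm h powr p"
        unfolding truncated_kernel_def p_def N_def by (intro divide_right_mono) auto
      also have "(norm h)\<^sup>2 = 2 powr (2 * x)"
        unfolding h power2_eq_square powr_add[symmetric] by simp
      also have "2 powr (2 * x) / norm h powr p = 2 powr (2 * x - x * p)"
        by (simp add: h powr_powr powr_diff)
      also have "\<dots> \<le> d j"
      proof -
        have "(- x) * p \<le> (real j + 1) * p" using j p by (intro mult_right_mono) auto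
        then show ?thesis unfolding d_def using j by (intro powr_mono) auto
      qed
      finally have "ennreal (truncated_kernel s h) \<le> ennreal (d j) * indicator (D j) h"
        using j by (simp add: D_def h ennreal_leI powr_mono)
      also have "\<dots> \<le> (\<Sum>j. ennreal (d j) * indicator (D j) h)"
        by (rule term_le[of "\<lambda>j. ennreal (d j) * indicator (D j) h"])
      finally show ?thesis by (simp add: add_increasing)
    qed
  qed
  \<comment> \<open>The volume grows like \<open>2 powr (real j * N)\<close>, leaving decay at rate
    \<open>2 * s\<close>: integrability at infinity is where \<open>0 < s\<close> enters.\<close>
  have intB: "(\<integral>\<^sup>+h. ennreal (c j) * indicator (B j) h \<partial>lborel) = ennreal ((V * 2 powr N) * 2 powr (- (2 * s) * real j))" for j
  proof -
    have "(\<integral>\<^sup>+h. ennreal (c j) * indicator (B j) h \<partial>lborel) = ennreal (c j) * ennreal (V * 2 powr ((real j + 1) * N))"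
      by (simp add: nn_integral_cmult_indicator B_def emeasure_cball_powr V_def N_def)
    also have "\<dots> = ennreal (V * (c j * 2 powr ((real j + 1) * N)))"
      using V by (subst ennreal_mult[symmetric]) (simp_all add: c_def mult.left_commute)
    also have "c j * 2 powr ((real j + 1) * N) = 2 powr N * 2 powr (- (2 * s) * real j)"
    proof -
      have "- real j * p + (real j + 1) * N = N + - (2 * s) * real j"
        by (simp add: p_def algebra_simps)
      then show ?thesis unfolding c_def powr_add[symmetric] by (rule arg_cong)
    qed
    finally show ?thesis by (simp add: mult.assoc)
  qed
  \<comment> \<open>The numerator \<open>(norm h)\<^sup>2\<close> leaves decay at rate
    \<open>2 - 2 * s\<close>: integrability at 0 is where \<open>s < 1\<close> enters.\<close>
  have intD: "(\<integral>\<^sup>+h. ennreal (d j) * indicator (D j) h \<partial>lborel) = ennreal ((V * 2 powr p) * 2 powr (- (2 - 2 * s) * real j))" for j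
  proof -
    have "(\<integral>\<^sup>+h. ennreal (d j) * indicator (D j) h \<partial>lborel) = ennreal (d j) * ennreal (V * 2 powr (- real j * N))"
      by (simp add: nn_integral_cmult_indicator D_def emeasure_cball_powr[of "- real j"] V_def N_def)
    also have "\<dots> = ennreal (V * (d j * 2 powr (- real j * N)))"
      using V by (subst ennreal_mult[symmetric]) (simp_all add: d_def mult.left_commute)
    also have "d j * 2 powr (- real j * N) = 2 powr p * 2 powr (- (2 - 2 * s) * real j)"
    proof -
      have "- 2 * real j + (real j + 1) * p + - real j * N = p + - (2 - 2 * s) * real j"
        by (simp add: p_def algebra_simps)
      then show ?thesis unfolding d_def powr_add[symmetric] by (rule arg_cong)
    qed
    finally show ?thesis by (simp add: mult.assoc)
  qed
  have finB: "(\<integral>\<^sup>+h. (\<Sum>j. ennreal (c j) * indicator (B j) h) \<partial>lborel) < \<infinity>"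
  proof -
    have "(\<integral>\<^sup>+h. (\<Sum>j. ennreal (c j) * indicator (B j) h) \<partial>lborel) =
        (\<Sum>j. \<integral>\<^sup>+h. ennreal (c j) * indicator (B j) h \<partial>lborel)"
      by (rule nn_integral_suminf) measurable
    also have "\<dots> < \<infinity>"
      unfolding intB by (rule suminf_geometric_finite) (use s V in auto)
    finally show ?thesis .
  qed
  have finD: "(\<integral>\<^sup>+h. (\<Sum>j. ennreal (d j) * indicator (D j) h) \<partial>lborel) < \<infinity>"
  proof -
    have "(\<integral>\<^sup>+h. (\<Sum>j. ennreal (d j) * indicator (D j) h) \<partial>lborel) =
        (\<Sum>j. \<integral>\<^sup>+h. ennreal (d j) * indicator (D j) h \<partial>lborel)"
      by (rule nn_integral_suminf) measurable
    also have "\<dots> < \<infinity>"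
      unfolding intD by (rule suminf_geometric_finite) (use s V in auto)
    finally show ?thesis .
  qed
  have "(\<integral>\<^sup>+h. ennreal (truncated_kernel s (h :: 'a)) \<partial>lborel) \<le>
      (\<integral>\<^sup>+h. (\<Sum>j. ennreal (c j) * indicator (B j) h) + (\<Sum>j. ennreal (d j) * indicator (D j) h) \<partial>lborel)"
    by (rule nn_integral_mono) (rule bound)
  also have "\<dots> = (\<integral>\<^sup>+h. (\<Sum>j. ennreal (c j) * indicator (B j) h) \<partial>lborel) +
      (\<integral>\<^sup>+h. (\<Sum>j. ennreal (d j) * indicator (D j) h) \<partial>lborel)"
    by (rule nn_integral_add) measurable
  also have "\<dots> < \<infinity>" using finB finD by simp
  finally show ?thesis .
qed

section \<open>Bumps of finite energy and density\<close>

lemma truncated_kernel_commute: "truncated_kernel s (x - y) = truncated_kernel s (y - x)"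
  by (simp add: truncated_kernel_def norm_minus_commute)

lemma nn_integral_truncated_kernel_shift:
  fixes x :: "'a::euclidean_space"
  shows "(\<integral>\<^sup>+y. ennreal (truncated_kernel s (x - y)) \<partial>lborel) = (\<integral>\<^sup>+h. ennreal (truncated_kernel s (h :: 'a)) \<partial>lborel)"
proof -
  have "(\<integral>\<^sup>+h. ennreal (truncated_kernel s (h :: 'a)) \<partial>lborel) =
      (\<integral>\<^sup>+h. ennreal (truncated_kernel s h) \<partial>distr lborel borel ((+) (- x)))"
    by (simp only: lborel_distr_plus)
  also have "\<dots> = (\<integral>\<^sup>+y. ennreal (truncated_kernel s (- x + y)) \<partial>lborel)"
    by (intro nn_integral_distr) measurable
  finally show ?thesis by (simp add: truncated_kernel_commute[of s x])
qed

text \<open>The squared difference is at most a constant times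
  \<open>min ((norm (x - y))\<^sup>2) 1\<close>, and it vanishes unless \<open>x\<close> or
  \<open>y\<close> lies in the ball \<open>S\<close>. In each of the two cases Tonelli's theorem
  leaves the volume of \<open>S\<close> times the integral of the truncated kernel.\<close>

lemma Lipschitz_bump_in_H0:
  fixes \<phi> :: "'a::euclidean_space \<Rightarrow> real"
  assumes s: "0 < s" "s < 1"
    and lip: "\<And>x y. \<bar>\<phi> x - \<phi> y\<bar> \<le> L * norm (x - y)"
    and range: "\<And>x. 0 \<le> \<phi> x" "\<And>x. \<phi> x \<le> 1"
    and supp: "\<And>x. x \<notin> \<Omega> \<Longrightarrow> \<phi> x = 0" and \<Omega>: "bounded \<Omega>"
  shows "square_integrable \<phi>" "abs_L2 \<phi> \<in> H0 s \<Omega>"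
proof -
  have "L-lipschitz_on UNIV \<phi>" if "0 \<le> L"
    using lip that by (intro lipschitz_onI) (auto simp: dist_norm)
  moreover have "0 \<le> L"
  proof (rule ccontr)
    assume "\<not> 0 \<le> L"
    moreover obtain b :: 'a where "b \<in> Basis" using nonempty_Basis by blast
    ultimately show False using lip[of b 0] by (simp add: abs_le_iff)
  qed
  ultimately have "continuous_on UNIV \<phi>" by (intro lipschitz_on_continuous_on)
  then have \<phi>_meas [measurable]: "\<phi> \<in> borel_measurable borel"
    by (rule borel_measurable_continuous_onI)
  obtain R where "\<And>x. x \<in> \<Omega> \<Longrightarrow> norm x \<le> R" using \<Omega> by (auto simp: bounded_iff)
  then have R: "\<Omega> \<subseteq> cball 0 R" by auto
  define S where "S = cball (0 :: 'a) R"
  have [measurable]: "S \<in> sets borel" by (simp add: S_def)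
  have S_fin: "emeasure lborel S < \<infinity>" unfolding S_def by (rule emeasure_bounded_finite) simp
  have out: "\<phi> x = 0" if "x \<notin> S" for x
    using supp[of x] subsetD[OF R, of x] that by (auto simp: S_def)
  show sq: "square_integrable \<phi>"
    unfolding square_integrable_def
  proof
    show "integrable lborel (\<lambda>x. (\<phi> x)\<^sup>2)"
    proof (rule Bochner_Integration.integrable_bound)
      show "integrable lborel (indicator S :: 'a \<Rightarrow> real)" using S_fin by simp
      have "norm ((\<phi> x)\<^sup>2) \<le> norm (indicator S x :: real)" for x
        using range[of x] out[of x] by (cases "x \<in> S") (auto simp: power_le_one)
      then show "AE x in lborel. norm ((\<phi> x)\<^sup>2) \<le> norm (indicator S x :: real)" by simp
    qed simp
  qed simp
  define u where "u = abs_L2 \<phi>"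
  have u: "AE x in lborel. rep_L2 u x = \<phi> x" unfolding u_def by (rule rep_abs_L2[OF sq])
  define C where "C = max (L\<^sup>2) 1"
  have pointwise: "(\<phi> x - \<phi> y)\<^sup>2 \<le> C * min ((norm (x - y))\<^sup>2) 1" for x y
  proof -
    have "(\<phi> x - \<phi> y)\<^sup>2 \<le> (L * norm (x - y))\<^sup>2"
      using power_mono[OF lip[of x y] abs_ge_zero, of 2] by simp
    also have "\<dots> \<le> C * (norm (x - y))\<^sup>2"
      unfolding C_def power_mult_distrib by (intro mult_right_mono) auto
    finally have 1: "(\<phi> x - \<phi> y)\<^sup>2 \<le> C * (norm (x - y))\<^sup>2" .
    have "\<bar>\<phi> x - \<phi> y\<bar> \<le> 1" using range[of x] range[of y] by linarith
    then have "(\<phi> x - \<phi> y)\<^sup>2 \<le> 1" by (simp add: abs_square_le_1)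
    also have "\<dots> \<le> C" by (simp add: C_def)
    finally show ?thesis using 1 by (simp add: min_def)
  qed
  let ?K = "\<lambda>x y. ennreal (truncated_kernel s (x - y :: 'a))"
  have dens: "ennreal (gagliardo_density s u u p) \<le>
      ennreal C * (indicator S (fst p) * ?K (fst p) (snd p)) + ennreal C * (indicator S (snd p) * ?K (fst p) (snd p))"
    if rep: "rep_L2 u (fst p) = \<phi> (fst p) \<and> rep_L2 u (snd p) = \<phi> (snd p)" for p
  proof -
    obtain x y where p: "p = (x, y)" by (cases p)
    have eq: "gagliardo_density s u u p = (\<phi> x - \<phi> y)\<^sup>2 / norm (x - y) powr (real DIM('a) + 2 * s)"
      using rep by (simp add: p gagliardo_density_def power2_eq_square)
    also have "\<dots> \<le> C * truncated_kernel s (x - y)"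
      unfolding truncated_kernel_def times_divide_eq_right by (intro divide_right_mono pointwise) simp
    finally have "ennreal (gagliardo_density s u u p) \<le> ennreal C * ?K x y"
      by (subst ennreal_mult[symmetric]) (auto simp: C_def truncated_kernel_nonneg intro: ennreal_leI)
    moreover have "gagliardo_density s u u p = 0" if "x \<notin> S" "y \<notin> S"
      unfolding eq using that by (simp add: out)
    ultimately show ?thesis
      by (cases "x \<in> S"; cases "y \<in> S") (auto simp: p add_increasing)
  qed
  have I1: "(\<integral>\<^sup>+p. indicator S (fst p) * ?K (fst p) (snd p) \<partial>lborel2) < \<infinity>"
  proof -
    have "(\<integral>\<^sup>+p. indicator S (fst p) * ?K (fst p) (snd p) \<partial>lborel2) =
        (\<integral>\<^sup>+x. \<integral>\<^sup>+y. indicator S x * ?K x y \<partial>lborel \<partial>lborel)"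
      by (subst lborel.nn_integral_fst[symmetric]) (auto intro: borel_measurable_times)
    also have "\<dots> = (\<integral>\<^sup>+x. (\<integral>\<^sup>+h. ?K h 0 \<partial>lborel) * indicator S x \<partial>lborel)"
      by (simp add: nn_integral_cmult nn_integral_truncated_kernel_shift mult.commute)
    also have "\<dots> = (\<integral>\<^sup>+h. ?K h 0 \<partial>lborel) * emeasure lborel S"
      by (rule nn_integral_cmult_indicator) simp
    also have "\<dots> < \<infinity>"
      using nn_integral_truncated_kernel[OF s, where 'a='a] S_fin by (simp add: ennreal_mult_less_top)
    finally show ?thesis .
  qed
  have I2: "(\<integral>\<^sup>+p. indicator S (snd p) * ?K (fst p) (snd p) \<partial>lborel2) < \<infinity>"
  proof -
    have "(\<integral>\<^sup>+p. indicator S (snd p) * ?K (fst p) (snd p) \<partial>lborel2) =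
        (\<integral>\<^sup>+y. \<integral>\<^sup>+x. indicator S y * ?K x y \<partial>lborel \<partial>lborel)"
      by (subst lborel_pair.nn_integral_snd[symmetric]) (auto intro: borel_measurable_times)
    also have "\<dots> = (\<integral>\<^sup>+y. (\<integral>\<^sup>+h. ?K h 0 \<partial>lborel) * indicator S y \<partial>lborel)"
      by (subst truncated_kernel_commute)
        (simp add: nn_integral_cmult nn_integral_truncated_kernel_shift mult.commute)
    also have "\<dots> = (\<integral>\<^sup>+h. ?K h 0 \<partial>lborel) * emeasure lborel S"
      by (rule nn_integral_cmult_indicator) simp
    also have "\<dots> < \<infinity>"
      using nn_integral_truncated_kernel[OF s, where 'a='a] S_fin by (simp add: ennreal_mult_less_top)
    finally show ?thesis .
  qed
  have "(\<integral>\<^sup>+p. ennreal (gagliardo_density s u u p) \<partial>lborel2) \<le>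
      (\<integral>\<^sup>+p. ennreal C * (indicator S (fst p) * ?K (fst p) (snd p)) +
        ennreal C * (indicator S (snd p) * ?K (fst p) (snd p)) \<partial>lborel2)"
    by (intro nn_integral_mono_AE) (use AE_lborel2[OF u] in eventually_elim, rule dens)
  also have "\<dots> = ennreal C * (\<integral>\<^sup>+p. indicator S (fst p) * ?K (fst p) (snd p) \<partial>lborel2) +
      ennreal C * (\<integral>\<^sup>+p. indicator S (snd p) * ?K (fst p) (snd p) \<partial>lborel2)"
    by (subst nn_integral_add) (auto simp: nn_integral_cmult intro: borel_measurable_times)
  also have "\<dots> < \<infinity>" using I1 I2 by (simp add: ennreal_mult_less_top)
  finally have "integrable lborel2 (gagliardo_density s u u)"
    by (intro integrableI_nonneg) (auto simp: gagliardo_density_nonneg)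
  moreover have "u \<in> L2_on \<Omega>"
    unfolding L2_on_def mem_Collect_eq using u by eventually_elim (simp add: supp)
  ultimately show "abs_L2 \<phi> \<in> H0 s \<Omega>" by (simp add: H0_eq fractional_sobolev_def flip: u_def)
qed

text \<open>For open \<open>U\<close> the bumps \<open>min 1 (n * infdist x (- W))\<close> increase
  to the indicator of \<open>W = U \<inter> \<Omega>\<close>. Hence \<open>f\<close> has integral 0
  over all open sets, and by a Dynkin argument over all Borel sets; boundedness of
  \<open>\<Omega>\<close> makes \<open>f\<close> integrable.\<close>

theorem H0_dense:
  fixes \<Omega> :: "'a::euclidean_space set"
  assumes s: "0 < s" "s < 1" and \<Omega>: "open \<Omega>" "bounded \<Omega>"
    and f: "f \<in> L2_on \<Omega>" and orth: "\<And>v. v \<in> H0 s \<Omega> \<Longrightarrow> f \<bullet> v = 0"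
  shows "f = 0"
proof -
  have [measurable]: "\<Omega> \<in> sets borel" using \<Omega> by simp
  have fin: "emeasure lborel \<Omega> < \<infinity>" by (rule emeasure_bounded_finite[OF \<Omega>(2)])
  define g where "g x = indicator \<Omega> x * rep_L2 f x" for x
  have fg: "AE x in lborel. rep_L2 f x = g x"
    using f unfolding L2_on_def mem_Collect_eq by eventually_elim (auto simp: g_def indicator_def)
  have "square_integrable (indicator \<Omega> :: 'a \<Rightarrow> real)"
  proof -
    have "(\<lambda>x. (indicator \<Omega> x :: real)\<^sup>2) = indicator \<Omega>" by (auto simp: indicator_def)
    then show ?thesis using fin by (simp add: square_integrable_def)
  qed
  from square_integrable_mult[OF this square_integrable_rep[of f]]
  have g: "integrable lborel g" by (simp add: g_def[abs_def])
  have [measurable]: "g \<in> borel_measurable borel" using g by simp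
  have opens: "(LINT x:U|lborel. g x) = 0" if U: "open U" for U
  proof -
    define W where "W = U \<inter> \<Omega>"
    have W: "open W" "bounded W" using U \<Omega> by (auto simp: W_def)
    then have [measurable]: "W \<in> sets borel" by simp
    \<comment> \<open>Since \<open>infdist x {}\<close> is 0, the bumps would vanish identically if
      \<open>- W\<close> were empty; boundedness of \<open>W\<close> excludes this.\<close>
    from W have ne: "closed (- W)" "- W \<noteq> {}" by (auto simp: closed_open) (metis Compl_UNIV_eq double_complement not_bounded_UNIV)
    define \<phi> where "\<phi> n x = min 1 (real n * infdist x (- W))" for n x
    have \<phi>: "0 \<le> \<phi> n x" "\<phi> n x \<le> 1" for n x by (auto simp: \<phi>_def infdist_nonneg)
    have \<phi>0: "\<phi> n x = 0" if "x \<notin> W" for n x using that by (simp add: \<phi>_def)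
    have lip: "\<bar>\<phi> n x - \<phi> n y\<bar> \<le> real n * norm (x - y)" for n x y
    proof -
      have "\<bar>\<phi> n x - \<phi> n y\<bar> \<le> \<bar>real n * infdist x (- W) - real n * infdist y (- W)\<bar>"
        unfolding \<phi>_def by linarith
      also have "\<dots> = real n * \<bar>infdist x (- W) - infdist y (- W)\<bar>"
        by (simp add: abs_mult flip: right_diff_distrib)
      also have "\<dots> \<le> real n * dist x y" by (intro mult_left_mono infdist_triangle_abs) simp
      finally show ?thesis by (simp add: dist_norm)
    qed
    have [measurable]: "\<phi> n \<in> borel_measurable borel" for n
      unfolding \<phi>_def by (intro borel_measurable_continuous_onI continuous_intros)
    have zero: "(LINT x|lborel. \<phi> n x * g x) = 0" for n
    proof -
      have sq: "square_integrable (\<phi> n)" and H: "abs_L2 (\<phi> n) \<in> H0 s \<Omega>"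
        using Lipschitz_bump_in_H0[OF s lip \<phi> _ \<Omega>(2)] \<phi>0 by (auto simp: W_def)
      have "(LINT x|lborel. \<phi> n x * g x) = f \<bullet> abs_L2 (\<phi> n)"
        unfolding inner_L2
      proof (rule integral_cong_AE)
        show "AE x in lborel. \<phi> n x * g x = rep_L2 f x * rep_L2 (abs_L2 (\<phi> n)) x"
          using rep_abs_L2[OF sq] fg by eventually_elim simp
      qed measurable
      then show ?thesis using orth[OF H] by simp
    qed
    have "(\<lambda>n. LINT x|lborel. \<phi> n x * g x) \<longlonglongrightarrow> (LINT x|lborel. indicator W x * g x)"
    proof (rule integral_dominated_convergence)
      show "integrable lborel (\<lambda>x. \<bar>g x\<bar>)" using g by simp
      show "AE x in lborel. norm (\<phi> n x * g x) \<le> \<bar>g x\<bar>" for n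
        using \<phi> by (auto simp: abs_mult mult_left_le_one_le)
      show "AE x in lborel. (\<lambda>n. \<phi> n x * g x) \<longlonglongrightarrow> indicator W x * g x"
      proof (rule AE_I2, intro tendsto_mult tendsto_const)
        fix x
        show "(\<lambda>n. \<phi> n x) \<longlonglongrightarrow> indicator W x"
        proof (cases "x \<in> W")
          case True
          then have pos: "0 < infdist x (- W)" using ne by (intro infdist_pos_not_in_closed) auto
          obtain m where m: "1 < real m * infdist x (- W)" using ex_less_of_nat_mult[OF pos] by blast
          show ?thesis
          proof (rule tendsto_eventually, rule eventually_sequentiallyI)
            fix n assume "m \<le> n"
            then have "real m * infdist x (- W) \<le> real n * infdist x (- W)"
              by (intro mult_right_mono) (auto simp: infdist_nonneg)
            with m True show "\<phi> n x = indicator W x" by (simp add: \<phi>_def)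
          qed
        qed (simp add: \<phi>0)
      qed
    qed measurable
    then have "(LINT x|lborel. indicator W x * g x) = 0" by (simp add: zero LIMSEQ_const_iff)
    moreover have "indicator W x * g x = indicator U x *\<^sub>R g x" for x
      by (auto simp: W_def g_def indicator_def)
    ultimately show ?thesis by (simp add: set_lebesgue_integral_def)
  qed
  have "(LINT x:A|lborel. g x) = 0" if A: "A \<in> sets lborel" for A
  proof -
    have int: "set_integrable lborel B g" if "B \<in> sets borel" for B
      using g that unfolding set_integrable_def by (intro integrable_mult_indicator) auto
    have "Int_stable {U :: 'a set. open U}" by (auto simp: Int_stable_def)
    moreover have "{U :: 'a set. open U} \<subseteq> Pow UNIV" by auto
    moreover have "A \<in> sigma_sets UNIV {U. open U}" using A by (simp add: borel_def)
    ultimately show ?thesis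
    proof (induction rule: sigma_sets_induct_disjoint)
      case (compl B)
      then have B: "B \<in> sets borel" by (simp add: borel_def)
      have "(LINT x:UNIV|lborel. g x) = (LINT x:B \<union> (UNIV - B)|lborel. g x)" by (simp add: Un_Diff_cancel)
      also have "\<dots> = (LINT x:B|lborel. g x) + (LINT x:UNIV - B|lborel. g x)"
        using B by (intro set_integral_Un int) auto
      finally show ?case using compl opens[of UNIV] by simp
    next
      case (union B)
      then have B: "range B \<subseteq> sets borel" by (simp add: borel_def)
      have "(LINT x:(\<Union>n. B n)|lborel. g x) = (\<Sum>n. LINT x:B n|lborel. g x)"
        using B union(1) int[of "\<Union>n. B n"] by (intro lebesgue_integral_countable_add)
          (auto simp: disjoint_family_on_def)
      then show ?case using union(3) by simp
    qed (auto intro: opens)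
  qed
  then have "AE x in lborel. g x = 0" by (rule sigma_finite_measure.density_zero[OF sigma_finite_lborel g])
  with fg rep_zero have "AE x in lborel. rep_L2 f x = rep_L2 0 x"
    by eventually_elim simp
  then show ?thesis by (rule L2_eqI)
qed

section \<open>The square root of the operator of a coercive form\<close>

locale coercive_form = form: complete_form V a
  for V :: "'h::{real_inner, complete_space} set" and a :: "'h \<Rightarrow> 'h \<Rightarrow> real" +
  fixes X :: "'h set" and P :: "'h \<Rightarrow> 'h"
  assumes X: "subspace X" "closed X"
    and P: "bounded_linear P" and P_sym: "\<And>x y. P x \<bullet> y = x \<bullet> P y"
    and P_mem: "\<And>x. P x \<in> X" and P_id: "\<And>x. x \<in> X \<Longrightarrow> P x = x"
    and V_X: "V \<subseteq> X"
    and coercive: "\<And>v. v \<in> V \<Longrightarrow> (norm v)\<^sup>2 \<le> a v v"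
    and dense: "\<And>f. f \<in> X \<Longrightarrow> (\<And>v. v \<in> V \<Longrightarrow> f \<bullet> v = 0) \<Longrightarrow> f = 0"
begin

section \<open>The inverse and the chosen resolution of the identity\<close>

definition T :: "'h \<Rightarrow> 'h" where "T f = (SOME u. u \<in> V \<and> (\<forall>v\<in>V. a u v = f \<bullet> v))"

lemma T_mem: "T f \<in> V" and T_form: "v \<in> V \<Longrightarrow> a (T f) v = f \<bullet> v"
proof -
  have "\<exists>u\<in>V. \<forall>v\<in>V. a u v = f \<bullet> v"
  proof (rule form.riesz[of _ "norm f"])
    fix v assume v: "v \<in> V"
    have "norm v \<le> sqrt (a v v)" using coercive[OF v] by (rule real_le_rsqrt)
    then have "norm f * norm v \<le> norm f * sqrt (a v v)" by (rule mult_left_mono) simp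
    then show "\<bar>f \<bullet> v\<bar> \<le> norm f * sqrt (a v v)"
      using Cauchy_Schwarz_ineq2[of f v] by linarith
  qed (auto simp: inner_add_right)
  then have "\<exists>u. u \<in> V \<and> (\<forall>v\<in>V. a u v = f \<bullet> v)" by blast
  from someI_ex[OF this] show "T f \<in> V" "v \<in> V \<Longrightarrow> a (T f) v = f \<bullet> v"
    unfolding T_def by blast+
qed

lemma form_zeroD:
  assumes "u \<in> V" "a u u = 0" shows "u = 0"
  using coercive[OF assms(1)] assms(2) by simp

lemma T_eqI:
  assumes "u \<in> V" "\<And>v. v \<in> V \<Longrightarrow> a u v = f \<bullet> v"
  shows "T f = u"
proof -
  have mem: "T f - u \<in> V" by (intro form.diff_mem T_mem assms)
  have "a (T f - u) (T f - u) = 0"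
    unfolding form.diff_left[OF T_mem assms(1) mem] using assms(2)[OF mem] T_form[OF mem] by simp
  then show ?thesis using form_zeroD[OF mem] by simp
qed

lemma T_sym: "T x \<bullet> y = x \<bullet> T y"
proof -
  have "T x \<bullet> y = a (T y) (T x)" by (simp add: T_form[OF T_mem] inner_commute)
  also have "\<dots> = x \<bullet> T y" by (simp add: form.sym[OF T_mem T_mem] T_form[OF T_mem])
  finally show ?thesis .
qed

sublocale inverse: spectral_inverse T P X
proof (rule spectral_inverse.intro)
  show "linear T"
    by (intro linearI T_eqI form.add_mem form.scale_mem T_mem)
      (simp_all add: form.add_left form.scale_left T_mem T_form inner_add_left)
  show norm: "norm (T x) \<le> norm x" for x
  proof -
    have "(norm (T x))\<^sup>2 \<le> norm x * norm (T x)"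
      using coercive[OF T_mem, of x] Cauchy_Schwarz_ineq2[of x "T x"] by (simp add: T_form[OF T_mem])
    then show ?thesis by (cases "T x = 0") (auto simp: power2_eq_square)
  qed
  show "0 \<le> T x \<bullet> x" for x
    using form.nonneg[OF T_mem, of x] by (simp add: T_form[OF T_mem] inner_commute)
  show "P (T x) = T (P x)" for x
  proof -
    have "T (P x) = T x"
      by (rule T_eqI) (use V_X in \<open>auto simp: T_mem T_form P_sym P_id\<close>)
    then show ?thesis using T_mem[of x] V_X by (auto simp: P_id)
  qed
  show "x = 0" if "x \<in> X" "T x = 0" for x
  proof (rule dense[OF that(1)])
    show "x \<bullet> v = 0" if "v \<in> V" for v
      using T_form[OF that, of x] \<open>T x = 0\<close> form.scale_left[OF form.zero_mem that, of 0] by simp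
  qed
qed (fact T_sym X P P_sym P_mem P_id)+

abbreviation "G \<equiv> form_operator X V a"

lemma G_eq: "G = {(T z, z) |z. z \<in> X}"
  unfolding form_operator_def by (auto simp: T_mem T_form T_eqI)

text \<open>The same choice as inside \<open>op_power\<close>, so that the powers unfold to
  integrals over this \<open>E\<close>. The constructed family \<open>inverse.E\<close> only
  witnesses that the choice is possible.\<close>

definition E :: "real \<Rightarrow> 'h \<Rightarrow> 'h" where
  "E = (SOME E. resolution_of_identity X E \<and> G = spectral_integral X E (\<lambda>t. t))"

lemma E: "resolution_of_identity X E" "G = spectral_integral X E (\<lambda>t. t)"
proof -
  have "\<exists>E. resolution_of_identity X E \<and> G = spectral_integral X E (\<lambda>t. t)"
    by (rule exI[of _ inverse.E]) (simp add: inverse.resolution_E inverse.spectral_theorem G_eq)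
  from someI_ex[OF this]
  show "resolution_of_identity X E" "G = spectral_integral X E (\<lambda>t. t)"
    unfolding E_def by blast+
qed

sublocale calc: bounded_below_spectral_family X E
proof -
  interpret spectral_family X E
    using X E by (intro spectral_family.intro) (auto simp: complete_eq_closed)
  \<comment> \<open>A pair of the integral of \<open>t\<close> is a pair of \<open>G\<close>, so
    coercivity of \<open>a\<close> becomes a bound on this arbitrary \<open>E\<close>.\<close>
  have "(norm v)\<^sup>2 \<le> w \<bullet> v" if "(v, w) \<in> spectral_integral X E (\<lambda>t. t)" for v w
  proof -
    have "v \<in> V" "a v v = w \<bullet> v"
      using that unfolding E(2)[symmetric] form_operator_def by auto
    then show ?thesis using coercive[of v] by simp
  qed
  then show "bounded_below_spectral_family X E"
    by unfold_locales (rule E_zero_if_bounded_below)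
qed

text \<open>Equal to \<open>t powr (- 1 / 2)\<close> on the spectrum, but bounded on the whole
  line.\<close>

definition root :: "real \<Rightarrow> real" where "root t = max t (1/2) powr (- 1 / 2)"

lemma root_nonneg: "0 \<le> root t"
  by (simp add: root_def)

lemma bounded_root: "calc.bounded_borel root"
  unfolding calc.bounded_borel_def root_def
proof (intro conjI exI[of _ "(1/2) powr (- 1 / 2)"] allI)
  show "(\<lambda>t :: real. max t (1/2) powr (- 1 / 2)) \<in> borel_measurable borel" by measurable
  show "\<bar>max t (1/2) powr (- 1 / 2)\<bar> \<le> (1/2) powr (- 1 / 2)" for t :: real
    by (auto intro!: powr_mono2')
qed

lemma root_inverse: "1 \<le> t \<Longrightarrow> t powr (1 / 2) * root t = 1"
  by (simp add: root_def max_def flip: powr_add)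

section \<open>The inverse square root as an isometry onto the energy space\<close>

definition R :: "'h \<Rightarrow> 'h" where "R = calc.Phi root"

lemma R_X: "z \<in> X \<Longrightarrow> R z \<in> X"
  and R_add: "z \<in> X \<Longrightarrow> w \<in> X \<Longrightarrow> R (z + w) = R z + R w"
  and R_scale: "z \<in> X \<Longrightarrow> R (c *\<^sub>R z) = c *\<^sub>R R z"
  and R_sym: "z \<in> X \<Longrightarrow> w \<in> X \<Longrightarrow> R z \<bullet> w = z \<bullet> R w"
  unfolding R_def
  by (simp_all add: calc.Phi_mem calc.Phi_add calc.Phi_scale calc.Phi_commute bounded_root)

lemma R_diff: "z \<in> X \<Longrightarrow> w \<in> X \<Longrightarrow> R (z - w) = R z - R w"
  using R_add[of z "(-1) *\<^sub>R w"] R_scale[of w "-1"] inverse.calc.scale_mem[of w "-1"] by simp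

text \<open>\<open>T\<close> comes from the form and \<open>R\<close> from the chosen
  \<open>E\<close>. They are linked because \<open>T\<close> and the integral of
  \<open>root\<^sup>2\<close> both have the transposed graph of \<open>G\<close>.\<close>

lemma R_R: assumes z: "z \<in> X" shows "R (R z) = T z"
proof -
  let ?g = "\<lambda>t. root t * root t"
  have g: "calc.bounded_borel ?g" by (intro calc.bounded_borel_mult bounded_root)
  have "t * (root t * root t) = 1" if "1 \<le> t" for t
  proof -
    have "t = t powr (1 / 2) * t powr (1 / 2)"
      using that by (simp flip: powr_add)
    then have "t * (root t * root t) = (t powr (1 / 2) * t powr (1 / 2)) * (root t * root t)"
      by (rule arg_cong)
    also have "\<dots> = (t powr (1 / 2) * root t) * (t powr (1 / 2) * root t)"
      by (simp only: mult_ac)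
    finally show ?thesis using root_inverse[OF that] by simp
  qed
  then have "G = {(calc.Phi ?g z, z) |z. z \<in> X}"
    unfolding E(2) by (intro calc.spectral_integral_inverse g) (auto simp: root_nonneg)
  moreover have "(T z, z) \<in> G" using z by (auto simp: G_eq)
  ultimately have "T z = calc.Phi ?g z" by auto
  then show ?thesis
    using z by (simp add: R_def calc.Phi_Phi bounded_root root_nonneg)
qed

lemma R_inj: "z \<in> X \<Longrightarrow> R z = 0 \<Longrightarrow> z = 0"
  using R_R[of z] inverse.T_inj[of z] R_scale[of 0 0] inverse.calc.zero_mem by simp

lemma op_power_half: "op_power X G (1 / 2) = {(R z, z) |z. z \<in> X}"
  unfolding op_power_def E_def[symmetric] R_def
  by (rule calc.spectral_integral_inverse[OF _ bounded_root root_nonneg root_inverse]) measurable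

lemma op_power_minus_half: "op_power X G (- 1 / 2) = {(z, R z) |z. z \<in> X}"
proof -
  have "op_power X G (- 1 / 2) = spectral_integral X E root"
    unfolding op_power_def E_def[symmetric]
    by (rule calc.spectral_integral_cong)
      (use bounded_root in \<open>auto simp: root_def max_def calc.bounded_borel_measurable\<close>)
  then show ?thesis
    using calc.spectral_integral_bounded_borel[OF bounded_root] by (simp add: R_def)
qed

lemma op_apply_half: "z \<in> X \<Longrightarrow> op_apply (op_power X G (1 / 2)) (R z) = z"
  unfolding op_apply_def op_power_half
proof (rule the_equality)
  fix w assume "z \<in> X" "(R z, w) \<in> {(R z, z) |z. z \<in> X}"
  then have "R z = R w" "w \<in> X" by auto
  then show "w = z" using R_inj[of "w - z"] \<open>z \<in> X\<close> by (simp add: R_diff inverse.calc.diff_mem)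
qed auto

lemma op_apply_minus_half: "z \<in> X \<Longrightarrow> op_apply (op_power X G (- 1 / 2)) z = R z"
  unfolding op_apply_def op_power_minus_half by (rule the_equality) auto

text \<open>\<open>R z\<close> is approximated by the elements \<open>T (f n)\<close> of the domain of \<open>G\<close>, where
  \<open>R (f n) = E n z\<close>.\<close>

lemma
  assumes z: "z \<in> X"
  shows R_mem: "R z \<in> V" and form_R_R: "w \<in> X \<Longrightarrow> R w \<in> V \<Longrightarrow> a (R z) (R w) = z \<bullet> w"
proof -
  \<comment> \<open>Cutting off the reciprocal of \<open>root\<close> keeps it bounded, so that
    \<open>f n\<close> exists for every \<open>z\<close> in \<open>X\<close>.\<close>
  define h where "h n t = max t (1/2) powr (1 / 2) * indicator {..real n} t" for n :: nat and t :: real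
  have h_nonneg: "0 \<le> h n t" for n t by (simp add: h_def)
  have h: "calc.bounded_borel (h n)" for n
    unfolding calc.bounded_borel_def
  proof (intro conjI exI[of _ "(real n + 1) powr (1 / 2)"] allI)
    show "h n \<in> borel_measurable borel" unfolding h_def by measurable
    show "\<bar>h n t\<bar> \<le> (real n + 1) powr (1 / 2)" for t
      by (auto simp: h_def indicator_def intro!: powr_mono2)
  qed
  define f where "f n = calc.Phi (h n) z" for n
  have f: "f n \<in> X" for n unfolding f_def by (rule calc.Phi_mem[OF h z])
  have "(\<lambda>t. root t * h n t) = indicator {..real n}" for n
    by (auto simp: root_def h_def mult.assoc[symmetric] simp flip: powr_add)
  then have Rf: "R (f n) = E (real n) z" for n
    using z by (simp add: R_def f_def calc.Phi_Phi bounded_root h h_nonneg calc.Phi_indicator_atMost)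
  have Rf_lim: "(\<lambda>n. R (f n)) \<longlonglongrightarrow> z"
    unfolding Rf by (rule filterlim_compose[OF calc.E_at_top[OF z] filterlim_real_sequentially])
  have form_T: "a (T x) (T x) = (norm (R x))\<^sup>2" if "x \<in> X" for x
  proof -
    have "a (T x) (T x) = x \<bullet> T x" by (rule T_form[OF T_mem])
    also have "\<dots> = x \<bullet> R (R x)" using that by (simp add: R_R)
    also have "\<dots> = (norm (R x))\<^sup>2"
      using that by (simp add: R_X power2_norm_eq_inner flip: R_sym)
    finally show ?thesis .
  qed
  have T_diff: "T x - T y = T (x - y)" for x y
    by (simp add: linear_diff[OF inverse.linear_T])
  \<comment> \<open>By \<open>form_T\<close> the energy of \<open>T (f m) - T (f n)\<close> is the
    squared distance of \<open>R (f m)\<close> and \<open>R (f n)\<close>, which converge to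
    \<open>z\<close>.\<close>
  have "\<exists>u\<in>V. (\<lambda>n. a (T (f n) - u) (T (f n) - u)) \<longlonglongrightarrow> 0"
  proof (rule form.limit_exists[OF T_mem])
    fix e :: real assume e: "0 < e"
    have "Cauchy (\<lambda>n. R (f n))" using Rf_lim by (rule LIMSEQ_imp_Cauchy)
    then obtain N where N: "\<And>m n. N \<le> m \<Longrightarrow> N \<le> n \<Longrightarrow> norm (R (f m) - R (f n)) < sqrt e"
      using CauchyD[of "\<lambda>n. R (f n)" "sqrt e"] e by auto
    have "a (T (f m) - T (f n)) (T (f m) - T (f n)) < e" if "N \<le> m" "N \<le> n" for m n
    proof -
      have "(norm (R (f m) - R (f n)))\<^sup>2 < (sqrt e)\<^sup>2"
        using N[OF that] by (intro power_strict_mono) auto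
      then show ?thesis
        using e f by (simp add: T_diff form_T R_diff inverse.calc.diff_mem)
    qed
    then show "\<exists>N. \<forall>m\<ge>N. \<forall>n\<ge>N. a (T (f m) - T (f n)) (T (f m) - T (f n)) < e" by blast
  qed
  then obtain u where u: "u \<in> V" and lim: "(\<lambda>n. a (T (f n) - u) (T (f n) - u)) \<longlonglongrightarrow> 0" by blast
  have mem: "T (f n) - u \<in> V" for n by (intro form.diff_mem T_mem u)
  have "(\<lambda>n. (norm (T (f n) - u))\<^sup>2) \<longlonglongrightarrow> 0"
    by (rule tendsto_sandwich[OF _ _ tendsto_const lim]) (simp_all add: coercive[OF mem])
  then have "(\<lambda>n. norm (T (f n) - u)) \<longlonglongrightarrow> 0" by (simp add: tendsto_null_power)
  then have Tu: "(\<lambda>n. T (f n)) \<longlonglongrightarrow> u" by (simp add: LIM_zero_iff tendsto_norm_zero_iff)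
  \<comment> \<open>\<open>T (f n)\<close> is \<open>R (R (f n))\<close> and \<open>R\<close> is a
    contraction on \<open>X\<close>; this identifies the limit \<open>u\<close> in energy with
    \<open>R z\<close>.\<close>
  have "(\<lambda>n. T (f n)) \<longlonglongrightarrow> R z"
  proof -
    have bound: "norm (R x) \<le> norm x" if x: "x \<in> X" for x
    proof -
      have "(norm (R x))\<^sup>2 = x \<bullet> T x"
        using x by (simp add: power2_norm_eq_inner R_sym R_X R_R)
      also have "\<dots> \<le> (norm x)\<^sup>2" using inverse.T_le[of x] by (simp add: inner_commute)
      finally show ?thesis by (rule power2_le_imp_le) simp
    qed
    have "(\<lambda>n. T (f n) - R z) \<longlonglongrightarrow> 0"
    proof (rule Lim_null_comparison)
      show "\<forall>\<^sub>F n in sequentially. norm (T (f n) - R z) \<le> norm (R (f n) - z)"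
        using bound[OF inverse.calc.diff_mem[OF R_X[OF f] z]] f z
        by (simp add: R_R[symmetric] R_diff R_X)
      show "(\<lambda>n. norm (R (f n) - z)) \<longlonglongrightarrow> 0"
        using Rf_lim by (simp add: LIM_zero tendsto_norm_zero)
    qed
    then show ?thesis by (simp add: LIM_zero_iff)
  qed
  then have Rz: "R z = u" using Tu by (rule LIMSEQ_unique)
  with u show RV: "R z \<in> V" by simp
  have conv: "(\<lambda>n. f n \<bullet> v) \<longlonglongrightarrow> a (R z) v" if v: "v \<in> V" for v
  proof -
    have "(\<lambda>n. a (T (f n) - u) (T (f n) - u) * a v v) \<longlonglongrightarrow> 0 * a v v"
      by (intro tendsto_intros lim)
    then have "(\<lambda>n. a (T (f n) - u) (T (f n) - u) * a v v) \<longlonglongrightarrow> 0" by simp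
    then have "(\<lambda>n. (a (T (f n) - u) v)\<^sup>2) \<longlonglongrightarrow> 0"
      by (rule tendsto_sandwich[OF _ _ tendsto_const, rotated 2])
        (auto intro!: always_eventually form.Cauchy_Schwarz mem v)
    then have "(\<lambda>n. a (T (f n) - u) v) \<longlonglongrightarrow> 0" by (simp add: tendsto_null_power)
    then show ?thesis
      by (simp add: Rz form.diff_left[OF T_mem u v] T_form[OF v] LIM_zero_iff)
  qed
  show "a (R z) (R w) = z \<bullet> w" if w: "w \<in> X" and wV: "R w \<in> V" for w
  proof (rule LIMSEQ_unique[OF conv[OF wV]])
    have "(\<lambda>n. R (f n) \<bullet> w) \<longlonglongrightarrow> z \<bullet> w" by (intro tendsto_intros Rf_lim)
    then show "(\<lambda>n. f n \<bullet> R w) \<longlonglongrightarrow> z \<bullet> w" using w f by (simp add: R_sym)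
  qed
qed

lemma R_isometry: "z \<in> X \<Longrightarrow> w \<in> X \<Longrightarrow> a (R z) (R w) = z \<bullet> w"
  by (intro form_R_R R_mem)

text \<open>Subtracting the Riesz representative leaves a vector \<open>v\<close> orthogonal in
  energy to the range of \<open>R\<close>. That range contains \<open>T v = R (R v)\<close>, and
  \<open>a v (T v)\<close> is \<open>v \<bullet> v\<close>.\<close>

lemma R_surj:
  assumes u: "u \<in> V" shows "\<exists>z\<in>X. R z = u"
proof -
  have "\<exists>z\<in>X. \<forall>w\<in>X. z \<bullet> w = a u (R w)"
  proof (rule inverse.calc.riesz[of _ "sqrt (a u u)"])
    fix w assume w: "w \<in> X"
    have "(a u (R w))\<^sup>2 \<le> a u u * (w \<bullet> w)"
      using form.Cauchy_Schwarz[OF u R_mem[OF w]] by (simp add: R_isometry w)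
    then have "sqrt ((a u (R w))\<^sup>2) \<le> sqrt (a u u * (w \<bullet> w))" by (rule real_sqrt_le_mono)
    then show "\<bar>a u (R w)\<bar> \<le> sqrt (a u u) * sqrt (w \<bullet> w)" by (simp add: real_sqrt_mult)
  qed (simp_all add: R_add R_scale form.add_right form.scale_right R_mem u)
  then obtain z where z: "z \<in> X" "\<And>w. w \<in> X \<Longrightarrow> z \<bullet> w = a u (R w)" by blast
  define v where "v = u - R z"
  have v: "v \<in> V" unfolding v_def by (intro form.diff_mem u R_mem z)
  then have vX: "v \<in> X" using V_X by blast
  have "a v (R w) = 0" if w: "w \<in> X" for w
    unfolding v_def form.diff_left[OF u R_mem[OF z(1)] R_mem[OF w]]
    using z w by (simp add: R_isometry)
  from this[OF R_X[OF vX]] have "a v (T v) = 0" by (simp add: R_R vX)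
  then have "v \<bullet> v = 0"
    using T_form[OF v, of v] by (simp add: form.sym[OF v T_mem])
  then show ?thesis using z by (auto simp: v_def)
qed

end

section \<open>The regularized problem\<close>

lemma coercive_form_sobolev:
  fixes \<Omega> :: "'a::euclidean_space set"
  assumes \<Omega>: "open \<Omega>" "bounded \<Omega>" and s: "0 < s" "s < 1"
  shows "coercive_form (H0 s \<Omega>) (sobolev_form s \<Omega>) (L2_on \<Omega>) (restrict_L2 \<Omega>)"
proof -
  have borel: "\<Omega> \<in> sets borel" using \<Omega> by simp
  show ?thesis
  proof (rule coercive_form.intro)
    show "complete_form (H0 s \<Omega>) (sobolev_form s \<Omega>)"
      by (rule complete_form_sobolev[OF borel s])
    show "coercive_form_axioms (H0 s \<Omega>) (sobolev_form s \<Omega>) (L2_on \<Omega>) (restrict_L2 \<Omega>)"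
      by (rule coercive_form_axioms.intro)
        (use subspace_L2_on[OF borel] closed_L2_on[OF borel] bounded_linear_restrict[OF borel]
          restrict_L2_sym[OF borel] restrict_L2_mem[OF borel] restrict_L2_id[OF borel]
          norm_le_sobolev_form[OF borel s] H0_dense[OF s \<Omega>] in \<open>auto simp: H0_eq\<close>)
  qed
qed

text \<open>\<open>z0\<close> solves the normal equation, by Riesz for the form \<open>b\<close>.
  Completing the square, \<open>J z - J z0\<close> is half of \<open>b (z - z0) (z - z0)\<close>;
  the quadratic growth gives uniqueness together with existence.\<close>

lemma regularized_least_squares:
  fixes X :: "'h::real_inner set" and Y :: "'k::real_inner set" and y :: 'k
  assumes X: "subspace X" "complete X" and B: "linear_between X Y B"
    and bound: "\<And>z. z \<in> X \<Longrightarrow> norm (B z) \<le> M * norm z" and \<alpha>: "0 < \<alpha>"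
  defines "J \<equiv> \<lambda>z. 1 / 2 * (norm (B z - y))\<^sup>2 + \<alpha> / 2 * (norm z)\<^sup>2"
  shows "\<exists>z0\<in>X. \<forall>z\<in>X. J z0 + \<alpha> / 2 * (norm (z - z0))\<^sup>2 \<le> J z"
proof -
  define b where "b z w = B z \<bullet> B w + \<alpha> * (z \<bullet> w)" for z w
  have B_add: "B (z + w) = B z + B w" if "z \<in> X" "w \<in> X" for z w
    using B that by (simp add: linear_between_def)
  have B_scale: "B (c *\<^sub>R z) = c *\<^sub>R B z" if "z \<in> X" for c z
    using B that by (simp add: linear_between_def)
  have b_self: "b z z = (norm (B z))\<^sup>2 + \<alpha> * (norm z)\<^sup>2" for z
    by (simp add: b_def power2_norm_eq_inner)
  interpret complete_form X b
  proof
    fix x :: "nat \<Rightarrow> 'h"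
    assume x: "\<And>n. x n \<in> X"
      and C: "\<And>e. 0 < e \<Longrightarrow> \<exists>N. \<forall>m\<ge>N. \<forall>n\<ge>N. b (x m - x n) (x m - x n) < e"
    have "Cauchy x"
    proof (rule metric_CauchyI)
      fix e :: real assume e: "0 < e"
      then obtain N where N: "\<And>m n. N \<le> m \<Longrightarrow> N \<le> n \<Longrightarrow> b (x m - x n) (x m - x n) < \<alpha> * e\<^sup>2"
        using C[of "\<alpha> * e\<^sup>2"] \<alpha> by auto
      have "dist (x m) (x n) < e" if "N \<le> m" "N \<le> n" for m n
      proof -
        have "\<alpha> * (norm (x m - x n))\<^sup>2 < \<alpha> * e\<^sup>2"
          using N[OF that] zero_le_power2[of "norm (B (x m - x n))"] unfolding b_self by linarith
        then have "(dist (x m) (x n))\<^sup>2 < e\<^sup>2" using \<alpha> by (simp add: dist_norm)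
        then show ?thesis using e by (simp add: power2_less_imp_less)
      qed
      then show "\<exists>N. \<forall>m\<ge>N. \<forall>n\<ge>N. dist (x m) (x n) < e" by blast
    qed
    then obtain u where u: "u \<in> X" "x \<longlonglongrightarrow> u"
      using X(2) x unfolding complete_def by blast
    have "(\<lambda>n. M\<^sup>2 * (norm (x n - u))\<^sup>2 + \<alpha> * (norm (x n - u))\<^sup>2) \<longlonglongrightarrow> M\<^sup>2 * (norm (u - u))\<^sup>2 + \<alpha> * (norm (u - u))\<^sup>2"
      by (intro tendsto_intros u)
    then have lim: "(\<lambda>n. M\<^sup>2 * (norm (x n - u))\<^sup>2 + \<alpha> * (norm (x n - u))\<^sup>2) \<longlonglongrightarrow> 0" by simp
    have le: "b (x n - u) (x n - u) \<le> M\<^sup>2 * (norm (x n - u))\<^sup>2 + \<alpha> * (norm (x n - u))\<^sup>2" for n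
      using power_mono[OF bound[OF subspace_diff[OF X(1) x[of n] u(1)]] norm_ge_zero, of 2]
      by (simp add: b_self power_mult_distrib)
    have "0 \<le> b (x n - u) (x n - u)" for n using \<alpha> by (simp add: b_self)
    then have "(\<lambda>n. b (x n - u) (x n - u)) \<longlonglongrightarrow> 0"
      using le by (intro tendsto_sandwich[OF _ _ tendsto_const lim]) simp_all
    with u show "\<exists>u\<in>X. (\<lambda>n. b (x n - u) (x n - u)) \<longlonglongrightarrow> 0" by blast
  qed (use X \<alpha> in \<open>auto simp: b_def B_add B_scale inner_add_left distrib_left algebra_simps inner_commute\<close>)
  have "\<exists>z0\<in>X. \<forall>z\<in>X. b z0 z = y \<bullet> B z"
  proof (rule riesz[of _ "norm y"])
    fix z assume "z \<in> X"
    have "norm (B z) \<le> sqrt (b z z)" using \<alpha> by (intro real_le_rsqrt) (simp add: b_self)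
    then have "norm y * norm (B z) \<le> norm y * sqrt (b z z)" by (rule mult_left_mono) simp
    then show "\<bar>y \<bullet> B z\<bar> \<le> norm y * sqrt (b z z)"
      using Cauchy_Schwarz_ineq2[of y "B z"] by linarith
  qed (simp_all add: B_add B_scale inner_add_right)
  then obtain z0 where z0: "z0 \<in> X" "\<And>z. z \<in> X \<Longrightarrow> b z0 z = y \<bullet> B z" by blast
  have J: "J z = 1 / 2 * b z z - b z0 z + 1 / 2 * (norm y)\<^sup>2" if "z \<in> X" for z
    unfolding z0(2)[OF that] b_self J_def
    by (simp add: power2_norm_eq_inner inner_diff_left inner_diff_right inner_commute algebra_simps)
  have "J z0 + \<alpha> / 2 * (norm (z - z0))\<^sup>2 \<le> J z" if z: "z \<in> X" for z
  proof -
    have "b (z - z0) (z - z0) = b z z - 2 * b z0 z + b z0 z0"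
      using z z0(1) sym[OF z z0(1)] by (simp add: diff_left diff_right diff_mem)
    then have "J z = J z0 + 1 / 2 * b (z - z0) (z - z0)"
      using J[OF z] J[OF z0(1)] by (simp add: field_simps)
    then show ?thesis using zero_le_power2[of "norm (B (z - z0))"] unfolding b_self by simp
  qed
  with z0(1) show ?thesis by blast
qed

theorem proposition3p2:
  fixes \<Omega> :: "(real ^ 'n) set" and s \<alpha> :: real
    and y :: "(real ^ 'n) L2" and K :: "(real ^ 'n) L2 \<Rightarrow> (real ^ 'n) L2"
  assumes "bounded_lipschitz_domain \<Omega>"
    and "0 < s" and "s < 1"
    and "\<alpha> > 0"
    and "y \<in> L2_on \<Omega>"
    and "bounded_linear_H0_L2 s \<Omega> K"
  shows
    "\<comment> \<open>the change of variables is a bijection which matches the functionals\<close>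
     (\<forall>u \<in> H0 s \<Omega>. A_pow s \<Omega> (1 / 2) u \<in> L2_on \<Omega> \<and>
        A_pow s \<Omega> (- 1 / 2) (A_pow s \<Omega> (1 / 2) u) = u \<and>
        J_tilde s \<Omega> K y \<alpha> (A_pow s \<Omega> (1 / 2) u) = J_fun s \<Omega> K y \<alpha> u) \<and>
     (\<forall>z \<in> L2_on \<Omega>. A_pow s \<Omega> (- 1 / 2) z \<in> H0 s \<Omega> \<and>
        A_pow s \<Omega> (1 / 2) (A_pow s \<Omega> (- 1 / 2) z) = z \<and>
        J_fun s \<Omega> K y \<alpha> (A_pow s \<Omega> (- 1 / 2) z) = J_tilde s \<Omega> K y \<alpha> z) \<and>
     \<comment> \<open>minimizers correspond to minimizers\<close>
     (\<forall>u \<in> H0 s \<Omega>.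
        is_arg_min (J_fun s \<Omega> K y \<alpha>) (\<lambda>u. u \<in> H0 s \<Omega>) u \<longleftrightarrow>
        is_arg_min (J_tilde s \<Omega> K y \<alpha>) (\<lambda>z. z \<in> L2_on \<Omega>) (A_pow s \<Omega> (1 / 2) u)) \<and>
     \<comment> \<open>the unique minimizer of the transformed problem gives the minimizer of the original one\<close>
     (\<exists>!z. is_arg_min (J_tilde s \<Omega> K y \<alpha>) (\<lambda>z. z \<in> L2_on \<Omega>) z) \<and>
     (\<forall>z. is_arg_min (J_tilde s \<Omega> K y \<alpha>) (\<lambda>z. z \<in> L2_on \<Omega>) z \<longrightarrow>
        (\<forall>u. is_arg_min (J_fun s \<Omega> K y \<alpha>) (\<lambda>u. u \<in> H0 s \<Omega>) u \<longleftrightarrow>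
             u = A_pow s \<Omega> (- 1 / 2) z))"
proof -
  have \<Omega>: "open \<Omega>" "bounded \<Omega>" using assms(1) by (auto simp: bounded_lipschitz_domain_def)
  interpret coercive_form "H0 s \<Omega>" "sobolev_form s \<Omega>" "L2_on \<Omega>" "restrict_L2 \<Omega>"
    by (rule coercive_form_sobolev[OF \<Omega> assms(2,3)])
  define J where "J = J_fun s \<Omega> K y \<alpha>"
  define J' where "J' = J_tilde s \<Omega> K y \<alpha>"
  define S where "S = A_pow s \<Omega> (1 / 2)"
  define Q where "Q = A_pow s \<Omega> (- 1 / 2)"
  \<comment> \<open>Outside \<open>L2_on \<Omega>\<close> the graph of the power has no pairs and
    \<open>op_apply\<close> is unspecified, so these identities are confined to
    \<open>L2_on \<Omega>\<close>.\<close>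
  have Q: "Q z = R z" if "z \<in> L2_on \<Omega>" for z
    using op_apply_minus_half[OF that] by (simp add: Q_def A_pow_def A_op_def)
  have S_R: "S (R z) = z" if "z \<in> L2_on \<Omega>" for z
    using op_apply_half[OF that] by (simp add: S_def A_pow_def A_op_def)
  have H0_norm_R: "H0_norm s \<Omega> (R z) = norm z" if "z \<in> L2_on \<Omega>" for z
    using R_isometry[OF that that] by (simp add: H0_norm_def norm_eq_sqrt_inner)
  have J'_eq: "J' z = 1 / 2 * (norm (K (R z) - y))\<^sup>2 + \<alpha> / 2 * (norm z)\<^sup>2" if "z \<in> L2_on \<Omega>" for z
    unfolding J'_def J_tilde_def Let_def Q_def[symmetric] o_apply Q[OF that] ..
  have J_R: "J (R z) = J' z" if "z \<in> L2_on \<Omega>" for z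
    using that by (simp add: J_def J_fun_def J'_eq H0_norm_R)
  \<comment> \<open>\<open>S\<close> is known so far only on vectors \<open>R z\<close>;
    surjectivity of \<open>R\<close> makes these the whole energy space.\<close>
  have to_L2: "S u \<in> L2_on \<Omega>" "R (S u) = u" if u: "u \<in> H0 s \<Omega>" for u
    using R_surj[OF u] S_R by auto
  have J_S: "J' (S u) = J u" if u: "u \<in> H0 s \<Omega>" for u
    using J_R[OF to_L2(1)[OF u]] to_L2(2)[OF u] by simp
  obtain M where M: "\<And>u. u \<in> H0 s \<Omega> \<Longrightarrow> norm (K u) \<le> M * H0_norm s \<Omega> u"
    using assms(6) by (auto simp: bounded_linear_H0_L2_def)
  have lin: "linear_between (L2_on \<Omega>) (L2_on \<Omega>) (\<lambda>z. K (R z))"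
    using assms(6) R_mem
    by (simp add: linear_between_def bounded_linear_H0_L2_def R_add R_scale)
  have bound: "norm (K (R z)) \<le> M * norm z" if "z \<in> L2_on \<Omega>" for z
    using M[OF R_mem[OF that]] by (simp add: H0_norm_R that)
  obtain z0 where z0: "z0 \<in> L2_on \<Omega>"
    and growth: "\<And>z. z \<in> L2_on \<Omega> \<Longrightarrow> J' z0 + \<alpha> / 2 * (norm (z - z0))\<^sup>2 \<le> J' z"
    using regularized_least_squares[OF X(1) complete_eq_closed[THEN iffD2, OF X(2)] lin bound assms(4), of y]
    by (auto simp: J'_eq)
  have J'_min: "is_arg_min J' (\<lambda>z. z \<in> L2_on \<Omega>) z \<longleftrightarrow> z = z0" for z
  proof
    assume min: "is_arg_min J' (\<lambda>z. z \<in> L2_on \<Omega>) z"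
    then have z: "z \<in> L2_on \<Omega>" "J' z \<le> J' z0" using z0 by (auto simp: is_arg_min_def not_less)
    then have "\<alpha> / 2 * (norm (z - z0))\<^sup>2 \<le> 0" using growth[OF z(1)] by linarith
    then show "z = z0" using assms(4) by (simp add: mult_le_0_iff)
  next
    have "J' z0 \<le> J' z" if "z \<in> L2_on \<Omega>" for z
      using growth[OF that] assms(4) zero_le_power2[of "norm (z - z0)"]
      by (smt (verit) divide_nonneg_nonneg mult_nonneg_nonneg)
    then show "is_arg_min J' (\<lambda>z. z \<in> L2_on \<Omega>) z" if "z = z0"
      using that z0 by (auto simp: is_arg_min_def not_less)
  qed
  have min_iff: "is_arg_min J (\<lambda>u. u \<in> H0 s \<Omega>) u \<longleftrightarrow> is_arg_min J' (\<lambda>z. z \<in> L2_on \<Omega>) (S u)"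
    if u: "u \<in> H0 s \<Omega>" for u
    unfolding is_arg_min_def using u to_L2 J_S J_R R_mem by metis
  have J_min: "is_arg_min J (\<lambda>u. u \<in> H0 s \<Omega>) u \<longleftrightarrow> u = R z0" for u
  proof
    assume min: "is_arg_min J (\<lambda>u. u \<in> H0 s \<Omega>) u"
    then have u: "u \<in> H0 s \<Omega>" by (simp add: is_arg_min_def)
    with min have "S u = z0" by (simp add: min_iff J'_min)
    then show "u = R z0" using to_L2(2)[OF u] by simp
  next
    assume "u = R z0"
    then show "is_arg_min J (\<lambda>u. u \<in> H0 s \<Omega>) u"
      by (simp add: min_iff R_mem z0 J'_min S_R)
  qed
  \<comment> \<open>Once both minimizer predicates are rewritten as equations, this is what remains
    of the correspondence of minimizers.\<close>
  have "u = R z0 \<longleftrightarrow> S u = z0" if "u \<in> H0 s \<Omega>" for u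
    using to_L2[OF that] S_R[OF z0] by auto
  then show ?thesis
    unfolding J_def[symmetric] J'_def[symmetric] S_def[symmetric] Q_def[symmetric]
    by (simp add: to_L2 J_S Q R_mem S_R J_R min_iff J'_min J_min z0)
qed

end
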